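(* Let $\mathcal{F}$ be the family of independent sets of a matroid on $U$, let the cost function $g$ be separable, $g(z)=\sum_{i=1}^d g_i(z_i)$, and suppose the standing Assumption below holds. Suppose algorithm $\mathsf{SubmodMS}$ satisfies the SubmodMS Assumption below and is $\alpha$-competitive in expectation. Then Algorithm OA (constrained version, described below) achieves expected profit at least $\mathrm{opt}/O(\alpha d^2)$.
   Context: Setting: a universe $U$ of $n$ items (with $n$ known), item $e$ having value $v(e)\ge0$ and size $s(e)\in\mathbb{R}^d_{\ge0}$; items arrive in uniformly random order and must be irrevocably accepted or rejected on arrival; the accepted set must lie in the downward-closed family $\mathcal{F}$. For $x\in[0,1]^n$, $\pi(x)=\langle v,x\rangle-g(Sx)$ where $S$ has the sizes as columns; sets are identified with indicator vectors. $\mathrm{opt}=\max_{A\in\mathcal{F}}\pi(A)$. For $A\subseteq U$, $\mathcal{F}|_A=\{B\in\mathcal{F}:B\subseteq A\}$ and $\mathrm{fopt}(A)=\max\{\pi(x):x\in\mathrm{Conv}(\mathcal{F}|_A)\}$. Standing Assumption: $g:\mathbb{R}^d_{\ge0}\to\mathbb{R}_{\ge0}$ is non-decreasing, strictly convex, closed, differentiable, $g(0)=0$, supermodular, and its gradients tend to $+\infty$ along every positive direction; items are in general position (in particular for each $\lambda\in\mathbb{R}^d_{\ge0}$ at most one item $e$ has $v(e)=\langle\lambda,s(e)\rangle$); no item is exceptional ($e$ is exceptional if $\arg\max_{\theta\in[0,1]}\{\theta v(e)-g(\theta s(e))\}\in(0,1)$); every item has $\pi(\{e\})\le\mathrm{opt}/(\eta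 d)$ for a constant $\eta\ge10^4$. SubmodMS Assumption: $\mathsf{SubmodMS}$ takes a non-negative monotone submodular set function $f$ with $f(\emptyset)=0$ and a number $N$; run on a sequence $X$ of $N$ elements presented in random order it returns a random set $X_{alg}\in\mathcal{F}$ with $\mathbb{E}[f(X_{alg})]\ge\frac1\alpha\max_{X'\in\mathcal{F}}f(X')$ (maximum over feasible subsets of $X$), and it evaluates $f$ only on feasible sets. Curve $\mathcal{C}$: with $g_i(t)=g(t\mathbf{e}_i)$ and $g_i^\star(u)=\sup_{t\ge0}(ut-g_i(t))$, for $\tau>0$ let $\lambda(\tau)$ be the unique vector with $g_i^\star(\lambda_i(\tau))=\tau$ for all $i$; $\mathcal{C}$ is the union of $\{\lambda(\tau):\tau>0\}$ with a monotone curve from $0$ to $(g_1'(0),\dots,g_d'(0))$, totally ordered coordinatewise. For a set $X$ and $\mu$, $X_\mu=\{e\in X:v(e)\ge\langle\mu,s(e)\rangle\}$. Algorithm OA (constrained version): (1) $L$ = first $\mathrm{Binomial}(n,1/2)$ items; (2) $\mu$ = largest vector on $\mathcal{C}$ with $\mathrm{fopt}(L_\mu)\ge\frac1{12d}\mathrm{fopt}(L)$; (3) $R$ = remaining items, $R^\circ_\mu=\{e\in R:v(e)>\langle\mu,s(e)\rangle\}$; (4) run $\mathsf{SubmodMS}$ on $R^\circ_\mu$ with profit function $\pi$, accepting items as it does, except never adding an item that decreases the profit of the current solution. *)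

theory Defs
  imports "HOL-Probability.Probability" "HOL-Combinatorics.Combinatorics"
begin

text \<open>
  The constant hidden in the O-notation must not depend on the dimension \<open>d\<close> or on the
  number of items, so neither may be encoded in a type: items are natural numbers from a finite set
  \<open>U\<close>, and a vector of the \<open>d\<close>-dimensional space is a function \<open>nat \<Rightarrow> real\<close> that vanishes
  outside \<open>{..<d}\<close>.  On such functions the pointwise order, lattice operations and topology of
  the function space are those of the Euclidean space.
\<close>

type_synonym rvec = "nat \<Rightarrow> real"

definition orthant :: "nat \<Rightarrow> rvec set" where
  "orthant d = {z. (\<forall>i<d. 0 \<le> z i) \<and> (\<forall>i\<ge>d. z i = 0)}"

definition dotp :: "nat \<Rightarrow> rvec \<Rightarrow> rvec \<Rightarrow> real" where
  "dotp d x y = (\<Sum>i<d. x i * y i)"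


subsection \<open>Feasible sets\<close>

definition matroid :: "nat set \<Rightarrow> nat set set \<Rightarrow> bool" where
  "matroid U F \<longleftrightarrow>
     F \<subseteq> Pow U \<and> {} \<in> F \<and>
     (\<forall>A\<in>F. \<forall>B. B \<subseteq> A \<longrightarrow> B \<in> F) \<and>
     (\<forall>A\<in>F. \<forall>B\<in>F. card A < card B \<longrightarrow> (\<exists>e\<in>B - A. insert e A \<in> F))"

definition restrict_family :: "nat set set \<Rightarrow> nat set \<Rightarrow> nat set set" where
  "restrict_family F A = {B \<in> F. B \<subseteq> A}"

text \<open>Convex hull of the indicator vectors of the members of a finite family of sets
  (the function space is not a \<open>real_vector\<close>, so \<open>convex hull\<close> is not available).\<close>

definition conv :: "nat set set \<Rightarrow> rvec set" where
  "conv G = {x. \<exists>c. (\<forall>B\<in>G. 0 \<le> c B) \<and> (\<Sum>B\<in>G. c B) = 1 \<and>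
                    x = (\<lambda>e. \<Sum>B\<in>G. c B * indicat_real B e)}"


subsection \<open>Cost functions\<close>

definition has_gradient :: "nat \<Rightarrow> (rvec \<Rightarrow> real) \<Rightarrow> rvec \<Rightarrow> rvec \<Rightarrow> bool" where
  "has_gradient d g G z \<longleftrightarrow>
     (\<forall>\<epsilon>>0. \<exists>\<delta>>0. \<forall>y\<in>orthant d. L2_set (\<lambda>i. y i - z i) {..<d} < \<delta> \<longrightarrow>
        \<bar>g y - g z - dotp d G (\<lambda>i. y i - z i)\<bar> \<le> \<epsilon> * L2_set (\<lambda>i. y i - z i) {..<d})"

text \<open>Only the values of \<open>g\<close> on the orthant matter.  A positive direction is a nonzero
  element \<open>u\<close> of the orthant, and the gradient tends to infinity along \<open>u\<close> in the sense that its
  component in direction \<open>u\<close> does.\<close>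

definition cost_function :: "nat \<Rightarrow> (rvec \<Rightarrow> real) \<Rightarrow> bool" where
  "cost_function d g \<longleftrightarrow>
     (\<forall>z\<in>orthant d. 0 \<le> g z) \<and>
     g (\<lambda>_. 0) = 0 \<and>
     mono_on (orthant d) g \<and>
     (\<forall>x\<in>orthant d. \<forall>y\<in>orthant d. \<forall>t. x \<noteq> y \<and> 0 < t \<and> t < 1 \<longrightarrow>
        g (\<lambda>i. (1 - t) * x i + t * y i) < (1 - t) * g x + t * g y) \<and>
     closed (epigraph (orthant d) g) \<and>
     (\<forall>x\<in>orthant d. \<forall>y\<in>orthant d. g x + g y \<le> g (sup x y) + g (inf x y)) \<and>
     (\<exists>G. (\<forall>z\<in>orthant d. has_gradient d g (G z) z) \<and>
          (\<forall>u\<in>orthant d. u \<noteq> (\<lambda>_. 0) \<longrightarrow>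
             filterlim (\<lambda>t. dotp d (G (\<lambda>i. t * u i)) u) at_top at_top))"

definition coord_cost :: "(rvec \<Rightarrow> real) \<Rightarrow> nat \<Rightarrow> real \<Rightarrow> real" where
  "coord_cost g i t = g (\<lambda>j. if j = i then t else 0)"

definition separable :: "nat \<Rightarrow> (rvec \<Rightarrow> real) \<Rightarrow> bool" where
  "separable d g \<longleftrightarrow> (\<forall>z\<in>orthant d. g z = (\<Sum>i<d. coord_cost g i (z i)))"


subsection \<open>Profit\<close>

definition profit :: "nat set \<Rightarrow> (rvec \<Rightarrow> real) \<Rightarrow> (nat \<Rightarrow> real) \<Rightarrow> (nat \<Rightarrow> rvec) \<Rightarrow> rvec \<Rightarrow> real" where
  "profit U g v s x = (\<Sum>e\<in>U. v e * x e) - g (\<lambda>i. \<Sum>e\<in>U. s e i * x e)"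

abbreviation set_profit ::
  "nat set \<Rightarrow> (rvec \<Rightarrow> real) \<Rightarrow> (nat \<Rightarrow> real) \<Rightarrow> (nat \<Rightarrow> rvec) \<Rightarrow> nat set \<Rightarrow> real" where
  "set_profit U g v s A \<equiv> profit U g v s (indicat_real A)"

definition opt ::
  "nat set \<Rightarrow> nat set set \<Rightarrow> (rvec \<Rightarrow> real) \<Rightarrow> (nat \<Rightarrow> real) \<Rightarrow> (nat \<Rightarrow> rvec) \<Rightarrow> real" where
  "opt U F g v s = Max (set_profit U g v s ` F)"

definition fopt ::
  "nat set \<Rightarrow> nat set set \<Rightarrow> (rvec \<Rightarrow> real) \<Rightarrow> (nat \<Rightarrow> real) \<Rightarrow> (nat \<Rightarrow> rvec) \<Rightarrow> nat set \<Rightarrow> real" where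
  "fopt U F g v s A = (SUP x\<in>conv (restrict_family F A). profit U g v s x)"


subsection \<open>Standing assumption\<close>

text \<open>The maximizer in the following definition is unique unless the item has
  value and size zero; such an item does not count as exceptional.\<close>

definition exceptional :: "(rvec \<Rightarrow> real) \<Rightarrow> (nat \<Rightarrow> real) \<Rightarrow> (nat \<Rightarrow> rvec) \<Rightarrow> nat \<Rightarrow> bool" where
  "exceptional g v s e \<longleftrightarrow>
     {\<theta>. is_arg_max (\<lambda>\<theta>. \<theta> * v e - g (\<lambda>i. \<theta> * s e i)) (\<lambda>\<theta>. \<theta> \<in> {0..1}) \<theta>} \<subseteq> {0<..<1}"

definition general_position ::
  "nat \<Rightarrow> nat set \<Rightarrow> (nat \<Rightarrow> real) \<Rightarrow> (nat \<Rightarrow> rvec) \<Rightarrow> bool" where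
  "general_position d U v s \<longleftrightarrow>
     (\<forall>\<mu>\<in>orthant d. \<forall>e\<in>U. \<forall>e'\<in>U.
        v e = dotp d \<mu> (s e) \<and> v e' = dotp d \<mu> (s e') \<longrightarrow> e = e')"

definition standing_assumption ::
  "nat \<Rightarrow> nat set \<Rightarrow> nat set set \<Rightarrow> (rvec \<Rightarrow> real) \<Rightarrow> (nat \<Rightarrow> real) \<Rightarrow> (nat \<Rightarrow> rvec) \<Rightarrow> real \<Rightarrow> bool" where
  "standing_assumption d U F g v s \<eta> \<longleftrightarrow>
     cost_function d g \<and>
     general_position d U v s \<and>
     (\<forall>e\<in>U. \<not> exceptional g v s e) \<and>
     (\<forall>e\<in>U. set_profit U g v s {e} \<le> opt U F g v s / (\<eta> * real d))"


subsection \<open>The price curve\<close>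

definition conjugate :: "(rvec \<Rightarrow> real) \<Rightarrow> nat \<Rightarrow> real \<Rightarrow> real" where
  "conjugate g i u = (SUP t\<in>{0..}. u * t - coord_cost g i t)"

text \<open>The initial piece \<open>\<gamma>\<close> is an arbitrary monotone curve; the derivatives at 0 are one-sided.\<close>

definition price_curve :: "nat \<Rightarrow> (rvec \<Rightarrow> real) \<Rightarrow> rvec set \<Rightarrow> bool" where
  "price_curve d g C \<longleftrightarrow>
     (\<exists>\<gamma> :: real \<Rightarrow> rvec.
        continuous_on {0..1} \<gamma> \<and> mono_on {0..1} \<gamma> \<and> \<gamma> ` {0..1} \<subseteq> orthant d \<and>
        \<gamma> 0 = (\<lambda>_. 0) \<and>
        (\<forall>i<d. (coord_cost g i has_real_derivative \<gamma> 1 i) (at 0 within {0..})) \<and>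
        C = {\<mu> \<in> orthant d. \<exists>\<tau>>0. \<forall>i<d. conjugate g i (\<mu> i) = \<tau>} \<union> \<gamma> ` {0..1})"


subsection \<open>Online algorithms and the subroutine SubmodMS\<close>

text \<open>
  \<open>D hist cur\<close> is the law of the decision on the last element of \<open>hist\<close>, where \<open>hist\<close> lists the
  elements that have arrived and \<open>cur\<close> is the set of those accepted earlier.  As a randomized
  algorithm may condition on its whole history, every randomized online algorithm has this form.
\<close>

type_synonym decision_rule = "nat list \<Rightarrow> nat set \<Rightarrow> bool pmf"

fun online_run :: "decision_rule \<Rightarrow> nat list \<Rightarrow> nat set \<Rightarrow> nat list \<Rightarrow> nat set pmf" where
  "online_run D hist cur [] = return_pmf cur"
| "online_run D hist cur (e # es) =
     bind_pmf (D (hist @ [e]) cur) (\<lambda>b.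
       online_run D (hist @ [e]) (if b then insert e cur else cur) es)"

definition submodular_on :: "nat set \<Rightarrow> (nat set \<Rightarrow> real) \<Rightarrow> bool" where
  "submodular_on X f \<longleftrightarrow> (\<forall>A\<subseteq>X. \<forall>B\<subseteq>X. f (A \<union> B) + f (A \<inter> B) \<le> f A + f B)"

text \<open>
  An algorithm receives a set function and the length of the sequence.  Evaluating the function
  only on feasible sets means, for an online algorithm, that its decisions depend only on the values
  at feasible sets of elements that have arrived.
\<close>

definition submodMS_assumption ::
  "nat set \<Rightarrow> nat set set \<Rightarrow> real \<Rightarrow> ((nat set \<Rightarrow> real) \<Rightarrow> nat \<Rightarrow> decision_rule) \<Rightarrow> bool" where
  "submodMS_assumption U F \<alpha> \<A> \<longleftrightarrow>
     (\<forall>f f' N hist cur. (\<forall>B\<in>F. B \<subseteq> set hist \<longrightarrow> f B = f' B) \<longrightarrow>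
        \<A> f N hist cur = \<A> f' N hist cur) \<and>
     (\<forall>f xs. distinct xs \<and> set xs \<subseteq> U \<longrightarrow>
        set_pmf (online_run (\<A> f (length xs)) [] {} xs) \<subseteq> F) \<and>
     (\<forall>f X. X \<subseteq> U \<and> (\<forall>A\<subseteq>X. 0 \<le> f A) \<and> f {} = 0 \<and> mono_on (Pow X) f \<and> submodular_on X f \<longrightarrow>
        measure_pmf.expectation
          (bind_pmf (pmf_of_set (permutations_of_set X)) (online_run (\<A> f (card X)) [] {})) f
        \<ge> 1 / \<alpha> * Max (f ` restrict_family F X))"


subsection \<open>Algorithm OA\<close>

definition items_above :: "nat \<Rightarrow> (nat \<Rightarrow> real) \<Rightarrow> (nat \<Rightarrow> rvec) \<Rightarrow> rvec \<Rightarrow> nat set \<Rightarrow> nat set" where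
  "items_above d v s \<mu> X = {e \<in> X. v e \<ge> dotp d \<mu> (s e)}"

definition items_strictly_above ::
  "nat \<Rightarrow> (nat \<Rightarrow> real) \<Rightarrow> (nat \<Rightarrow> rvec) \<Rightarrow> rvec \<Rightarrow> nat set \<Rightarrow> nat set" where
  "items_strictly_above d v s \<mu> X = {e \<in> X. v e > dotp d \<mu> (s e)}"

definition admissible_price ::
  "nat \<Rightarrow> nat set \<Rightarrow> nat set set \<Rightarrow> (rvec \<Rightarrow> real) \<Rightarrow> (nat \<Rightarrow> real) \<Rightarrow> (nat \<Rightarrow> rvec) \<Rightarrow>
   rvec set \<Rightarrow> nat set \<Rightarrow> rvec \<Rightarrow> bool" where
  "admissible_price d U F g v s C L \<mu> \<longleftrightarrow>
     \<mu> \<in> C \<and> fopt U F g v s (items_above d v s \<mu> L) \<ge> 1 / (12 * real d) * fopt U F g v s L"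

text \<open>
  If no largest admissible price exists (e.g. for empty \<open>L\<close>), then the admissible prices are
  unbounded and the price is read as infinite: an item lies strictly above it iff it lies strictly
  above every price of the curve (that is, iff it has size zero and positive value).
\<close>

definition candidates ::
  "nat \<Rightarrow> nat set \<Rightarrow> nat set set \<Rightarrow> (rvec \<Rightarrow> real) \<Rightarrow> (nat \<Rightarrow> real) \<Rightarrow> (nat \<Rightarrow> rvec) \<Rightarrow>
   rvec set \<Rightarrow> nat set \<Rightarrow> nat set \<Rightarrow> nat set" where
  "candidates d U F g v s C L R =
     (let P = admissible_price d U F g v s C L in
      if \<exists>\<mu>. P \<mu> \<and> (\<forall>\<nu>. P \<nu> \<longrightarrow> \<nu> \<le> \<mu>)
      then items_strictly_above d v s (GREATEST \<mu>. P \<mu>) R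
      else (\<Inter>\<mu>\<in>C. items_strictly_above d v s \<mu> R))"

text \<open>\<open>cur\<close> is the set accepted by the simulated algorithm, \<open>sol\<close> the actual solution.\<close>

fun filtered_run ::
  "(nat set \<Rightarrow> real) \<Rightarrow> decision_rule \<Rightarrow> nat list \<Rightarrow> nat set \<Rightarrow> nat set \<Rightarrow> nat list \<Rightarrow> nat set pmf" where
  "filtered_run p D hist cur sol [] = return_pmf sol"
| "filtered_run p D hist cur sol (e # es) =
     bind_pmf (D (hist @ [e]) cur) (\<lambda>b.
       filtered_run p D (hist @ [e])
         (if b then insert e cur else cur)
         (if b \<and> p (insert e sol) \<ge> p sol then insert e sol else sol) es)"

definition OA ::
  "nat \<Rightarrow> nat set \<Rightarrow> nat set set \<Rightarrow> (rvec \<Rightarrow> real) \<Rightarrow> (nat \<Rightarrow> real) \<Rightarrow> (nat \<Rightarrow> rvec) \<Rightarrow>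
   rvec set \<Rightarrow> ((nat set \<Rightarrow> real) \<Rightarrow> nat \<Rightarrow> decision_rule) \<Rightarrow> nat set pmf" where
  "OA d U F g v s C \<A> =
     bind_pmf (pmf_of_set (permutations_of_set U)) (\<lambda>xs.
     bind_pmf (binomial_pmf (card U) (1 / 2)) (\<lambda>k.
       let L = set (take k xs);
           R = set (drop k xs);
           ys = filter (\<lambda>e. e \<in> candidates d U F g v s C L R) (drop k xs);
           p = set_profit U g v s
       in filtered_run p (\<A> p (length ys)) [] {} {} ys))"

end

theory Submission
  imports Defs
begin

text \<open>
  Write \<open>\<phi>\<^sub>i\<close> for the coordinate costs and parametrize the curve by \<open>\<tau>\<close>: the price \<open>\<lambda>\<^sub>i(\<tau>)\<close> is the slope
  of \<open>\<phi>\<^sub>i\<close> at the saturation point \<open>T\<^sub>i(\<tau>)\<close>, where \<open>\<lambda>\<^sub>i T\<^sub>i - \<phi>\<^sub>i(T\<^sub>i) = \<tau>\<close>.  Call \<open>\<tau>\<close> overfull for \<open>X\<close> if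
  some feasible set of items of \<open>X\<close> above the price has load more than \<open>T\<^sub>i(\<tau>)\<close> in some coordinate \<open>i\<close>.
  If \<open>\<tau>\<close> is not overfull, Fenchel duality bounds the fractional optimum of \<open>X\<close> by \<open>d\<tau>\<close> plus the integral
  optimum above the price.  If \<open>\<tau>\<close> is overfull, filling up until a coordinate saturates earns at least
  \<open>\<tau>\<close>; only one item is used fractionally, so the integral optimum above the price is at least \<open>\<tau>/2\<close>.
  At the supremum \<open>\<tau>*\<close> of the overfull parameters both hold: the fractional optimum of \<open>X\<close> is at most
  \<open>2d + 1\<close> times the integral optimum above \<open>\<lambda>(\<tau>*)\<close>, and strictly above \<open>\<lambda>(\<tau>*)\<close> no feasible set
  exceeds saturation.

  Since items are small, the second moment method shows that with probability at least 1/2 the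
  price chosen from the sample is at least \<open>\<lambda>(\<tau>*)\<close> for \<open>X = U\<close>, and the remaining items strictly above
  it still have fractional optimum \<open>\<Omega>(opt/d)\<close>, hence integral optimum \<open>\<Omega>(opt/d\<^sup>2)\<close>.  On these items the profit
  agrees, on feasible sets, with the monotone submodular function obtained by continuing each \<open>\<phi>\<^sub>i\<close>
  along its tangent at \<open>T\<^sub>i(\<tau>*)\<close>, so the guarantee of the subroutine applies.
\<close>

section \<open>Convex costs of one variable\<close>

text \<open>Differentiating within the half-line makes the value at \<open>0\<close> the right
  derivative, in agreement with the endpoint condition of \<open>price_curve\<close>.\<close>

definition slope :: "(real \<Rightarrow> real) \<Rightarrow> real \<Rightarrow> real" where
  "slope \<phi> t = (SOME D. (\<phi> has_real_derivative D) (at t within {0..}))"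

text \<open>The value of the convex conjugate at the slope in \<open>t\<close>, as
  \<open>conjugate_slope\<close> shows. Parametrizing by the maximizer \<open>t\<close> rather than
  by the price avoids inverting \<open>slope\<close>.\<close>

definition legendre :: "(real \<Rightarrow> real) \<Rightarrow> real \<Rightarrow> real" where
  "legendre \<phi> t = t * slope \<phi> t - \<phi> t"

definition saturation :: "(real \<Rightarrow> real) \<Rightarrow> real \<Rightarrow> real" where
  "saturation \<phi> \<tau> = (THE t. 0 \<le> t \<and> legendre \<phi> t = \<tau>)"

definition price :: "(real \<Rightarrow> real) \<Rightarrow> real \<Rightarrow> real" where
  "price \<phi> \<tau> = slope \<phi> (saturation \<phi> \<tau>)"

lemma has_real_derivative_unique_atLeast:
  fixes \<phi> :: "real \<Rightarrow> real"
  assumes "(\<phi> has_real_derivative D) (at t within {0..})" "(\<phi> has_real_derivative E) (at t within {0..})" "0 \<le> t"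
  shows "D = E"
proof -
  have "at_right t \<le> at t within {0..}" using assms(3) by (intro at_le) auto
  then have "at t within {0..} \<noteq> bot"
    using trivial_limit_at_right_real[of t] by (metis bot.extremum_uniqueI)
  then show ?thesis
    using assms tendsto_unique unfolding has_field_derivative_iff by blast
qed

text \<open>Past saturation this is the tangent at the saturation point: by
  \<open>price_tight\<close> its intercept is \<open>-\<tau>\<close>.\<close>

definition tangent_cost :: "(real \<Rightarrow> real) \<Rightarrow> real \<Rightarrow> real \<Rightarrow> real" where
  "tangent_cost \<phi> \<tau> t = (if t \<le> saturation \<phi> \<tau> then \<phi> t else price \<phi> \<tau> * t - \<tau>)"

locale convex_cost =
  fixes \<phi> :: "real \<Rightarrow> real"
  assumes zero: "\<phi> 0 = 0"
    and nonneg: "0 \<le> t \<Longrightarrow> 0 \<le> \<phi> t"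
    and strictly_convex: "\<lbrakk>0 \<le> x; 0 \<le> y; x \<noteq> y; 0 < u; u < 1\<rbrakk> \<Longrightarrow>
      \<phi> ((1 - u) * x + u * y) < (1 - u) * \<phi> x + u * \<phi> y"
    and differentiable: "0 \<le> t \<Longrightarrow> \<exists>D. (\<phi> has_real_derivative D) (at t within {0..})"
    and slope_at_top: "filterlim (slope \<phi>) at_top at_top"
begin

lemma has_slope: "0 \<le> t \<Longrightarrow> (\<phi> has_real_derivative slope \<phi> t) (at t within {0..})"
  unfolding slope_def by (rule someI_ex) (rule differentiable)

lemma convex: "convex_on {0..} \<phi>"
proof (rule convex_onI)
  fix u x y :: real assume *: "0 < u" "u < 1" "x \<in> {0..}" "y \<in> {0..}"
  show "\<phi> ((1 - u) *\<^sub>R x + u *\<^sub>R y) \<le> (1 - u) * \<phi> x + u * \<phi> y"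
  proof (cases "x = y")
    case True
    then show ?thesis by (simp add: algebra_simps)
  next
    case False
    then show ?thesis using strictly_convex[of x y u] * by simp
  qed
qed simp

lemma continuous: "continuous_on {0..} \<phi>"
  using has_slope by (meson DERIV_continuous_on atLeast_iff)

text \<open>Convexity bounds the increment along the segment from \<open>t\<close> to
  \<open>y\<close> by the chord; shrinking the segment turns the difference quotient into the slope.
  Moving along the segment treats both sides of \<open>t\<close> at once and never leaves the
  half-line.\<close>

lemma above_tangent:
  assumes "0 \<le> t" "0 \<le> y"
  shows "\<phi> t + slope \<phi> t * (y - t) \<le> \<phi> y"
proof (cases "y = t")
  case False
  have "((\<lambda>x. (\<phi> x - \<phi> t) / (x - t)) \<longlongrightarrow> slope \<phi> t) (at t within {0..})"
    using has_slope[OF assms(1)] by (simp add: has_field_derivative_iff)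
  moreover have "filterlim (\<lambda>u. t + u * (y - t)) (at t within {0..}) (at_right 0)"
    unfolding filterlim_at
  proof
    show "\<forall>\<^sub>F u in at_right 0. t + u * (y - t) \<in> {0..} \<and> t + u * (y - t) \<noteq> t"
    proof -
      have "\<forall>\<^sub>F u in at_right (0::real). u \<in> {0<..<1}"
        by (rule eventually_at_right_real) simp
      then show ?thesis
      proof eventually_elim
        case (elim u)
        have "t + u * (y - t) = (1 - u) * t + u * y" by (simp add: algebra_simps)
        also have "\<dots> \<ge> 0" using elim assms by simp
        finally show ?case using elim False by simp
      qed
    qed
    show "((\<lambda>u. t + u * (y - t)) \<longlongrightarrow> t) (at_right 0)"
      by (rule tendsto_eq_intros refl | simp)+
  qed
  ultimately have "((\<lambda>u. (\<phi> (t + u * (y - t)) - \<phi> t) / (t + u * (y - t) - t)) \<longlongrightarrow> slope \<phi> t) (at_right 0)"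
    by (rule filterlim_compose)
  then have "((\<lambda>u. (\<phi> (t + u * (y - t)) - \<phi> t) / (t + u * (y - t) - t) * (y - t)) \<longlongrightarrow> slope \<phi> t * (y - t)) (at_right 0)"
    by (intro tendsto_intros)
  moreover have "\<forall>\<^sub>F u in at_right 0. (\<phi> (t + u * (y - t)) - \<phi> t) / (t + u * (y - t) - t) * (y - t) \<le> \<phi> y - \<phi> t"
  proof -
    have "\<forall>\<^sub>F u in at_right (0::real). u \<in> {0<..<1}"
      by (rule eventually_at_right_real) simp
    then show ?thesis
    proof eventually_elim
      case (elim u)
      have "(1 - u) * t + u * y = t + u * (y - t)" by (simp add: algebra_simps)
      then have "\<phi> (t + u * (y - t)) < (1 - u) * \<phi> t + u * \<phi> y"
        using strictly_convex[of t y u] elim assms False by auto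
      then have "\<phi> (t + u * (y - t)) - \<phi> t \<le> u * (\<phi> y - \<phi> t)"
        by (simp add: algebra_simps)
      then have "(\<phi> (t + u * (y - t)) - \<phi> t) / u \<le> \<phi> y - \<phi> t"
        using elim by (simp add: field_simps)
      moreover have "(\<phi> (t + u * (y - t)) - \<phi> t) / (t + u * (y - t) - t) * (y - t) = (\<phi> (t + u * (y - t)) - \<phi> t) / u"
        using elim False by simp
      ultimately show ?case by simp
    qed
  qed
  ultimately have "slope \<phi> t * (y - t) \<le> \<phi> y - \<phi> t"
    by (rule tendsto_upperbound) simp
  then show ?thesis by simp
qed simp

lemma strictly_above_tangent:
  assumes "0 \<le> t" "0 \<le> y" "y \<noteq> t"
  shows "\<phi> t + slope \<phi> t * (y - t) < \<phi> y"
proof -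
  \<comment> \<open>The tangent bound at the midpoint becomes strict when combined with strict
    convexity there.\<close>
  have "\<phi> t + slope \<phi> t * ((1 - 1/2) * t + 1/2 * y - t) \<le> \<phi> ((1 - 1/2) * t + 1/2 * y)"
    using assms by (intro above_tangent) auto
  also have "\<dots> < (1 - 1/2) * \<phi> t + 1/2 * \<phi> y"
    using assms by (intro strictly_convex) auto
  finally show ?thesis by (simp add: field_simps)
qed

lemma slope_strict_mono:
  assumes "0 \<le> x" "x < y"
  shows "slope \<phi> x < slope \<phi> y"
proof -
  have "(slope \<phi> y - slope \<phi> x) * (y - x) > 0"
    using strictly_above_tangent[of x y] strictly_above_tangent[of y x] assms by (simp add: algebra_simps)
  then show ?thesis using assms by (simp add: zero_less_mult_iff)
qed

lemma slope_mono: "0 \<le> x \<Longrightarrow> x \<le> y \<Longrightarrow> slope \<phi> x \<le> slope \<phi> y"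
  using slope_strict_mono[of x y] by (cases "x = y") auto

text \<open>With a fixed step \<open>k\<close>, the slope at \<open>s\<close> lies between the
  backward and the forward difference quotient, and both are continuous in \<open>s\<close>. The
  step is chosen so that the quotient at \<open>t\<close> is already on the right side of
  \<open>a\<close>. At \<open>t = 0\<close> there is no backward quotient, but monotonicity of the
  slope suffices.\<close>

lemma slope_continuous: "continuous_on {0..} (slope \<phi>)"
  unfolding continuous_on_def
proof
  fix t :: real assume "t \<in> {0..}"
  then have t: "0 \<le> t" by simp
  have quot: "((\<lambda>x. (\<phi> x - \<phi> t) / (x - t)) \<longlongrightarrow> slope \<phi> t) (at t within {0..})"
    using has_slope[OF t] by (simp add: has_field_derivative_iff)
  show "(slope \<phi> \<longlongrightarrow> slope \<phi> t) (at t within {0..})"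
  proof (rule order_tendstoI)
    fix a assume a: "slope \<phi> t < a"
    have "\<forall>\<^sub>F x in at_right t. (\<phi> x - \<phi> t) / (x - t) < a"
      using order_tendstoD(2)[OF quot a] t by (auto simp: eventually_at_filter elim!: eventually_mono)
    then have "\<forall>\<^sub>F x in at_right t. (\<phi> x - \<phi> t) / (x - t) < a \<and> x > t"
      by (simp add: eventually_conj eventually_at_right_less)
    then obtain y where y: "y > t" "(\<phi> y - \<phi> t) / (y - t) < a"
      using eventually_happens'[of "at_right t"] by (metis (lifting) trivial_limit_at_right_real)
    define k where "k = y - t"
    have k: "k > 0" "(\<phi> (t + k) - \<phi> t) / k < a" using y by (auto simp: k_def)
    have "((\<lambda>s. (\<phi> (s + k) - \<phi> s) / k) \<longlongrightarrow> (\<phi> (t + k) - \<phi> t) / k) (at t within {0..})"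
    proof -
      have "continuous_on {0..} (\<lambda>s. (\<phi> (s + k) - \<phi> s) / k)"
        using k(1) by (intro continuous_intros continuous_on_compose2[OF continuous, of _ "\<lambda>s. s + k"] continuous) auto
      then show ?thesis using t by (simp add: continuous_on_def)
    qed
    then have "\<forall>\<^sub>F s in at t within {0..}. (\<phi> (s + k) - \<phi> s) / k < a"
      using k(2) by (rule order_tendstoD)
    moreover have "\<forall>\<^sub>F s in at t within {0..}. s \<in> {0..}"
      by (simp add: eventually_at_filter)
    ultimately show "\<forall>\<^sub>F s in at t within {0..}. slope \<phi> s < a"
    proof eventually_elim
      case (elim s)
      then have "slope \<phi> s \<le> (\<phi> (s + k) - \<phi> s) / k"
        using above_tangent[of s "s + k"] k by (simp add: field_simps)
      with elim show ?case by simp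
    qed
  next
    fix a assume a: "a < slope \<phi> t"
    show "\<forall>\<^sub>F s in at t within {0..}. a < slope \<phi> s"
    proof (cases "t = 0")
      case True
      have "\<forall>\<^sub>F s in at t within {0..}. s \<in> {0..}"
        by (simp add: eventually_at_filter)
      then show ?thesis
        by eventually_elim (use a True in \<open>auto intro: less_le_trans slope_mono\<close>)
    next
      case False
      with t have t: "t > 0" by simp
      have "\<forall>\<^sub>F x in nhds t. x > 0"
        by (rule order_tendstoD(1)[OF filterlim_ident t])
      moreover have "\<forall>\<^sub>F x in nhds t. x \<noteq> t \<longrightarrow> x \<in> {0..} \<longrightarrow> a < (\<phi> x - \<phi> t) / (x - t)"
        using order_tendstoD(1)[OF quot a] by (simp add: eventually_at_filter)
      ultimately have "\<forall>\<^sub>F x in at_left t. x > 0 \<and> x < t \<and> a < (\<phi> x - \<phi> t) / (x - t)"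
        unfolding eventually_at_filter by eventually_elim auto
      then obtain y where y: "y > 0" "y < t" "a < (\<phi> y - \<phi> t) / (y - t)"
        using eventually_happens'[of "at_left t"] by (metis (lifting) trivial_limit_at_left_real)
      define k where "k = t - y"
      have k: "k > 0" "t - k > 0" "a < (\<phi> t - \<phi> (t - k)) / k"
        using y by (auto simp: k_def minus_divide_divide[symmetric, of "\<phi> y - \<phi> t"])
      have "((\<lambda>s. (\<phi> s - \<phi> (s - k)) / k) \<longlongrightarrow> (\<phi> t - \<phi> (t - k)) / k) (at t within {k..})"
      proof -
        have "continuous_on {k..} (\<lambda>s. (\<phi> s - \<phi> (s - k)) / k)"
          using k(1) by (intro continuous_intros continuous_on_compose2[OF continuous, of _ "\<lambda>s. s - k"] continuous_on_subset[OF continuous]) auto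
        then show ?thesis using k by (simp add: continuous_on_def)
      qed
      then have "\<forall>\<^sub>F s in at t within {k..}. a < (\<phi> s - \<phi> (s - k)) / k"
        using k(3) by (rule order_tendstoD)
      then have "\<forall>\<^sub>F s in nhds t. s \<noteq> t \<longrightarrow> s \<in> {k..} \<longrightarrow> a < (\<phi> s - \<phi> (s - k)) / k"
        by (simp add: eventually_at_filter)
      moreover have "\<forall>\<^sub>F s in nhds t. s > k"
        by (rule order_tendstoD(1)[OF filterlim_ident]) (use k in simp)
      ultimately show ?thesis
        unfolding eventually_at_filter
      proof eventually_elim
        case (elim s)
        show ?case
        proof (intro impI)
          assume "s \<noteq> t"
          with elim have "a < (\<phi> s - \<phi> (s - k)) / k" by simp
          also have "\<dots> \<le> slope \<phi> s"
            using above_tangent[of s "s - k"] k elim by (simp add: field_simps)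
          finally show "a < slope \<phi> s" .
        qed
      qed
    qed
  qed
qed

section \<open>Conjugate values, saturation points and prices\<close>

lemma legendre_zero [simp]: "legendre \<phi> 0 = 0"
  by (simp add: legendre_def zero)

lemma legendre_strict_mono:
  assumes "0 \<le> x" "x < y"
  shows "legendre \<phi> x < legendre \<phi> y"
proof -
  have "legendre \<phi> y - legendre \<phi> x > x * (slope \<phi> y - slope \<phi> x)"
    using strictly_above_tangent[of y x] assms by (simp add: legendre_def algebra_simps)
  moreover have "x * (slope \<phi> y - slope \<phi> x) \<ge> 0"
    using assms slope_mono[of x y] by simp
  ultimately show ?thesis by simp
qed

lemma legendre_continuous: "continuous_on {0..} (legendre \<phi>)"
  unfolding legendre_def by (intro continuous_intros slope_continuous continuous)

lemma slope_large: "\<exists>t\<ge>b. slope \<phi> t \<ge> c"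
proof -
  have "\<forall>\<^sub>F t in at_top. slope \<phi> t \<ge> c \<and> t \<ge> b"
    using slope_at_top by (simp add: filterlim_at_top eventually_conj eventually_ge_at_top)
  then show ?thesis using eventually_happens'[of at_top] by (metis (lifting) trivial_limit_at_top_linorder)
qed

text \<open>The tangent at \<open>b\<close>, evaluated at \<open>1\<close>, gives
  \<open>legendre \<phi> b \<ge> slope \<phi> b - \<phi> 1\<close>, so unbounded slopes make
  \<open>legendre\<close> unbounded and the intermediate value theorem applies.\<close>

lemma legendre_surj:
  assumes "0 \<le> \<tau>"
  shows "\<exists>t\<ge>0. legendre \<phi> t = \<tau>"
proof -
  obtain b where b: "b \<ge> 1" "slope \<phi> b \<ge> \<tau> + \<phi> 1" using slope_large by blast
  have "legendre \<phi> b \<ge> \<tau>"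
    using above_tangent[of b 1] b by (simp add: legendre_def algebra_simps)
  moreover have "continuous_on {0..b} (legendre \<phi>)"
    by (rule continuous_on_subset[OF legendre_continuous]) auto
  ultimately show ?thesis
    using IVT'[of "legendre \<phi>" 0 \<tau> b] assms b by auto
qed

lemma legendre_inj: "\<lbrakk>0 \<le> x; 0 \<le> y; legendre \<phi> x = legendre \<phi> y\<rbrakk> \<Longrightarrow> x = y"
  using legendre_strict_mono by (metis less_irrefl linorder_neqE_linordered_idom)

lemma
  assumes "0 \<le> \<tau>"
  shows saturation_nonneg: "0 \<le> saturation \<phi> \<tau>"
    and legendre_saturation: "legendre \<phi> (saturation \<phi> \<tau>) = \<tau>"
proof -
  have "\<exists>!t. 0 \<le> t \<and> legendre \<phi> t = \<tau>"
    using legendre_surj[OF assms] legendre_inj by blast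
  from theI'[OF this] show "0 \<le> saturation \<phi> \<tau>" "legendre \<phi> (saturation \<phi> \<tau>) = \<tau>"
    unfolding saturation_def by auto
qed

lemma legendre_nonneg: "0 \<le> t \<Longrightarrow> 0 \<le> legendre \<phi> t"
  using legendre_strict_mono[of 0 t] by (cases "t = 0") auto

lemma saturation_legendre: "0 \<le> t \<Longrightarrow> saturation \<phi> (legendre \<phi> t) = t"
  by (rule legendre_inj) (simp_all add: saturation_nonneg legendre_saturation legendre_nonneg)

lemma saturation_zero: "saturation \<phi> 0 = 0"
  using saturation_legendre[of 0] by simp

lemma saturation_strict_mono:
  assumes "0 \<le> x" "x < y" shows "saturation \<phi> x < saturation \<phi> y"
proof (rule ccontr)
  assume "\<not> ?thesis"
  then have "saturation \<phi> y \<le> saturation \<phi> x" by simp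
  then have "legendre \<phi> (saturation \<phi> y) \<le> legendre \<phi> (saturation \<phi> x)"
    using legendre_strict_mono[of "saturation \<phi> y" "saturation \<phi> x"] saturation_nonneg[of y] assms
    by (cases "saturation \<phi> y = saturation \<phi> x") auto
  then show False using assms by (simp add: legendre_saturation)
qed

lemma saturation_continuous: "continuous_on {0..} (saturation \<phi>)"
proof -
  \<comment> \<open>Extending by the identity to negative arguments gives a monotone surjection of
    the line, and monotone functions with open image are continuous.\<close>
  define T where "T = (\<lambda>\<tau>. if \<tau> < 0 then \<tau> else saturation \<phi> \<tau>)"
  have "continuous_on UNIV T"
  proof (rule continuous_onI_mono)
    have "y \<in> range T" for y
    proof (cases "y < 0")
      case True
      then have "y = T y" by (simp add: T_def)
      then show ?thesis by blast
    next
      case False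
      then have "y = T (legendre \<phi> y)"
        using legendre_nonneg[of y] by (simp add: T_def saturation_legendre)
      then show ?thesis by blast
    qed
    then have "range T = UNIV" by blast
    then show "open (T ` UNIV)" by simp
  next
    fix x y :: real assume "x \<le> y"
    then show "T x \<le> T y"
      using saturation_strict_mono[of x y] saturation_nonneg[of y] by (cases "x = y") (auto simp: T_def)
  qed
  then have "continuous_on {0..} T" by (rule continuous_on_subset) simp
  then show ?thesis by (rule continuous_on_eq) (auto simp: T_def)
qed

lemma saturation_large:
  assumes "0 \<le> b" "legendre \<phi> b \<le> \<tau>" shows "b \<le> saturation \<phi> \<tau>"
  using assms saturation_legendre[OF assms(1)] legendre_nonneg[OF assms(1)]
    saturation_strict_mono[of "legendre \<phi> b" \<tau>] by (cases "legendre \<phi> b = \<tau>") auto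

lemma price_strict_mono: "0 \<le> x \<Longrightarrow> x < y \<Longrightarrow> price \<phi> x < price \<phi> y"
  unfolding price_def by (intro slope_strict_mono saturation_nonneg saturation_strict_mono)

lemma price_continuous: "continuous_on {0..} (price \<phi>)"
  unfolding price_def
  by (rule continuous_on_compose2[OF slope_continuous saturation_continuous]) (auto simp: saturation_nonneg)

lemma price_zero: "price \<phi> 0 = slope \<phi> 0"
  by (simp add: price_def saturation_zero)

lemma slope_nonneg: "0 \<le> t \<Longrightarrow> 0 \<le> slope \<phi> t"
proof -
  assume t: "0 \<le> t"
  have "0 \<le> slope \<phi> 0"
  proof (rule tendsto_lowerbound)
    show "((\<lambda>x. (\<phi> x - \<phi> 0) / (x - 0)) \<longlongrightarrow> slope \<phi> 0) (at_right 0)"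
      using has_slope[of 0] tendsto_within_subset[of _ _ 0 "{0..}" "{0<..}"] by (force simp: has_field_derivative_iff)
    show "\<forall>\<^sub>F x in at_right 0. 0 \<le> (\<phi> x - \<phi> 0) / (x - 0)"
      using eventually_at_right_less[of "0::real"] by eventually_elim (simp add: zero nonneg)
  qed simp
  with slope_mono[OF order_refl t] show ?thesis by simp
qed

lemma price_nonneg: "0 \<le> \<tau> \<Longrightarrow> 0 \<le> price \<phi> \<tau>"
  by (simp add: price_def slope_nonneg saturation_nonneg)

lemma price_tight: "0 \<le> \<tau> \<Longrightarrow> price \<phi> \<tau> * saturation \<phi> \<tau> - \<phi> (saturation \<phi> \<tau>) = \<tau>"
  using legendre_saturation[of \<tau>] by (simp add: legendre_def price_def mult.commute)

text \<open>The left side is the tangent at the saturation point.\<close>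

lemma fenchel:
  assumes "0 \<le> \<tau>" "0 \<le> t" shows "price \<phi> \<tau> * t - \<tau> \<le> \<phi> t"
  using above_tangent[of "saturation \<phi> \<tau>" t] saturation_nonneg[OF assms(1)] price_tight[OF assms(1)] assms
  by (simp add: price_def algebra_simps)

text \<open>Convexity and \<open>\<phi> 0 = 0\<close> bound the cost by
  \<open>slope \<phi> t * t\<close>, and up to saturation the slope is at most the price.\<close>

lemma below_saturation:
  assumes "0 \<le> \<tau>" "0 \<le> t" "t \<le> saturation \<phi> \<tau>"
  shows "\<phi> t \<le> price \<phi> \<tau> * t"
proof -
  have "\<phi> t + slope \<phi> t * (0 - t) \<le> \<phi> 0" using assms by (intro above_tangent) auto
  moreover have "slope \<phi> t * t \<le> price \<phi> \<tau> * t"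
    unfolding price_def using assms by (intro mult_right_mono slope_mono) auto
  ultimately show ?thesis by (simp add: zero)
qed

text \<open>Up to saturation the marginal cost is at most the price; the tangent at \<open>y\<close>
  turns this into a bound on the increment.\<close>

lemma price_minus_cost_mono:
  assumes "0 \<le> \<tau>" "0 \<le> x" "x \<le> y" "y \<le> saturation \<phi> \<tau>"
  shows "price \<phi> \<tau> * x - \<phi> x \<le> price \<phi> \<tau> * y - \<phi> y"
proof -
  have "\<phi> y + slope \<phi> y * (x - y) \<le> \<phi> x" using assms by (intro above_tangent) auto
  moreover have "slope \<phi> y * (y - x) \<le> price \<phi> \<tau> * (y - x)"
    unfolding price_def using assms by (intro mult_right_mono slope_mono) auto
  ultimately show ?thesis by (simp add: algebra_simps)
qed

lemma conjugate_slope: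
  assumes "0 \<le> t" shows "(SUP x\<in>{0..}. slope \<phi> t * x - \<phi> x) = legendre \<phi> t"
proof (rule cSup_eq_maximum)
  show "legendre \<phi> t \<in> (\<lambda>x. slope \<phi> t * x - \<phi> x) ` {0..}"
    using assms by (intro image_eqI[of _ _ t]) (auto simp: legendre_def)
  fix y assume "y \<in> (\<lambda>x. slope \<phi> t * x - \<phi> x) ` {0..}"
  then show "y \<le> legendre \<phi> t"
    using above_tangent[OF assms] by (auto simp: legendre_def algebra_simps)
qed

lemma conjugate_price:
  assumes "0 \<le> \<tau>" shows "(SUP x\<in>{0..}. price \<phi> \<tau> * x - \<phi> x) = \<tau>"
  using conjugate_slope[OF saturation_nonneg[OF assms]] by (simp add: price_def legendre_saturation[OF assms])

text \<open>Positivity of \<open>\<tau>\<close> matters: every price up to the slope at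
  \<open>0\<close> has conjugate \<open>0\<close>. A larger price is a slope by the intermediate
  value theorem, and there the conjugate is given by \<open>legendre\<close>.\<close>

lemma price_unique:
  assumes "0 < \<tau>" "(SUP x\<in>{0..}. u * x - \<phi> x) = \<tau>"
  shows "u = price \<phi> \<tau>"
proof (cases "u \<le> slope \<phi> 0")
  case True
  have "(SUP x\<in>{0..}. u * x - \<phi> x) = 0"
  proof (rule cSup_eq_maximum)
    show "0 \<in> (\<lambda>x. u * x - \<phi> x) ` {0..}" by (intro image_eqI[of _ _ 0]) (auto simp: zero)
    fix y assume "y \<in> (\<lambda>x. u * x - \<phi> x) ` {0..}"
    then obtain x where x: "x \<ge> 0" "y = u * x - \<phi> x" by auto
    have "u * x \<le> slope \<phi> 0 * x" using True x by (intro mult_right_mono) auto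
    then show "y \<le> 0" using above_tangent[of 0 x] x by (simp add: zero)
  qed
  with assms show ?thesis by simp
next
  case False
  obtain b where b: "b \<ge> 0" "slope \<phi> b \<ge> u" using slope_large by blast
  have "continuous_on {0..b} (slope \<phi>)" by (rule continuous_on_subset[OF slope_continuous]) auto
  then obtain t where t: "t \<ge> 0" "slope \<phi> t = u" using IVT'[of "slope \<phi>" 0 u b] False b by auto
  then have "legendre \<phi> t = \<tau>" using conjugate_slope[of t] assms by simp
  then show ?thesis using saturation_legendre[of t] t by (auto simp: price_def)
qed

text \<open>A linear cost minus the surplus of price over cost, frozen at saturation. Both cases of
  the definition become one formula, so growth and convexity follow from properties of the surplus
  alone.\<close>

lemma tangent_cost_eq:
  assumes "0 \<le> \<tau>"
  shows "tangent_cost \<phi> \<tau> t = price \<phi> \<tau> * t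
    - (price \<phi> \<tau> * min t (saturation \<phi> \<tau>) - \<phi> (min t (saturation \<phi> \<tau>)))"
  using price_tight[OF assms] by (auto simp: tangent_cost_def min_def)

lemma tangent_cost_zero: "0 \<le> \<tau> \<Longrightarrow> tangent_cost \<phi> \<tau> 0 = 0"
  by (simp add: tangent_cost_def saturation_nonneg zero)

lemma tangent_cost_slope:
  assumes "0 \<le> \<tau>" "0 \<le> x" "x \<le> y"
  shows "tangent_cost \<phi> \<tau> y - tangent_cost \<phi> \<tau> x \<le> price \<phi> \<tau> * (y - x)"
proof -
  let ?T = "saturation \<phi> \<tau>"
  have "price \<phi> \<tau> * min x ?T - \<phi> (min x ?T) \<le> price \<phi> \<tau> * min y ?T - \<phi> (min y ?T)"
    using assms saturation_nonneg by (intro price_minus_cost_mono) auto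
  then show ?thesis unfolding tangent_cost_eq[OF assms(1)] by (simp add: algebra_simps)
qed

lemma tangent_cost_convex:
  assumes "0 \<le> \<tau>"
  shows "convex_on {0..} (tangent_cost \<phi> \<tau>)"
proof (rule convex_onI)
  fix u x y :: real assume *: "0 < u" "u < 1" "x \<in> {0..}" "y \<in> {0..}"
  let ?T = "saturation \<phi> \<tau>" and ?p = "price \<phi> \<tau>"
  define a b where "a = min x ?T" and "b = min y ?T"
  have T: "0 \<le> ?T" using assms by (rule saturation_nonneg)
  have ab: "0 \<le> a" "0 \<le> b" using * T by (auto simp: a_def b_def)
  define m where "m = (1 - u) * x + u * y"
  \<comment> \<open>Truncation is concave; since the surplus is concave and increasing up to
    saturation, the truncated surplus is concave as well.\<close>
  have m: "(1 - u) * a + u * b \<le> min m ?T"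
  proof -
    have "(1 - u) * a + u * b \<le> m" unfolding m_def a_def b_def using *
      by (intro add_mono mult_left_mono) auto
    moreover have "(1 - u) * a + u * b \<le> (1 - u) * ?T + u * ?T" unfolding a_def b_def using *
      by (intro add_mono mult_left_mono) auto
    ultimately show ?thesis by (simp add: algebra_simps)
  qed
  have "?p * ((1 - u) * a + u * b) - \<phi> ((1 - u) * a + u * b) \<le> ?p * min m ?T - \<phi> (min m ?T)"
    using m assms * ab by (intro price_minus_cost_mono) auto
  moreover have "\<phi> ((1 - u) * a + u * b) \<le> (1 - u) * \<phi> a + u * \<phi> b"
    using convex_onD[OF convex, of u a b] * ab by simp
  ultimately have "?p * ((1 - u) * a + u * b) - ((1 - u) * \<phi> a + u * \<phi> b) \<le> ?p * min m ?T - \<phi> (min m ?T)"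
    by linarith
  then have "tangent_cost \<phi> \<tau> m \<le> ?p * m - (?p * ((1 - u) * a + u * b) - ((1 - u) * \<phi> a + u * \<phi> b))"
    unfolding tangent_cost_eq[OF assms] by linarith
  also have "\<dots> = (1 - u) * tangent_cost \<phi> \<tau> x + u * tangent_cost \<phi> \<tau> y"
    unfolding tangent_cost_eq[OF assms] a_def[symmetric] b_def[symmetric] m_def
    by (simp add: algebra_simps)
  finally show "tangent_cost \<phi> \<tau> ((1 - u) *\<^sub>R x + u *\<^sub>R y)
      \<le> (1 - u) * tangent_cost \<phi> \<tau> x + u * tangent_cost \<phi> \<tau> y" by (simp add: m_def)
qed simp

end

section \<open>Submodularity of the profit and fractional optima\<close>

text \<open>Both \<open>b\<close> and \<open>c\<close> are convex combinations of \<open>a\<close>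
  and \<open>z\<close> with complementary weights, so the two convexity bounds add up.\<close>

lemma convex_on_four_points:
  fixes H :: "real \<Rightarrow> real"
  assumes "convex_on {0..} H" "0 \<le> a" "a \<le> b" "a \<le> c" "a + z = b + c"
  shows "H b + H c \<le> H a + H z"
proof (cases "a = z")
  case False
  define u where "u = (b - a) / (z - a)"
  have az: "a < z" using False assms by linarith
  have u: "0 \<le> u" "u \<le> 1" using az assms by (auto simp: u_def field_simps)
  have ub: "u * (z - a) = b - a" using az by (simp add: u_def)
  have b: "(1 - u) * a + u * z = b" using ub by (simp add: algebra_simps)
  have c: "(1 - (1 - u)) * a + (1 - u) * z = c" using ub assms by (simp add: algebra_simps)
  have "H b \<le> (1 - u) * H a + u * H z"
    using convex_onD[OF assms(1), of u a z] u assms az by (simp add: b)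
  moreover have "H c \<le> (1 - (1 - u)) * H a + (1 - u) * H z"
    using convex_onD[OF assms(1), of "1 - u" a z, unfolded real_scaleR_def c] u assms az by simp
  ultimately show ?thesis by (simp add: algebra_simps)
next
  case True
  then have "b = a" "c = a" "z = a" using assms by auto
  then show ?thesis by simp
qed

lemma convex_of_sum_supermodular:
  fixes H :: "real \<Rightarrow> real"
  assumes "convex_on {0..} H" "finite X" "\<And>e. e \<in> X \<Longrightarrow> 0 \<le> q e" "A \<subseteq> X" "B \<subseteq> X"
  shows "H (sum q A) + H (sum q B) \<le> H (sum q (A \<union> B)) + H (sum q (A \<inter> B))"
proof -
  have fin: "finite A" "finite B" by (meson assms(2,4,5) finite_subset)+
  have "H (sum q A) + H (sum q B) \<le> H (sum q (A \<inter> B)) + H (sum q (A \<union> B))"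
  proof (rule convex_on_four_points[OF assms(1)])
    show "0 \<le> sum q (A \<inter> B)" using assms by (intro sum_nonneg) auto
    show "sum q (A \<inter> B) \<le> sum q A" "sum q (A \<inter> B) \<le> sum q B"
      using assms fin by (intro sum_mono2; auto)+
    show "sum q (A \<inter> B) + sum q (A \<union> B) = sum q A + sum q B"
      using sum.union_inter[OF fin, of q] by simp
  qed
  then show ?thesis by simp
qed

text \<open>A convex function of a nonnegative additive set function is supermodular. The costs
  \<open>H\<close> and weights are left arbitrary because the lemma serves both the profit of
  restrictions of a fractional point and \<open>tangent_profit\<close>.\<close>

lemma submodular_on_value_minus_cost:
  fixes H :: "nat \<Rightarrow> real \<Rightarrow> real"
  assumes "finite X" "\<And>i. i \<in> I \<Longrightarrow> convex_on {0..} (H i)" "\<And>i e. i \<in> I \<Longrightarrow> e \<in> X \<Longrightarrow> 0 \<le> q i e"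
  shows "submodular_on X (\<lambda>A. sum w A - (\<Sum>i\<in>I. H i (sum (q i) A)))"
  unfolding submodular_on_def
proof (intro allI impI)
  fix A B assume AB: "A \<subseteq> X" "B \<subseteq> X"
  then have fin: "finite A" "finite B" using assms(1) finite_subset by auto
  have "H i (sum (q i) A) + H i (sum (q i) B) \<le> H i (sum (q i) (A \<union> B)) + H i (sum (q i) (A \<inter> B))"
    if "i \<in> I" for i
    using assms(2,3) that assms(1) AB convex_of_sum_supermodular[of "H i" X "q i" A B] by simp
  then have "(\<Sum>i\<in>I. H i (sum (q i) A)) + (\<Sum>i\<in>I. H i (sum (q i) B))
      \<le> (\<Sum>i\<in>I. H i (sum (q i) (A \<union> B))) + (\<Sum>i\<in>I. H i (sum (q i) (A \<inter> B)))"
    unfolding sum.distrib[symmetric]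
    by (rule sum_mono)
  moreover have "sum w (A \<union> B) + sum w (A \<inter> B) = sum w A + sum w B"
    by (rule sum.union_inter[OF fin])
  ultimately show "sum w (A \<union> B) - (\<Sum>i\<in>I. H i (sum (q i) (A \<union> B))) + (sum w (A \<inter> B) - (\<Sum>i\<in>I. H i (sum (q i) (A \<inter> B))))
      \<le> sum w A - (\<Sum>i\<in>I. H i (sum (q i) A)) + (sum w B - (\<Sum>i\<in>I. H i (sum (q i) B)))"
    by linarith
qed

text \<open>The greedy vertex of the base polytope.\<close>

lemma submodular_base_exists:
  assumes "finite X" "submodular_on X h" "h {} = 0"
  shows "\<exists>w. sum w X = h X \<and> (\<forall>L\<subseteq>X. sum w L \<le> h L)"
  using assms
proof (induction X rule: finite_induct)
  case (insert a X)
  have "submodular_on X h" using insert.prems(1) unfolding submodular_on_def by (meson subset_insertI2)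
  then obtain w where w: "sum w X = h X" "\<And>L. L \<subseteq> X \<Longrightarrow> sum w L \<le> h L"
    using insert by auto
  define w' where "w' = w(a := h (insert a X) - h X)"
  have eq: "sum w' L = sum w L" if "L \<subseteq> X" for L
    unfolding w'_def using that insert.hyps by (intro sum.cong) auto
  have "sum w' (insert a X) = h (insert a X)"
    using insert.hyps eq[of X] w(1) by (simp add: w'_def)
  moreover have "sum w' L \<le> h L" if L: "L \<subseteq> insert a X" for L
  proof (cases "a \<in> L")
    case True
    define L' where "L' = L - {a}"
    have L': "L' \<subseteq> X" "L = insert a L'" "a \<notin> L'" "finite L'"
      using L True insert.hyps finite_subset by (auto simp: L'_def)
    have "h (L \<union> X) + h (L \<inter> X) \<le> h L + h X"
      using insert.prems(1) L unfolding submodular_on_def by blast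
    moreover have "L \<union> X = insert a X" "L \<inter> X = L'" using L' insert.hyps by auto
    ultimately have "h (insert a X) + h L' \<le> h L + h X" by simp
    moreover have "sum w' L = w' a + sum w L'" using L' eq[of L'] by simp
    ultimately show ?thesis using w(2)[OF L'(1)] by (simp add: w'_def)
  next
    case False
    then have "L \<subseteq> X" using L by auto
    then show ?thesis using eq w(2) by simp
  qed
  ultimately show ?case by blast
qed simp

text \<open>Different indices may name the same set, so the weights of equal sets are collected. A
  mixture can therefore be pushed through a non-injective map of sets, as in
  \<open>conv_on\<close>.\<close>

lemma conv_mixture:
  assumes "finite I" "finite G" "\<And>i. i \<in> I \<Longrightarrow> 0 \<le> c i" "sum c I = 1" "\<And>i. i \<in> I \<Longrightarrow> B i \<in> G"
  shows "(\<lambda>e. \<Sum>i\<in>I. c i * indicat_real (B i) e) \<in> conv G"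
proof -
  define c' where "c' = (\<lambda>b. sum c {i \<in> I. B i = b})"
  have "\<forall>b\<in>G. 0 \<le> c' b" using assms by (auto simp: c'_def intro: sum_nonneg)
  moreover have "sum c' G = 1"
    unfolding c'_def using assms by (subst sum.group) auto
  moreover have "(\<Sum>i\<in>I. c i * indicat_real (B i) e) = (\<Sum>b\<in>G. c' b * indicat_real b e)" for e
  proof -
    have "(\<Sum>b\<in>G. c' b * indicat_real b e) = (\<Sum>b\<in>G. \<Sum>i\<in>{i \<in> I. B i = b}. c i * indicat_real (B i) e)"
      unfolding c'_def sum_distrib_right by (intro sum.cong) auto
    also have "\<dots> = (\<Sum>i\<in>I. c i * indicat_real (B i) e)"
      using assms by (subst sum.group) auto
    finally show ?thesis by simp
  qed
  ultimately show ?thesis unfolding conv_def by blast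
qed

lemma conv_indicator:
  assumes "finite G" "B \<in> G" shows "indicat_real B \<in> conv G"
  using conv_mixture[of "{()}" G "\<lambda>_. 1" "\<lambda>_. B"] assms by simp

lemma conv_mono:
  assumes "finite G'" "G \<subseteq> G'" shows "conv G \<subseteq> conv G'"
proof
  fix x assume "x \<in> conv G"
  then obtain c where "\<forall>B\<in>G. 0 \<le> c B" "sum c G = 1" "x = (\<lambda>e. \<Sum>B\<in>G. c B * indicat_real B e)"
    unfolding conv_def by blast
  then show "x \<in> conv G'"
    using conv_mixture[OF finite_subset[OF assms(2,1)] assms(1), of c "\<lambda>B. B"] assms(2)
    by (simp add: subset_iff del: indicator_simps sum_mult_indicator)
qed

definition restricted :: "rvec \<Rightarrow> nat set \<Rightarrow> rvec" where
  "restricted x A = (\<lambda>e. x e * indicat_real A e)"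

lemma restricted_eq: "(\<And>e. e \<notin> A \<Longrightarrow> x e = 0) \<Longrightarrow> restricted x A = x"
  unfolding restricted_def indicator_def by (rule ext) (metis mult.right_neutral mult_zero_left of_bool_eq)

text \<open>Intersecting every set of the mixture with \<open>A'\<close> realizes the restriction,
  and downward closure keeps the intersections feasible.\<close>

lemma conv_on:
  assumes "finite F" "\<forall>A\<in>F. \<forall>B. B \<subseteq> A \<longrightarrow> B \<in> F" "x \<in> conv (restrict_family F A)"
  shows "restricted x A' \<in> conv (restrict_family F (A \<inter> A'))"
proof -
  obtain c where c: "\<forall>B\<in>restrict_family F A. 0 \<le> c B" "sum c (restrict_family F A) = 1"
    "x = (\<lambda>e. \<Sum>B\<in>restrict_family F A. c B * indicat_real B e)"
    using assms(3) unfolding conv_def by blast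
  have "restricted x A' = (\<lambda>e. \<Sum>B\<in>restrict_family F A. c B * indicat_real (B \<inter> A') e)"
    by (simp add: restricted_def c(3) sum_distrib_right indicator_inter_arith mult.assoc)
  also have "\<dots> \<in> conv (restrict_family F (A \<inter> A'))"
    using assms c by (intro conv_mixture) (auto simp: restrict_family_def)
  finally show ?thesis .
qed

lemma conv_bounds:
  assumes "x \<in> conv G" shows "0 \<le> x e" "x e \<le> 1"
proof -
  obtain c where c: "\<forall>B\<in>G. 0 \<le> c B" "sum c G = 1"
    "x = (\<lambda>e. \<Sum>B\<in>G. c B * indicat_real B e)"
    using assms unfolding conv_def by blast
  show "0 \<le> x e" using c by (auto intro!: sum_nonneg)
  have "x e \<le> (\<Sum>B\<in>G. c B * 1)" unfolding c(3)
    using c by (intro sum_mono mult_left_mono) (auto simp: indicator_def)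
  then show "x e \<le> 1" using c by simp
qed

lemma conv_support:
  assumes "x \<in> conv (restrict_family F A)" "e \<notin> A" shows "x e = 0"
proof -
  obtain c where "x = (\<lambda>e. \<Sum>B\<in>restrict_family F A. c B * indicat_real B e)"
    using assms unfolding conv_def by blast
  then show ?thesis using assms(2) by (auto simp: restrict_family_def indicator_def intro!: sum.neutral)
qed

lemma sum_conv:
  assumes "x = (\<lambda>e. \<Sum>B\<in>G. c B * indicat_real B e)" "\<And>B. B \<in> G \<Longrightarrow> B \<subseteq> U" "finite U"
  shows "(\<Sum>e\<in>U. a e * x e) = (\<Sum>B\<in>G. c B * sum a B)"
proof -
  have "(\<Sum>e\<in>U. a e * x e) = (\<Sum>B\<in>G. c B * (\<Sum>e\<in>U. a e * indicat_real B e))"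
    unfolding assms(1) sum_distrib_left by (subst sum.swap) (simp add: algebra_simps)
  also have "\<dots> = (\<Sum>B\<in>G. c B * sum a B)"
  proof (intro sum.cong refl)
    fix B assume "B \<in> G"
    then have "(\<Sum>e\<in>U. a e * indicat_real B e) = sum a B"
      using assms by (subst sum.mono_neutral_right[of U B]) (auto simp: indicator_def intro: sum.cong)
    then show "c B * (\<Sum>e\<in>U. a e * indicat_real B e) = c B * sum a B" by simp
  qed
  finally show ?thesis .
qed

section \<open>Profits, integral optima and fractional optima of an instance\<close>

locale profit_instance =
  fixes d :: nat and U :: "nat set" and F :: "nat set set" and g :: "rvec \<Rightarrow> real"
    and v :: "nat \<Rightarrow> real" and s :: "nat \<Rightarrow> rvec"
  assumes finite_U: "finite U"
    and v_nonneg: "e \<in> U \<Longrightarrow> 0 \<le> v e"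
    and s_orthant: "e \<in> U \<Longrightarrow> s e \<in> orthant d"
    and F_subset: "F \<subseteq> Pow U"
    and F_empty: "{} \<in> F"
    and F_down: "\<forall>A\<in>F. \<forall>B. B \<subseteq> A \<longrightarrow> B \<in> F"
    and separable: "separable d g"
    and coord_convex: "i < d \<Longrightarrow> convex_cost (coord_cost g i)"
    and non_exceptional: "e \<in> U \<Longrightarrow> \<not> exceptional g v s e"
begin

abbreviation "p \<equiv> set_profit U g v s"
abbreviation "fo \<equiv> fopt U F g v s"
abbreviation "\<phi> \<equiv> coord_cost g"

definition iopt :: "nat set \<Rightarrow> real" where
  "iopt A = Max (p ` restrict_family F A)"

text \<open>The curve point with parameter \<open>\<tau>\<close>, padded with zeros to lie in
  \<open>orthant d\<close>. The agreement with the definition through conjugates is part of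
  \<open>parametrization_exists\<close>.\<close>

definition lam :: "real \<Rightarrow> rvec" where
  "lam \<tau> = (\<lambda>i. if i < d then price (\<phi> i) \<tau> else 0)"

lemma s_nonneg: "e \<in> U \<Longrightarrow> 0 \<le> s e i"
  using s_orthant[of e] by (cases "i < d") (auto simp: orthant_def)

lemma finite_F: "finite F"
  using finite_U F_subset finite_subset by blast

lemma finite_restrict [simp]: "finite (restrict_family F A)"
  using finite_F by (simp add: restrict_family_def)

lemma empty_restrict [simp]: "{} \<in> restrict_family F A"
  using F_empty by (simp add: restrict_family_def)

lemma F_U: "B \<in> F \<Longrightarrow> B \<subseteq> U"
  using F_subset by auto

lemma \<phi>_zero: "i < d \<Longrightarrow> \<phi> i 0 = 0"
  using coord_convex convex_cost.zero by blast

lemma profit_on: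
  assumes "\<And>e. e \<in> U \<Longrightarrow> 0 \<le> x e" "A \<subseteq> U"
  shows "profit U g v s (restricted x A) = (\<Sum>e\<in>A. v e * x e) - (\<Sum>i<d. \<phi> i (\<Sum>e\<in>A. s e i * x e))"
proof -
  have *: "(\<Sum>e\<in>U. a e * restricted x A e) = (\<Sum>e\<in>A. a e * x e)" for a
    using assms finite_U by (subst sum.mono_neutral_right[of U A]) (auto simp: restricted_def indicator_def intro: sum.cong)
  have "(\<lambda>i. \<Sum>e\<in>A. s e i * x e) \<in> orthant d"
    using assms s_orthant s_nonneg unfolding orthant_def by (auto intro!: sum_nonneg mult_nonneg_nonneg sum.neutral)
  then show ?thesis
    using separable unfolding profit_def * separable_def by simp
qed

lemma set_profit_eq:
  assumes "A \<subseteq> U"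
  shows "p A = sum v A - (\<Sum>i<d. \<phi> i (\<Sum>e\<in>A. s e i))"
proof -
  have "indicat_real A = restricted (\<lambda>_. 1) A" by (simp add: restricted_def)
  then show ?thesis using profit_on[of "\<lambda>_. 1" A] assms by simp
qed

lemma profit_eq:
  assumes "x \<in> conv (restrict_family F A)" "A \<subseteq> U"
  shows "profit U g v s x = (\<Sum>e\<in>A. v e * x e) - (\<Sum>i<d. \<phi> i (\<Sum>e\<in>A. s e i * x e))"
proof -
  have "x = restricted x A"
    using restricted_eq[of A x] conv_support[OF assms(1)] by simp
  then show ?thesis using profit_on[of x A] conv_bounds[OF assms(1)] assms(2) by simp
qed

lemma set_profit_empty [simp]: "p {} = 0"
  using set_profit_eq[of "{}"] \<phi>_zero by simp

lemma iopt_upper: "B \<in> F \<Longrightarrow> B \<subseteq> A \<Longrightarrow> p B \<le> iopt A"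
  unfolding iopt_def by (intro Max_ge) (auto simp: restrict_family_def F_empty finite_F)

lemma iopt_nonneg: "0 \<le> iopt A"
  using iopt_upper[OF F_empty, of A] by simp

lemma iopt_least:
  assumes "\<And>B. B \<in> F \<Longrightarrow> B \<subseteq> A \<Longrightarrow> p B \<le> K"
  shows "iopt A \<le> K"
proof -
  have "p ` restrict_family F A \<noteq> {}" using empty_restrict by blast
  then show ?thesis unfolding iopt_def using assms by (subst Max_le_iff) (auto simp: restrict_family_def finite_F)
qed

lemma iopt_mono: "A \<subseteq> A' \<Longrightarrow> iopt A \<le> iopt A'"
  by (rule iopt_least, rule iopt_upper) auto

lemma opt_eq: "opt U F g v s = iopt U"
proof -
  have "restrict_family F U = F" using F_subset by (auto simp: restrict_family_def)
  then show ?thesis by (simp add: opt_def iopt_def)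
qed

lemma submodular_profit_on:
  assumes "\<And>e. e \<in> U \<Longrightarrow> 0 \<le> x e"
  shows "submodular_on U (\<lambda>A. profit U g v s (restricted x A))"
proof -
  have "submodular_on U (\<lambda>A. (\<Sum>e\<in>A. v e * x e) - (\<Sum>i<d. \<phi> i (\<Sum>e\<in>A. s e i * x e)))"
    using assms s_nonneg by (intro submodular_on_value_minus_cost finite_U convex_cost.convex coord_convex) auto
  then show ?thesis
    unfolding submodular_on_def by (simp add: profit_on[OF assms] le_infI1)
qed

lemma profit_on_empty [simp]: "profit U g v s (restricted x {}) = 0"
proof -
  have "restricted x {} = indicat_real {}" by (rule ext) (simp add: restricted_def)
  then show ?thesis using set_profit_empty by simp
qed

lemma profit_on_U:
  assumes "x \<in> conv (restrict_family F A)" "A \<subseteq> U"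
  shows "profit U g v s (restricted x A) = profit U g v s x"
proof -
  have "x = restricted x A"
    using restricted_eq[of A x] conv_support[OF assms(1)] by simp
  then show ?thesis by simp
qed

text \<open>For a non-exceptional item some optimal fraction is an endpoint of
  \<open>{0..1}\<close>, so no fraction beats both taking nothing and taking the whole item.\<close>

lemma scaled_item_profit:
  assumes "e \<in> U" "0 \<le> \<theta>" "\<theta> \<le> 1"
  shows "\<theta> * v e - (\<Sum>i<d. \<phi> i (\<theta> * s e i)) \<le> max 0 (p {e})"
proof -
  define f where "f = (\<lambda>\<theta>. \<theta> * v e - g (\<lambda>i. \<theta> * s e i))"
  have f: "f \<theta> = \<theta> * v e - (\<Sum>i<d. \<phi> i (\<theta> * s e i))" if "0 \<le> \<theta>" for \<theta>
  proof -
    have "(\<lambda>i. \<theta> * s e i) \<in> orthant d" using s_orthant[OF assms(1)] that by (auto simp: orthant_def)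
    then show ?thesis using separable by (simp add: f_def separable_def)
  qed
  obtain \<xi> where \<xi>: "is_arg_max f (\<lambda>\<theta>. \<theta> \<in> {0..1}) \<xi>" "\<xi> \<notin> {0<..<1}"
    using non_exceptional[OF assms(1)] unfolding exceptional_def f_def by blast
  then have "\<xi> = 0 \<or> \<xi> = 1" and max: "f \<theta> \<le> f \<xi>"
    using assms unfolding is_arg_max_linorder by auto
  moreover have "f 0 = 0" using f[of 0] \<phi>_zero by simp
  moreover have "f 1 = p {e}" using f[of 1] set_profit_eq[of "{e}"] assms by simp
  ultimately show ?thesis using f[OF assms(2)] by auto
qed

lemma profit_on_single:
  assumes "e \<in> U" "\<And>e. e \<in> U \<Longrightarrow> 0 \<le> x e" "x e \<le> 1"
  shows "profit U g v s (restricted x {e}) \<le> max 0 (p {e})"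
  using profit_on[of x "{e}"] scaled_item_profit[of e "x e"] assms by (simp add: mult.commute)

text \<open>A crude bound that makes the supremum in \<open>fopt\<close> bounded above.\<close>

lemma profit_conv_le:
  assumes "x \<in> conv (restrict_family F A)" "A \<subseteq> U"
  shows "profit U g v s x \<le> sum v U"
proof -
  have "(\<Sum>i<d. \<phi> i (\<Sum>e\<in>A. s e i * x e)) \<ge> 0"
  proof (rule sum_nonneg)
    fix i assume "i \<in> {..<d}"
    moreover have "0 \<le> (\<Sum>e\<in>A. s e i * x e)"
      using conv_bounds[OF assms(1)] assms(2) s_nonneg by (intro sum_nonneg mult_nonneg_nonneg) auto
    ultimately show "0 \<le> \<phi> i (\<Sum>e\<in>A. s e i * x e)"
      using coord_convex convex_cost.nonneg by simp
  qed
  moreover have "(\<Sum>e\<in>A. v e * x e) \<le> (\<Sum>e\<in>A. v e * 1)"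
    using conv_bounds[OF assms(1)] assms(2) v_nonneg by (intro sum_mono mult_left_mono) auto
  moreover have "(\<Sum>e\<in>A. v e * 1) \<le> sum v U"
    using assms(2) v_nonneg finite_U by (auto intro!: sum_mono2)
  ultimately show ?thesis using profit_eq[OF assms] by linarith
qed

lemma fopt_upper:
  assumes "x \<in> conv (restrict_family F A)" "A \<subseteq> U"
  shows "profit U g v s x \<le> fo A"
  unfolding fopt_def using assms
  by (intro cSUP_upper bdd_aboveI2[of _ _ "sum v U"] profit_conv_le) auto

lemma conv_nonempty: "conv (restrict_family F A) \<noteq> {}"
  using conv_indicator[OF finite_restrict empty_restrict] by blast

lemma fopt_least:
  assumes "\<And>x. x \<in> conv (restrict_family F A) \<Longrightarrow> profit U g v s x \<le> K"
  shows "fo A \<le> K"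
  unfolding fopt_def using assms conv_nonempty by (intro cSUP_least) auto

lemma iopt_le_fopt:
  assumes "A \<subseteq> U" shows "iopt A \<le> fo A"
proof (rule iopt_least)
  fix B assume "B \<in> F" "B \<subseteq> A"
  then have "indicat_real B \<in> conv (restrict_family F A)"
    by (intro conv_indicator finite_restrict) (simp add: restrict_family_def)
  then show "p B \<le> fo A" using assms by (rule fopt_upper)
qed

lemma fopt_nonneg: "A \<subseteq> U \<Longrightarrow> 0 \<le> fo A"
  using iopt_le_fopt[of A] iopt_nonneg[of A] by simp

lemma fopt_mono:
  assumes "A \<subseteq> B" "B \<subseteq> U" shows "fo A \<le> fo B"
proof (rule fopt_least)
  fix x assume "x \<in> conv (restrict_family F A)"
  then have "x \<in> conv (restrict_family F B)"
    using conv_mono[of "restrict_family F B" "restrict_family F A"] assms(1)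
    by (auto simp: restrict_family_def finite_F)
  then show "profit U g v s x \<le> fo B" using assms(2) by (rule fopt_upper)
qed

text \<open>By submodularity, splitting a fractional point into its part on \<open>e\<close> and the
  rest does not lower the total profit, and the part on \<open>e\<close> is worth at most the whole
  item or nothing. This pays for the single item that may be lost in
  \<open>candidates_bounds\<close>.\<close>

lemma fopt_remove:
  assumes "A \<subseteq> U" "e \<in> U"
  shows "fo A \<le> fo (A - {e}) + max 0 (p {e})"
proof (rule fopt_least)
  fix x assume x: "x \<in> conv (restrict_family F A)"
  have x0: "\<And>e. 0 \<le> x e" and x1: "x e \<le> 1" using conv_bounds[OF x] by auto
  have "restricted x (- {e}) \<in> conv (restrict_family F (A \<inter> - {e}))"
    by (rule conv_on[OF finite_F F_down x])
  moreover have "restricted x (- {e}) = restricted x (U - {e})"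
    using conv_support[OF x] assms(1) by (intro ext) (auto simp: restricted_def indicator_def)
  ultimately have "profit U g v s (restricted x (U - {e})) \<le> fo (A - {e})"
    using assms(1) by (intro fopt_upper) (auto simp: Diff_eq)
  moreover have "profit U g v s (restricted x (U - {e} \<union> {e})) + profit U g v s (restricted x ((U - {e}) \<inter> {e}))
      \<le> profit U g v s (restricted x (U - {e})) + profit U g v s (restricted x {e})"
    using submodular_profit_on[of x, unfolded submodular_on_def, rule_format, of "U - {e}" "{e}"] x0 assms(2)
    by simp
  moreover have "profit U g v s (restricted x {e}) \<le> max 0 (p {e})"
    using assms(2) x0 x1 by (intro profit_on_single)
  moreover have "U - {e} \<union> {e} = U" "(U - {e}) \<inter> {e} = {}" using assms(2) by auto
  moreover have "restricted x U = x"
    using conv_support[OF x] assms(1) by (intro restricted_eq) auto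
  ultimately show "profit U g v s x \<le> fo (A - {e}) + max 0 (p {e})" by simp
qed

text \<open>
  A maximizer in the convex hull need not be constructed: take a nearly optimal point and restrict it
  to the best subset \<open>B\<close> of its support.  Optimality of \<open>B\<close> makes the greedy weights nonnegative.
\<close>

lemma fopt_base:
  assumes "A \<subseteq> U" "\<theta> < fo A" "\<And>e. e \<in> U \<Longrightarrow> p {e} \<le> m" "0 \<le> m"
  obtains w where "\<And>e. e \<in> A \<Longrightarrow> 0 \<le> w e" "\<And>e. e \<in> A \<Longrightarrow> w e \<le> m"
    "\<theta> < sum w A" "sum w A \<le> fo A" "\<And>L. L \<subseteq> A \<Longrightarrow> sum w L \<le> fo L"
proof -
  obtain x where x: "x \<in> conv (restrict_family F A)" "\<theta> < profit U g v s x"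
    using fopt_least[of A \<theta>] assms(2) by force
  have x0: "\<And>e. 0 \<le> x e" and x1: "\<And>e. x e \<le> 1" using conv_bounds[OF x(1)] by auto
  define h where "h = (\<lambda>B. profit U g v s (restricted x B))"
  have finA: "finite A" using assms(1) finite_U finite_subset by auto
  have "Max (h ` Pow A) \<in> h ` Pow A" using finA by (intro Max_in) auto
  then obtain B where B: "B \<subseteq> A" "Max (h ` Pow A) = h B" by auto
  then have B_max: "h B' \<le> h B" if "B' \<subseteq> A" for B'
    using that finA Max_ge[of "h ` Pow A" "h B'"] by auto
  have finB: "finite B" using B(1) finA finite_subset by auto
  have "submodular_on B h"
    using submodular_profit_on[of x] x0 B(1) assms(1) unfolding h_def submodular_on_def by (meson subset_trans)
  then obtain w where w: "sum w B = h B" "\<And>L. L \<subseteq> B \<Longrightarrow> sum w L \<le> h L"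
    using submodular_base_exists[OF finB, of h] by (auto simp: h_def)
  have h_fo: "h L \<le> fo L" if "L \<subseteq> A" for L
    unfolding h_def using conv_on[OF finite_F F_down x(1), of L] that assms(1)
    by (intro fopt_upper) (auto simp: Int_absorb1)
  define w' where "w' = (\<lambda>e. if e \<in> B then w e else 0)"
  have w'_sum: "sum w' L = sum w (L \<inter> B)" if "L \<subseteq> A" for L
    unfolding w'_def using that finA finite_subset by (subst sum.inter_restrict[symmetric]) auto
  have wL: "sum w' L \<le> fo L" if L: "L \<subseteq> A" for L
  proof -
    have "sum w' L \<le> h (L \<inter> B)" using w(2)[of "L \<inter> B"] w'_sum[OF L] by simp
    also have "\<dots> \<le> fo (L \<inter> B)" using L by (intro h_fo) auto
    also have "\<dots> \<le> fo L" using L assms(1) by (intro fopt_mono) auto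
    finally show ?thesis .
  qed
  show ?thesis
  proof
    fix e assume e: "e \<in> A"
    show "0 \<le> w' e"
    proof (cases "e \<in> B")
      case True
      have "sum w B = w e + sum w (B - {e})" using True finB by (simp add: sum.remove)
      moreover have "sum w (B - {e}) \<le> h B" using w(2)[of "B - {e}"] B_max[of "B - {e}"] B(1) by force
      ultimately show ?thesis using w(1) True by (simp add: w'_def)
    qed (simp add: w'_def)
    show "w' e \<le> m"
    proof (cases "e \<in> B")
      case True
      have "w e \<le> h {e}" using w(2)[of "{e}"] True by simp
      also have "\<dots> \<le> max 0 (p {e})" unfolding h_def
        using e assms(1) x0 x1 by (intro profit_on_single) auto
      also have "\<dots> \<le> m" using assms(3)[of e] assms(1,4) e by auto
      finally show ?thesis using True by (simp add: w'_def)
    qed (simp add: w'_def assms)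
  next
    have "h A = profit U g v s x" unfolding h_def by (rule profit_on_U[OF x(1) assms(1)])
    then have "\<theta> < h B" using B_max[of A] x(2) by simp
    then show "\<theta> < sum w' A" using w'_sum[of A] w(1) B(1) by (simp add: Int_absorb1)
    show "sum w' A \<le> fo A" by (rule wL) simp
  qed (rule wL)
qed

end

section \<open>The threshold price\<close>

context profit_instance
begin

abbreviation "upper \<tau> X \<equiv> items_above d v s (lam \<tau>) X"
abbreviation "strict_upper \<tau> X \<equiv> items_strictly_above d v s (lam \<tau>) X"

abbreviation load :: "nat \<Rightarrow> nat set \<Rightarrow> real" where
  "load i A \<equiv> \<Sum>e\<in>A. s e i"

lemma load_nonneg: "A \<subseteq> U \<Longrightarrow> 0 \<le> load i A"
  using s_nonneg by (intro sum_nonneg) auto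

lemma load_mono: "A \<subseteq> B \<Longrightarrow> B \<subseteq> U \<Longrightarrow> load i A \<le> load i B"
  using s_nonneg finite_U finite_subset by (intro sum_mono2) auto

lemma sum_dotp: "(\<Sum>e\<in>A. dotp d \<mu> (s e) * x e) = (\<Sum>i<d. \<mu> i * (\<Sum>e\<in>A. s e i * x e))"
  unfolding dotp_def sum_distrib_left sum_distrib_right by (subst sum.swap) (simp add: mult.assoc)

lemma sum_dotp_set: "(\<Sum>e\<in>A. dotp d (lam \<tau>) (s e)) = (\<Sum>i<d. price (\<phi> i) \<tau> * load i A)"
  using sum_dotp[of "lam \<tau>" "\<lambda>_. 1" A] by (simp add: lam_def)

lemma lam_nonneg: "0 \<le> \<tau> \<Longrightarrow> 0 \<le> lam \<tau> i"
  using coord_convex by (simp add: lam_def convex_cost.price_nonneg)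

lemma lam_mono: "0 \<le> \<tau> \<Longrightarrow> \<tau> \<le> \<tau>' \<Longrightarrow> lam \<tau> i \<le> lam \<tau>' i"
  using convex_cost.price_strict_mono[OF coord_convex, of i \<tau> \<tau>'] by (cases "\<tau> = \<tau>'") (auto simp: lam_def)

lemma dotp_mono:
  assumes "e \<in> U" "\<And>i. \<mu> i \<le> \<nu> i" shows "dotp d \<mu> (s e) \<le> dotp d \<nu> (s e)"
  unfolding dotp_def using assms s_nonneg by (intro sum_mono mult_right_mono) auto

lemma upper_antimono:
  assumes "0 \<le> \<tau>" "\<tau> \<le> \<tau>'" "X \<subseteq> U"
  shows "upper \<tau>' X \<subseteq> upper \<tau> X"
proof
  fix e assume "e \<in> upper \<tau>' X"
  then show "e \<in> upper \<tau> X"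
    using dotp_mono[of e "lam \<tau>" "lam \<tau>'"] lam_mono[OF assms(1,2)] assms(3)
    by (fastforce simp: items_above_def)
qed

lemma continuous_dotp_lam: "continuous_on {0..} (\<lambda>\<tau>. dotp d (lam \<tau>) (s e))"
proof -
  have "(\<lambda>\<tau>. dotp d (lam \<tau>) (s e)) = (\<lambda>\<tau>. \<Sum>i<d. price (\<phi> i) \<tau> * s e i)"
    by (simp add: dotp_def lam_def)
  then show ?thesis
    by (simp only:) (intro continuous_intros convex_cost.price_continuous coord_convex, auto)
qed

text \<open>Strict inequalities between value and price persist nearby because prices are
  continuous, and simultaneously so because there are finitely many items. Only items tight at
  \<open>\<tau>\<close> can change sides.\<close>

lemma eventually_upper:
  assumes "X \<subseteq> U" "0 \<le> \<tau>"
  shows "\<forall>\<^sub>F x in at \<tau> within {0..}. upper x X \<subseteq> upper \<tau> X \<and> strict_upper \<tau> X \<subseteq> strict_upper x X"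
proof -
  have lim: "((\<lambda>x. dotp d (lam x) (s e)) \<longlongrightarrow> dotp d (lam \<tau>) (s e)) (at \<tau> within {0..})" for e
    using continuous_dotp_lam[of e] assms(2) by (simp add: continuous_on_def)
  have "\<forall>\<^sub>F x in at \<tau> within {0..}. (e \<in> upper x X \<longrightarrow> e \<in> upper \<tau> X) \<and>
      (e \<in> strict_upper \<tau> X \<longrightarrow> e \<in> strict_upper x X)" for e
  proof (rule eventually_conj)
    show "\<forall>\<^sub>F x in at \<tau> within {0..}. e \<in> upper x X \<longrightarrow> e \<in> upper \<tau> X"
    proof (cases "e \<in> X \<and> v e < dotp d (lam \<tau>) (s e)")
      case True
      then have "\<forall>\<^sub>F x in at \<tau> within {0..}. v e < dotp d (lam x) (s e)"
        using order_tendstoD(1)[OF lim] by blast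
      then show ?thesis by eventually_elim (auto simp: items_above_def)
    qed (auto simp: items_above_def)
    show "\<forall>\<^sub>F x in at \<tau> within {0..}. e \<in> strict_upper \<tau> X \<longrightarrow> e \<in> strict_upper x X"
    proof (cases "e \<in> X \<and> dotp d (lam \<tau>) (s e) < v e")
      case True
      then have "\<forall>\<^sub>F x in at \<tau> within {0..}. dotp d (lam x) (s e) < v e"
        using order_tendstoD(2)[OF lim] by blast
      then show ?thesis by eventually_elim (use True in \<open>auto simp: items_strictly_above_def\<close>)
    qed (auto simp: items_strictly_above_def)
  qed
  then have "\<forall>\<^sub>F x in at \<tau> within {0..}. \<forall>e\<in>X. (e \<in> upper x X \<longrightarrow> e \<in> upper \<tau> X) \<and>
      (e \<in> strict_upper \<tau> X \<longrightarrow> e \<in> strict_upper x X)"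
    using assms(1) finite_U finite_subset by (intro eventually_ball_finite) auto
  then show ?thesis
    by eventually_elim (auto simp: items_above_def items_strictly_above_def)
qed

lemma set_profit_ge_priced:
  assumes "B \<subseteq> U" "0 \<le> \<tau>" "\<And>i. i < d \<Longrightarrow> load i B \<le> saturation (\<phi> i) \<tau>"
  shows "(\<Sum>e\<in>B. v e - dotp d (lam \<tau>) (s e)) \<le> p B"
proof -
  have "(\<Sum>i<d. \<phi> i (load i B)) \<le> (\<Sum>i<d. price (\<phi> i) \<tau> * load i B)"
    using assms by (intro sum_mono convex_cost.below_saturation coord_convex) (auto simp: load_nonneg)
  then show ?thesis
    using set_profit_eq[OF assms(1)] by (simp add: sum_subtractf sum_dotp_set)
qed

section \<open>Overfull parameters and the threshold\<close>

definition overfull :: "nat set \<Rightarrow> real \<Rightarrow> bool" where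
  "overfull X \<tau> \<longleftrightarrow> 0 \<le> \<tau> \<and>
     (\<exists>B\<in>F. B \<subseteq> upper \<tau> X \<and> (\<exists>i<d. saturation (\<phi> i) \<tau> < load i B))"

text \<open>Fenchel's inequality replaces the cost by linear prices at a loss of
  \<open>\<tau>\<close> per coordinate. The linear objective of a mixture is an average over its
  sets. In each set the items below the price contribute nothing positive, and the others stay below
  saturation, so their surplus is at most their profit.\<close>

lemma fopt_le_of_not_overfull:
  fixes \<tau> :: real
  assumes "X \<subseteq> U" "0 \<le> \<tau>" "\<not> overfull X \<tau>"
  shows "fo X \<le> iopt (upper \<tau> X) + d * \<tau>"
proof (rule fopt_least)
  fix x assume x: "x \<in> conv (restrict_family F X)"
  obtain c where c: "\<forall>B\<in>restrict_family F X. 0 \<le> c B" "sum c (restrict_family F X) = 1"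
    "x = (\<lambda>e. \<Sum>B\<in>restrict_family F X. c B * indicat_real B e)"
    using x unfolding conv_def by blast
  have finX: "finite X" using assms(1) finite_U finite_subset by auto
  let ?a = "\<lambda>e. v e - dotp d (lam \<tau>) (s e)"
  have "profit U g v s x = (\<Sum>e\<in>X. v e * x e) - (\<Sum>i<d. \<phi> i (\<Sum>e\<in>X. s e i * x e))"
    by (rule profit_eq[OF x assms(1)])
  also have "\<dots> \<le> (\<Sum>e\<in>X. v e * x e) - (\<Sum>i<d. lam \<tau> i * (\<Sum>e\<in>X. s e i * x e) - \<tau>)"
  proof -
    have "lam \<tau> i * (\<Sum>e\<in>X. s e i * x e) - \<tau> \<le> \<phi> i (\<Sum>e\<in>X. s e i * x e)" if "i < d" for i
    proof -
      have "0 \<le> (\<Sum>e\<in>X. s e i * x e)"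
        using conv_bounds[OF x] s_nonneg assms(1) by (intro sum_nonneg mult_nonneg_nonneg) auto
      then show ?thesis
        using convex_cost.fenchel[OF coord_convex[OF that] assms(2)] that by (simp add: lam_def)
    qed
    then show ?thesis by (intro diff_left_mono sum_mono) auto
  qed
  also have "\<dots> = (\<Sum>e\<in>X. ?a e * x e) + d * \<tau>"
    by (simp add: sum_subtractf sum_dotp[symmetric] left_diff_distrib)
  also have "(\<Sum>e\<in>X. ?a e * x e) = (\<Sum>B\<in>restrict_family F X. c B * sum ?a B)"
    by (rule sum_conv[OF c(3) _ finX]) (auto simp: restrict_family_def)
  also have "\<dots> \<le> (\<Sum>B\<in>restrict_family F X. c B * iopt (upper \<tau> X))"
  proof (intro sum_mono mult_left_mono)
    fix B assume B: "B \<in> restrict_family F X"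
    then have BF: "B \<in> F" "B \<subseteq> X" by (auto simp: restrict_family_def)
    define B' where "B' = upper \<tau> B"
    have B': "B' \<in> F" "B' \<subseteq> upper \<tau> X" "B' \<subseteq> U" "B' \<subseteq> B"
      using BF F_down F_U by (auto simp: B'_def items_above_def)
    have "sum ?a B = sum ?a B' + sum ?a (B - B')"
      using B' BF finX finite_subset by (subst add.commute, intro sum.subset_diff) auto
    moreover have "sum ?a (B - B') \<le> 0"
      by (intro sum_nonpos) (auto simp: B'_def items_above_def)
    moreover have "load i B' \<le> saturation (\<phi> i) \<tau>" if "i < d" for i
      using assms(2,3) B'(1,2) that unfolding overfull_def by (metis not_less)
    then have "sum ?a B' \<le> p B'" using assms(2) B'(3) by (intro set_profit_ge_priced)
    moreover have "p B' \<le> iopt (upper \<tau> X)" using B' by (intro iopt_upper)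
    ultimately show "sum ?a B \<le> iopt (upper \<tau> X)" by linarith
  qed (use c in auto)
  also have "\<dots> = iopt (upper \<tau> X)" using c by (simp add: sum_distrib_right[symmetric])
  finally show "profit U g v s x \<le> iopt (upper \<tau> X) + d * \<tau>" by simp
qed

text \<open>
  \<open>P\<close> is a maximal subset of \<open>B\<close> that exceeds no saturation point, and \<open>\<theta>\<close> is the largest fraction of a
  further item \<open>e\<close> that can be added; then some coordinate \<open>i\<close> is exactly saturated.
\<close>

lemma overfull_le:
  assumes "X \<subseteq> U" "overfull X \<tau>"
  shows "\<tau> \<le> 2 * iopt (upper \<tau> X)"
proof -
  let ?T = "\<lambda>i. saturation (\<phi> i) \<tau>"
  obtain B i0 where \<tau>: "0 \<le> \<tau>" and B: "B \<in> F" "B \<subseteq> upper \<tau> X" and i0: "i0 < d" "?T i0 < load i0 B"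
    using assms(2) unfolding overfull_def by blast
  have BU: "B \<subseteq> U" using F_U B by auto
  have finB: "finite B" using BU finite_U finite_subset by auto
  define fits where "fits = (\<lambda>P. \<forall>i<d. load i P \<le> ?T i)"
  have "fits {}"
    using convex_cost.saturation_nonneg[OF coord_convex \<tau>] by (simp add: fits_def)
  then have "\<exists>P. P \<subseteq> B \<and> fits P \<and> (\<forall>Q. Q \<subseteq> B \<and> fits Q \<longrightarrow> P \<subseteq> Q \<longrightarrow> P = Q)"
    using finite_has_maximal[of "{P. P \<subseteq> B \<and> fits P}"] finB by auto
  then obtain P where P: "P \<subseteq> B" "fits P" "\<And>Q. Q \<subseteq> B \<Longrightarrow> fits Q \<Longrightarrow> P \<subseteq> Q \<Longrightarrow> P = Q"
    by blast
  have PU: "P \<subseteq> U" and finP: "finite P" using P BU finB finite_subset by auto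
  have "P \<noteq> B" using P(2) i0 by (force simp: fits_def)
  then obtain e where e: "e \<in> B" "e \<notin> P" using P(1) by blast
  have eU: "e \<in> U" using e BU by auto
  \<comment> \<open>The coordinates that the whole of \<open>e\<close> would overfill. Its size is
    positive there, and the tightest ratio over \<open>J\<close> determines the fraction
    \<open>\<theta>\<close>.\<close>
  define J where "J = {i. i < d \<and> ?T i < load i P + s e i}"
  have "\<not> fits (insert e P)" using P(3)[of "insert e P"] P(1) e by auto
  then have "J \<noteq> {}" using e finP by (auto simp: J_def fits_def not_le add.commute)
  moreover have "finite J" by (auto simp: J_def)
  ultimately obtain i where i: "i \<in> J" and min: "\<And>j. j \<in> J \<Longrightarrow>
      (?T i - load i P) / s e i \<le> (?T j - load j P) / s e j"
    using ex_min_if_finite[of "(\<lambda>i. (?T i - load i P) / s e i) ` J"]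
    by (auto simp: not_less)
  define \<theta> where "\<theta> = (?T i - load i P) / s e i"
  have spos: "0 < s e j" if "j \<in> J" for j
    using that P(2) by (force simp: J_def fits_def)
  have id: "i < d" using i by (simp add: J_def)
  have \<theta>: "0 \<le> \<theta>" "\<theta> \<le> 1"
    using i spos[OF i] P(2) by (auto simp: \<theta>_def J_def fits_def field_simps)
  define z where "z = (\<lambda>j. load j P + \<theta> * s e j)"
  have z0: "0 \<le> z j" for j using load_nonneg[OF PU] s_nonneg[OF eU] \<theta> by (simp add: z_def)
  have zT: "z j \<le> ?T j" if j: "j < d" for j
  proof (cases "j \<in> J")
    case True
    have "\<theta> * s e j \<le> (?T j - load j P) / s e j * s e j"
      using min[OF True] spos[OF True] unfolding \<theta>_def[symmetric] by (intro mult_right_mono) auto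
    then show ?thesis using spos[OF True] by (simp add: z_def)
  next
    case False
    have "\<theta> * s e j \<le> 1 * s e j" using \<theta> s_nonneg[OF eU] by (intro mult_right_mono) auto
    then show ?thesis using False j by (auto simp: z_def J_def not_less)
  qed
  have zi: "z i = ?T i" using spos[OF i] by (simp add: z_def \<theta>_def)
  \<comment> \<open>The saturated coordinate alone has surplus \<open>\<tau>\<close> at these
    prices; the other coordinates are at most saturated and have nonnegative surplus.\<close>
  have "\<tau> = price (\<phi> i) \<tau> * z i - \<phi> i (z i)"
    using convex_cost.price_tight[OF coord_convex[OF id] \<tau>] by (simp add: zi)
  also have "\<dots> \<le> (\<Sum>j<d. price (\<phi> j) \<tau> * z j - \<phi> j (z j))"
    using id convex_cost.below_saturation[OF coord_convex \<tau> z0 zT]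
    by (intro member_le_sum) auto
  also have "\<dots> = (\<Sum>x\<in>P. dotp d (lam \<tau>) (s x)) + \<theta> * dotp d (lam \<tau>) (s e) - (\<Sum>j<d. \<phi> j (z j))"
    unfolding sum_dotp_set
    by (simp add: dotp_def lam_def z_def sum_subtractf distrib_left sum.distrib sum_distrib_left algebra_simps)
  also have "\<dots> \<le> sum v P + \<theta> * v e - (\<Sum>j<d. \<phi> j (z j))"
    using P(1) B(2) e \<theta> by (intro diff_right_mono add_mono sum_mono mult_left_mono) (auto simp: items_above_def)
  \<comment> \<open>A convex cost vanishing at \<open>0\<close> is superadditive, so
    \<open>P\<close> and the fraction of \<open>e\<close> can be charged separately.\<close>
  also have "\<dots> \<le> sum v P + \<theta> * v e - (\<Sum>j<d. \<phi> j (load j P) + \<phi> j (\<theta> * s e j))"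
  proof -
    have "\<phi> j (load j P) + \<phi> j (\<theta> * s e j) \<le> \<phi> j 0 + \<phi> j (z j)" if "j < d" for j
      using load_nonneg[OF PU] s_nonneg[OF eU] \<theta> that
      by (intro convex_on_four_points convex_cost.convex coord_convex) (auto simp: z_def)
    then show ?thesis using \<phi>_zero by (intro diff_left_mono sum_mono) auto
  qed
  also have "\<dots> = p P + (\<theta> * v e - (\<Sum>j<d. \<phi> j (\<theta> * s e j)))"
    by (simp add: set_profit_eq[OF PU] sum.distrib)
  also have "\<dots> \<le> iopt (upper \<tau> X) + iopt (upper \<tau> X)"
  proof (intro add_mono)
    have "P \<in> F" "{e} \<in> F" using F_down B(1) P(1) e by auto
    then have "p P \<le> iopt (upper \<tau> X)" "p {e} \<le> iopt (upper \<tau> X)"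
      using P(1) e B(2) by (auto intro!: iopt_upper)
    then show "p P \<le> iopt (upper \<tau> X)"
      and "\<theta> * v e - (\<Sum>j<d. \<phi> j (\<theta> * s e j)) \<le> iopt (upper \<tau> X)"
      using scaled_item_profit[OF eU \<theta>] iopt_nonneg[of "upper \<tau> X"] by auto
  qed
  finally show ?thesis by simp
qed

text \<open>Once every saturation point is at least the load of all items, no set can be
  overfull.\<close>

lemma overfull_bounded:
  assumes "overfull X \<tau>" "X \<subseteq> U"
  shows "\<tau> \<le> (\<Sum>i<d. legendre (\<phi> i) (load i U))"
proof -
  obtain B i where \<tau>: "0 \<le> \<tau>" and B: "B \<in> F" and i: "i < d" "saturation (\<phi> i) \<tau> < load i B"
    using assms(1) unfolding overfull_def by blast
  have nn: "0 \<le> legendre (\<phi> j) (load j U)" if "j < d" for j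
    by (rule convex_cost.legendre_nonneg[OF coord_convex[OF that] load_nonneg]) simp
  have "saturation (\<phi> i) \<tau> < load i U" using i load_mono[OF F_U[OF B] order_refl, of i] by simp
  then have "\<tau> \<le> legendre (\<phi> i) (load i U)"
    using convex_cost.saturation_large[OF coord_convex[OF i(1)], of "load i U" \<tau>] load_nonneg[of U] by force
  also have "\<dots> \<le> (\<Sum>i<d. legendre (\<phi> i) (load i U))"
    using i nn by (intro member_le_sum) auto
  finally show ?thesis .
qed

text \<open>Inserting 0 covers the case that no parameter is overfull; \<open>lam 0\<close> is then the vector of slopes at 0.\<close>

definition threshold :: "nat set \<Rightarrow> real" where
  "threshold X = Sup (insert 0 (Collect (overfull X)))"

lemma
  assumes "X \<subseteq> U"
  shows threshold_upper: "overfull X \<tau> \<Longrightarrow> \<tau> \<le> threshold X"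
    and threshold_nonneg: "0 \<le> threshold X"
    and threshold_approx: "x < threshold X \<Longrightarrow> 0 < threshold X \<Longrightarrow> \<exists>\<tau>>x. overfull X \<tau>"
proof -
  have bdd: "bdd_above (insert 0 (Collect (overfull X)))"
    using overfull_bounded assms by (auto intro!: bdd_aboveI)
  show "overfull X \<tau> \<Longrightarrow> \<tau> \<le> threshold X"
    unfolding threshold_def by (intro cSup_upper bdd) auto
  show "0 \<le> threshold X"
    unfolding threshold_def by (intro cSup_upper bdd) auto
  show "\<exists>\<tau>>x. overfull X \<tau>" if "x < threshold X" "0 < threshold X"
  proof -
    have "max x 0 < threshold X" using that by simp
    then show ?thesis unfolding threshold_def using less_cSup_iff[OF _ bdd, of "max x 0"] by auto
  qed
qed

text \<open>Because \<open>upper\<close> uses the weak inequality, parameters close to the threshold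
  have level sets inside the one at the threshold. The bound of \<open>overfull_le\<close> therefore
  passes to the supremum of the overfull parameters.\<close>

lemma threshold_le:
  assumes "X \<subseteq> U"
  shows "threshold X \<le> 2 * iopt (upper (threshold X) X)"
proof (cases "threshold X = 0")
  case True
  then show ?thesis using iopt_nonneg by simp
next
  case False
  then have pos: "0 < threshold X" using threshold_nonneg[OF assms] by simp
  let ?t = "threshold X" and ?K = "2 * iopt (upper (threshold X) X)"
  obtain \<delta> where \<delta>: "\<delta> > 0" "\<And>x. x \<ge> 0 \<Longrightarrow> x \<noteq> ?t \<Longrightarrow> dist x ?t < \<delta> \<Longrightarrow> upper x X \<subseteq> upper ?t X"
    using eventually_upper[OF assms threshold_nonneg[OF assms]] unfolding eventually_at by force
  show ?thesis
  proof (rule ccontr)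
    assume "\<not> ?thesis"
    then obtain \<tau> where \<tau>: "max ?K (?t - \<delta>) < \<tau>" "overfull X \<tau>"
      using threshold_approx[OF assms _ pos, of "max ?K (?t - \<delta>)"] \<delta>(1) by auto
    have "\<tau> \<le> ?t" "0 \<le> \<tau>" using threshold_upper[OF assms \<tau>(2)] \<tau>(2) by (auto simp: overfull_def)
    then have "upper \<tau> X \<subseteq> upper ?t X"
      using \<delta>(2)[of \<tau>] \<tau>(1) by (cases "\<tau> = ?t") (auto simp: dist_real_def)
    then have "\<tau> \<le> ?K" using overfull_le[OF assms \<tau>(2)] iopt_mono[of "upper \<tau> X" "upper ?t X"] by simp
    then show False using \<tau>(1) by simp
  qed
qed

text \<open>Parameters above the threshold are not overfull; letting them decrease to it gives the
  bound with \<open>d\<close> times the threshold, which \<open>threshold_le\<close>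
  absorbs.\<close>

lemma fopt_le_iopt_threshold:
  assumes "X \<subseteq> U"
  shows "fo X \<le> (2 * d + 1) * iopt (upper (threshold X) X)"
proof -
  let ?t = "threshold X"
  have "fo X \<le> iopt (upper ?t X) + d * ?t"
  proof (rule field_le_epsilon)
    fix \<epsilon> :: real assume \<epsilon>: "0 < \<epsilon>"
    \<comment> \<open>Dividing by \<open>d + 1\<close> keeps \<open>d\<close> times the increment
      below \<open>\<epsilon>\<close> and is safe for \<open>d = 0\<close>.\<close>
    define \<tau> where "\<tau> = ?t + \<epsilon> / (d + 1)"
    have \<tau>: "?t < \<tau>" "0 \<le> ?t" using \<epsilon> threshold_nonneg[OF assms] by (auto simp: \<tau>_def)
    then have "\<not> overfull X \<tau>" using threshold_upper[OF assms, of \<tau>] by auto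
    then have "fo X \<le> iopt (upper \<tau> X) + d * \<tau>"
      using \<tau> by (intro fopt_le_of_not_overfull assms) auto
    also have "\<dots> \<le> iopt (upper ?t X) + d * \<tau>"
      using \<tau> assms by (intro add_right_mono iopt_mono upper_antimono) auto
    also have "d * \<tau> = d * ?t + d / (d + 1) * \<epsilon>" by (simp add: \<tau>_def field_simps)
    also have "d / (d + 1) * \<epsilon> \<le> 1 * \<epsilon>" using \<epsilon> by (intro mult_right_mono) auto
    finally show "fo X \<le> iopt (upper ?t X) + d * ?t + \<epsilon>" by simp
  qed
  also have "d * ?t \<le> d * (2 * iopt (upper ?t X))"
    using threshold_le[OF assms] by (intro mult_left_mono) auto
  finally show ?thesis by (simp add: algebra_simps)
qed

text \<open>An integrality gap for arbitrary item sets: each \<open>X\<close> is analysed at its own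
  threshold, not at that of \<open>U\<close>.\<close>

lemma fopt_le_iopt: "X \<subseteq> U \<Longrightarrow> fo X \<le> (2 * d + 1) * iopt X"
proof -
  assume X: "X \<subseteq> U"
  have "iopt (upper (threshold X) X) \<le> iopt X" by (intro iopt_mono) (auto simp: items_above_def)
  then have "real (2 * d + 1) * iopt (upper (threshold X) X) \<le> real (2 * d + 1) * iopt X"
    by (rule mult_left_mono) simp
  with fopt_le_iopt_threshold[OF X] show ?thesis by (rule order_trans)
qed

text \<open>A feasible set strictly above the price that exceeds a saturation point would, by
  continuity, still do so at a slightly larger parameter, which would then be overfull.\<close>

lemma load_le_above_threshold:
  assumes "X \<subseteq> U" "B \<in> F" "B \<subseteq> strict_upper (threshold X) X" "i < d"
  shows "load i B \<le> saturation (\<phi> i) (threshold X)"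
proof (rule ccontr)
  let ?t = "threshold X"
  assume "\<not> ?thesis"
  moreover have "(saturation (\<phi> i) \<longlongrightarrow> saturation (\<phi> i) ?t) (at ?t within {0..})"
    using convex_cost.saturation_continuous[OF coord_convex[OF assms(4)]] threshold_nonneg[OF assms(1)]
    by (simp add: continuous_on_def)
  ultimately have "\<forall>\<^sub>F x in at ?t within {0..}. saturation (\<phi> i) x < load i B"
    by (intro order_tendstoD(2)) auto
  with eventually_upper[OF assms(1) threshold_nonneg[OF assms(1)]]
  have "\<forall>\<^sub>F x in at ?t within {0..}. saturation (\<phi> i) x < load i B \<and> strict_upper ?t X \<subseteq> strict_upper x X"
    by eventually_elim auto
  then obtain \<delta> where \<delta>: "\<delta> > 0" "\<And>x. x \<ge> 0 \<Longrightarrow> x \<noteq> ?t \<Longrightarrow> dist x ?t < \<delta> \<Longrightarrow>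
      saturation (\<phi> i) x < load i B \<and> strict_upper ?t X \<subseteq> strict_upper x X"
    unfolding eventually_at by force
  define \<tau> where "\<tau> = ?t + \<delta> / 2"
  have \<tau>: "0 \<le> \<tau>" "?t < \<tau>" "dist \<tau> ?t < \<delta>"
    using \<delta>(1) threshold_nonneg[OF assms(1)] by (auto simp: \<tau>_def dist_real_def)
  then have "saturation (\<phi> i) \<tau> < load i B" "B \<subseteq> strict_upper \<tau> X"
    using \<delta>(2)[of \<tau>] assms(3) by auto
  moreover from this have "B \<subseteq> upper \<tau> X" by (auto simp: items_above_def items_strictly_above_def)
  ultimately have "overfull X \<tau>" using assms(2,4) \<tau> by (auto simp: overfull_def)
  then show False using threshold_upper[OF assms(1)] \<tau> by fastforce
qed

section \<open>The monotone submodular surrogate of the profit\<close>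

definition tangent_profit :: "real \<Rightarrow> nat set \<Rightarrow> real" where
  "tangent_profit \<tau> A = sum v A - (\<Sum>i<d. tangent_cost (\<phi> i) \<tau> (load i A))"

lemma tangent_profit_submodular:
  assumes "0 \<le> \<tau>" "X \<subseteq> U"
  shows "submodular_on X (tangent_profit \<tau>)"
  unfolding tangent_profit_def using assms finite_U finite_subset s_nonneg
  by (intro submodular_on_value_minus_cost convex_cost.tangent_cost_convex coord_convex) auto

lemma tangent_profit_empty: "0 \<le> \<tau> \<Longrightarrow> tangent_profit \<tau> {} = 0"
  by (simp add: tangent_profit_def convex_cost.tangent_cost_zero coord_convex)

text \<open>The tangent costs never grow faster than the prices, and each item of \<open>X\<close>
  is worth more than its price.\<close>

lemma tangent_profit_mono:
  assumes "0 \<le> \<tau>" "X \<subseteq> strict_upper \<tau> U"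
  shows "mono_on (Pow X) (tangent_profit \<tau>)"
proof (rule mono_onI)
  fix A B assume AB: "A \<in> Pow X" "B \<in> Pow X" "A \<subseteq> B"
  have XU: "X \<subseteq> U" using assms(2) by (auto simp: items_strictly_above_def)
  then have U: "A \<subseteq> U" "B \<subseteq> U" using AB by auto
  then have finB: "finite B" using finite_U finite_subset by blast
  have diff: "sum f B = sum f A + sum f (B - A)" for f :: "nat \<Rightarrow> real"
    using sum.subset_diff[OF AB(3) finB, of f] by simp
  have "(\<Sum>i<d. tangent_cost (\<phi> i) \<tau> (load i B)) - (\<Sum>i<d. tangent_cost (\<phi> i) \<tau> (load i A))
      \<le> (\<Sum>i<d. price (\<phi> i) \<tau> * (load i B - load i A))"
    unfolding sum_subtractf[symmetric] using assms(1) U AB(3)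
    by (intro sum_mono convex_cost.tangent_cost_slope coord_convex) (auto simp: load_nonneg intro: load_mono)
  also have "\<dots> = (\<Sum>e\<in>B - A. dotp d (lam \<tau>) (s e))"
    by (simp add: diff sum_dotp_set)
  also have "\<dots> \<le> sum v (B - A)"
    using AB assms(2) by (intro sum_mono) (auto simp: items_strictly_above_def)
  finally show "tangent_profit \<tau> A \<le> tangent_profit \<tau> B"
    by (simp add: tangent_profit_def diff[of v])
qed

lemma tangent_profit_eq:
  assumes "B \<in> F" "B \<subseteq> strict_upper (threshold U) U"
  shows "tangent_profit (threshold U) B = p B"
  using load_le_above_threshold[OF order_refl assms] set_profit_eq[OF F_U[OF assms(1)]]
  by (simp add: tangent_profit_def tangent_cost_def)

end

section \<open>Random splitting and online runs\<close>

lemma sum_Pow_insert: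
  assumes "finite A" "a \<notin> A"
  shows "(\<Sum>L\<in>Pow (insert a A). f L) = (\<Sum>L\<in>Pow A. f L + f (insert a L))"
proof -
  have "inj_on (insert a) (Pow A)" using assms(2) by (force simp: inj_on_def)
  moreover have "Pow A \<inter> insert a ` Pow A = {}" using assms(2) by auto
  ultimately show ?thesis
    using assms(1) by (simp add: Pow_insert sum.union_disjoint sum.reindex sum.distrib)
qed

text \<open>The second moment of a sum of independent random signs with weights \<open>w\<close>:
  the cross terms with \<open>w a\<close> cancel when \<open>a\<close> changes sides.\<close>

lemma sum_Pow_square_imbalance:
  fixes w :: "'a \<Rightarrow> real"
  assumes "finite A"
  shows "(\<Sum>L\<in>Pow A. (sum w L - sum w (A - L))\<^sup>2) = 2 ^ card A * (\<Sum>e\<in>A. (w e)\<^sup>2)"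
  using assms
proof (induction A rule: finite_induct)
  case (insert a A)
  have "(\<Sum>L\<in>Pow (insert a A). (sum w L - sum w (insert a A - L))\<^sup>2)
      = (\<Sum>L\<in>Pow A. (sum w L - sum w (insert a A - L))\<^sup>2 + (sum w (insert a L) - sum w (insert a A - insert a L))\<^sup>2)"
    by (rule sum_Pow_insert[OF insert.hyps])
  also have "\<dots> = (\<Sum>L\<in>Pow A. 2 * (sum w L - sum w (A - L))\<^sup>2 + 2 * (w a)\<^sup>2)"
  proof (intro sum.cong refl)
    fix L assume L: "L \<in> Pow A"
    then have fin: "finite L" "finite (A - L)" and a: "a \<notin> L" "a \<notin> A - L"
      using insert.hyps finite_subset by auto
    have eq: "insert a A - L = insert a (A - L)" "insert a A - insert a L = A - L"
      using insert.hyps L by auto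
    show "(sum w L - sum w (insert a A - L))\<^sup>2 + (sum w (insert a L) - sum w (insert a A - insert a L))\<^sup>2
        = 2 * (sum w L - sum w (A - L))\<^sup>2 + 2 * (w a)\<^sup>2"
      unfolding eq using fin a by (simp add: power2_eq_square algebra_simps)
  qed
  also have "\<dots> = 2 ^ card (insert a A) * (\<Sum>e\<in>insert a A. (w e)\<^sup>2)"
    using insert by (simp add: sum.distrib sum_distrib_left[symmetric] card_Pow algebra_simps)
  finally show ?case .
qed simp

text \<open>Chebyshev's inequality by counting subsets; the bound \<open>m\<close> on single weights
  turns the sum of squares into \<open>m * sum w A\<close>.\<close>

lemma prob_imbalance:
  fixes w :: "'a \<Rightarrow> real"
  assumes "finite A" "\<And>e. e \<in> A \<Longrightarrow> 0 \<le> w e" "\<And>e. e \<in> A \<Longrightarrow> w e \<le> m" "0 < t"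
  shows "measure_pmf.prob (pmf_of_set (Pow A)) {L. t \<le> \<bar>sum w L - sum w (A - L)\<bar>} \<le> m * sum w A / t\<^sup>2"
proof -
  let ?B = "Pow A \<inter> {L. t \<le> \<bar>sum w L - sum w (A - L)\<bar>}"
  have "card ?B * t\<^sup>2 = (\<Sum>L\<in>?B. t\<^sup>2)" by simp
  also have "\<dots> \<le> (\<Sum>L\<in>?B. (sum w L - sum w (A - L))\<^sup>2)"
    using assms(4) by (intro sum_mono) (simp add: abs_le_square_iff[symmetric])
  also have "\<dots> \<le> (\<Sum>L\<in>Pow A. (sum w L - sum w (A - L))\<^sup>2)"
    using assms(1) by (intro sum_mono2) auto
  also have "\<dots> = 2 ^ card A * (\<Sum>e\<in>A. (w e)\<^sup>2)" by (rule sum_Pow_square_imbalance[OF assms(1)])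
  also have "\<dots> \<le> 2 ^ card A * (\<Sum>e\<in>A. m * w e)"
    using assms(2,3) by (intro mult_left_mono sum_mono) (auto simp: power2_eq_square intro: mult_right_mono)
  finally have "card ?B * t\<^sup>2 \<le> 2 ^ card A * (m * sum w A)" by (simp add: sum_distrib_left)
  moreover have "measure_pmf.prob (pmf_of_set (Pow A)) {L. t \<le> \<bar>sum w L - sum w (A - L)\<bar>} = card ?B / 2 ^ card A"
    using assms(1) by (subst measure_pmf_of_set) (auto simp: card_Pow)
  ultimately show ?thesis using assms(4) by (simp add: pos_divide_le_eq pos_le_divide_eq mult.commute)
qed

section \<open>Random order and binomial sampling\<close>

lemma filter_random_permutation:
  assumes "finite A"
  shows "map_pmf (filter P) (pmf_of_set (permutations_of_set A)) = pmf_of_set (permutations_of_set {x \<in> A. P x})"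
proof -
  have "map_pmf (filter P) (pmf_of_set (permutations_of_set A)) =
      map_pmf fst (map_pmf (partition P) (pmf_of_set (permutations_of_set A)))"
    by (simp add: pmf.map_comp o_def)
  then show ?thesis by (simp add: partition_random_permutations[OF assms] map_fst_pair_pmf)
qed

text \<open>Cutting a random order after a binomial number of items yields a uniformly random subset
  followed by a random order of the rest. The outcome \<open>(L, zs)\<close> arises only for
  \<open>k = card L\<close>, from \<open>fact (card L)\<close> permutations; multiplied by the
  binomial weight this gives \<open>1 / (2 ^ card U * fact (card U - card L))\<close>.\<close>

lemma binomial_split_permutation:
  assumes "finite U"
  shows "bind_pmf (pmf_of_set (permutations_of_set U)) (\<lambda>xs.
      bind_pmf (binomial_pmf (card U) (1 / 2)) (\<lambda>k. return_pmf (set (take k xs), drop k xs))) =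
    bind_pmf (pmf_of_set (Pow U)) (\<lambda>L. map_pmf (Pair L) (pmf_of_set (permutations_of_set (U - L))))"
    (is "?lhs = ?rhs")
proof (rule pmf_eqI)
  fix i :: "'a set \<times> 'a list"
  obtain L zs where i: "i = (L, zs)" by (cases i)
  let ?n = "card U" and ?P = "permutations_of_set U"
  define V where "V \<longleftrightarrow> L \<subseteq> U \<and> zs \<in> permutations_of_set (U - L)"
  define fibre where "fibre = (\<lambda>k. {xs \<in> ?P. (set (take k xs), drop k xs) = (L, zs)})"
  have fibre_empty: "fibre k = {}" if "k \<le> ?n" "\<not> (V \<and> k = card L)" for k
  proof (rule ccontr)
    assume "fibre k \<noteq> {}"
    then obtain xs where xs: "xs \<in> ?P" "set (take k xs) = L" "drop k xs = zs" by (auto simp: fibre_def)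
    then have d: "distinct xs" "set xs = U" "length xs = ?n"
      using length_finite_permutations_of_set by (auto dest: permutations_of_setD)
    have "xs = take k xs @ zs" using xs by (metis append_take_drop_id)
    then have "distinct (take k xs @ zs)" "set (take k xs @ zs) = U" using d by simp_all
    then have "V" using xs(2) by (auto simp: V_def permutations_of_set_def)
    moreover have "k = card L" using d that(1) xs(2)[symmetric] by (simp add: distinct_card)
    ultimately show False using that(2) by simp
  qed
  have fibre_card: "card (fibre (card L)) = fact (card L)" if V
  proof -
    have L: "L \<subseteq> U" "finite L" "set zs = U - L" "distinct zs" using that assms finite_subset
      by (auto simp: V_def permutations_of_set_def)
    have "fibre (card L) = (\<lambda>as. as @ zs) ` permutations_of_set L"
    proof (intro equalityI subsetI)
      fix xs assume "xs \<in> fibre (card L)"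
      then have xs: "distinct xs" "set (take (card L) xs) = L" "drop (card L) xs = zs"
        by (auto simp: fibre_def permutations_of_set_def)
      then have "xs = take (card L) xs @ zs" by (metis append_take_drop_id)
      moreover have "take (card L) xs \<in> permutations_of_set L" using xs by (auto simp: permutations_of_set_def)
      ultimately show "xs \<in> (\<lambda>as. as @ zs) ` permutations_of_set L" by blast
    next
      fix xs assume "xs \<in> (\<lambda>as. as @ zs) ` permutations_of_set L"
      then obtain as where as: "xs = as @ zs" "set as = L" "distinct as" by (auto simp: permutations_of_set_def)
      then have "length as = card L" by (simp add: distinct_card[symmetric])
      then show "xs \<in> fibre (card L)" using as L by (auto simp: fibre_def permutations_of_set_def)
    qed
    then have "card (fibre (card L)) = card (permutations_of_set L)"
      by (simp add: card_image inj_on_def)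
    then show ?thesis using L by simp
  qed
  have lhs: "?lhs = bind_pmf (binomial_pmf ?n (1 / 2)) (\<lambda>k. map_pmf (\<lambda>xs. (set (take k xs), drop k xs)) (pmf_of_set ?P))"
    by (subst bind_commute_pmf) (simp add: map_pmf_def)
  have "pmf ?lhs i = (\<Sum>k\<le>?n. pmf (binomial_pmf ?n (1 / 2)) k * (card (fibre k) / fact ?n))"
  proof -
    have fk: "pmf (map_pmf (\<lambda>xs. (set (take k xs), drop k xs)) (pmf_of_set ?P)) i = card (fibre k) / fact ?n" for k
    proof -
      have "?P \<inter> (\<lambda>xs. (set (take k xs), drop k xs)) -` {i} = fibre k" by (auto simp: fibre_def i)
      then show ?thesis using assms by (simp add: pmf_map measure_pmf_of_set)
    qed
    have "pmf ?lhs i = measure_pmf.expectation (binomial_pmf ?n (1 / 2)) (\<lambda>k. card (fibre k) / fact ?n)"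
      by (simp only: lhs pmf_bind fk)
    also have "\<dots> = (\<Sum>k\<le>?n. pmf (binomial_pmf ?n (1 / 2)) k *\<^sub>R (card (fibre k) / fact ?n))"
      using set_pmf_binomial_eq[of "1/2" ?n] by (intro integral_measure_pmf) auto
    finally show ?thesis by simp
  qed
  also have "\<dots> = (if V then pmf (binomial_pmf ?n (1 / 2)) (card L) * (card (fibre (card L)) / fact ?n) else 0)"
  proof -
    have "V \<Longrightarrow> card L \<le> ?n" using assms by (auto simp: V_def card_mono)
    moreover have "(\<Sum>k\<le>?n. pmf (binomial_pmf ?n (1 / 2)) k * (card (fibre k) / fact ?n)) =
        (\<Sum>k\<le>?n. if k = card L then (if V then pmf (binomial_pmf ?n (1 / 2)) k * (card (fibre k) / fact ?n) else 0) else 0)"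
      using fibre_empty by (intro sum.cong) auto
    ultimately show ?thesis by auto
  qed
  also have "\<dots> = (if V then 1 / (2 ^ ?n * fact (?n - card L)) else 0)"
  proof (cases V)
    case True
    then have le: "card L \<le> ?n" using assms by (auto simp: V_def card_mono)
    have "pmf (binomial_pmf ?n (1 / 2)) (card L) = real (?n choose card L) / 2 ^ ?n"
      using le by (simp add: power_add[symmetric] power_one_over field_simps)
    moreover have "real (?n choose card L) = fact ?n / (fact (card L) * fact (?n - card L))"
      by (rule binomial_fact[OF le])
    ultimately show ?thesis using True fibre_card by simp
  qed simp
  also have "\<dots> = pmf ?rhs i"
  proof -
    have "pmf (map_pmf (Pair L') (pmf_of_set (permutations_of_set (U - L')))) i =
        (if L' = L then (if V then 1 / fact (?n - card L) else 0) else 0)" if "L' \<in> Pow U" for L'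
    proof (cases "L' = L")
      case True
      have "pmf (map_pmf (Pair L) (pmf_of_set (permutations_of_set (U - L)))) (L, zs) = pmf (pmf_of_set (permutations_of_set (U - L))) zs"
        by (rule pmf_map_inj') (auto simp: inj_on_def)
      moreover have "card (U - L) = ?n - card L"
        using True that assms finite_subset[of L U] by (auto intro: card_Diff_subset)
      ultimately show ?thesis using True that assms
        by (auto simp: i V_def pmf_of_set)
    next
      case False
      then have "i \<notin> set_pmf (map_pmf (Pair L') (pmf_of_set (permutations_of_set (U - L'))))"
        by (auto simp: i)
      then show ?thesis using False by (simp add: pmf_eq_0_set_pmf)
    qed
    then have "pmf ?rhs i = (\<Sum>L'\<in>Pow U. if L' = L then (if V then 1 / fact (?n - card L) else 0) else 0) / 2 ^ ?n"
      using assms by (subst pmf_bind_pmf_of_set) (auto simp: card_Pow)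
    moreover have "V \<Longrightarrow> L \<in> Pow U" by (simp add: V_def)
    ultimately show ?thesis using assms by auto
  qed
  finally show "pmf ?lhs i = pmf ?rhs i" .
qed

section \<open>Online runs with and without the profit filter\<close>

lemma online_run_bounds:
  "x \<in> set_pmf (online_run D hist cur es) \<Longrightarrow> cur \<subseteq> x \<and> x \<subseteq> cur \<union> set es"
proof (induction es arbitrary: hist cur)
  case (Cons e es)
  then obtain b where "x \<in> set_pmf (online_run D (hist @ [e]) (if b then insert e cur else cur) es)" by auto
  from Cons.IH[OF this] show ?case by (cases b) auto
qed simp

lemma online_run_cong:
  assumes "\<And>hist cur. set hist \<subseteq> Z \<Longrightarrow> D hist cur = D' hist cur" "set hist \<subseteq> Z" "set es \<subseteq> Z"
  shows "online_run D hist cur es = online_run D' hist cur es"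
  using assms(2,3)
proof (induction es arbitrary: hist cur)
  case (Cons e es)
  have "online_run D (hist @ [e]) c es = online_run D' (hist @ [e]) c es" for c
    using Cons.prems by (intro Cons.IH) auto
  moreover have "D (hist @ [e]) cur = D' (hist @ [e]) cur" using Cons.prems by (intro assms(1)) auto
  ultimately show ?case by simp
qed simp

text \<open>The simulated set evolves as in the unfiltered run whatever the filter rejects, so each
  solution is contained in an outcome of that run.\<close>

lemma filtered_run_subset:
  assumes "x \<in> set_pmf (filtered_run p D hist cur sol es)" "sol \<subseteq> cur"
  shows "\<exists>y\<in>set_pmf (online_run D hist cur es). x \<subseteq> y"
  using assms
proof (induction es arbitrary: hist cur sol)
  case (Cons e es)
  then obtain b where b: "b \<in> set_pmf (D (hist @ [e]) cur)"
    "x \<in> set_pmf (filtered_run p D (hist @ [e]) (if b then insert e cur else cur)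
      (if b \<and> p (insert e sol) \<ge> p sol then insert e sol else sol) es)" by auto
  have "\<exists>y\<in>set_pmf (online_run D (hist @ [e]) (if b then insert e cur else cur) es). x \<subseteq> y"
    using Cons.prems(2) by (intro Cons.IH[OF b(2)]) auto
  then obtain y where y: "y \<in> set_pmf (online_run D (hist @ [e]) (if b then insert e cur else cur) es)" "x \<subseteq> y"
    by blast
  have "y \<in> set_pmf (online_run D hist cur (e # es))"
    unfolding online_run.simps set_bind_pmf using b(1) y(1) by (rule UN_I)
  then show ?case using y(2) by blast
qed simp

lemma filtered_run_profit:
  assumes "x \<in> set_pmf (filtered_run p D hist cur sol es)"
  shows "p sol \<le> p x"
  using assms
proof (induction es arbitrary: hist cur sol)
  case (Cons e es)
  then obtain b where
    "x \<in> set_pmf (filtered_run p D (hist @ [e]) (if b then insert e cur else cur)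
      (if b \<and> p (insert e sol) \<ge> p sol then insert e sol else sol) es)" by auto
  from Cons.IH[OF this] show ?case by (auto split: if_splits)
qed simp

text \<open>The filter never rejects: items are only added and the outcome is feasible, hence every
  intermediate set is feasible, and between feasible subsets of \<open>Z\<close> the function
  \<open>p\<close> is monotone.\<close>

lemma filtered_run_eq_online_run:
  assumes "\<And>A B. A \<in> F \<Longrightarrow> B \<subseteq> A \<Longrightarrow> B \<in> F"
    and "\<And>A B. B \<in> F \<Longrightarrow> B \<subseteq> Z \<Longrightarrow> A \<subseteq> B \<Longrightarrow> p A \<le> p B"
    and "cur \<subseteq> Z" "set es \<subseteq> Z" "set_pmf (online_run D hist cur es) \<subseteq> F"
  shows "filtered_run p D hist cur cur es = online_run D hist cur es"
  using assms(3-5)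
proof (induction es arbitrary: hist cur)
  case (Cons e es)
  have "filtered_run p D (hist @ [e]) (if b then insert e cur else cur)
        (if b \<and> p (insert e cur) \<ge> p cur then insert e cur else cur) es =
      online_run D (hist @ [e]) (if b then insert e cur else cur) es"
    if b: "b \<in> set_pmf (D (hist @ [e]) cur)" for b
  proof -
    let ?c = "if b then insert e cur else cur"
    have F: "set_pmf (online_run D (hist @ [e]) ?c es) \<subseteq> F"
      using Cons.prems(3) b unfolding online_run.simps set_bind_pmf by (rule order_trans[OF UN_upper, rotated])
    obtain x where x: "x \<in> set_pmf (online_run D (hist @ [e]) ?c es)"
      using set_pmf_not_empty[of "online_run D (hist @ [e]) ?c es"] by blast
    then have "?c \<in> F" using F online_run_bounds[OF x] assms(1)[of x ?c] by blast
    then have "b \<Longrightarrow> p cur \<le> p (insert e cur)"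
      using assms(2)[of "insert e cur" cur] Cons.prems(1,2) by auto
    then have "(if b \<and> p (insert e cur) \<ge> p cur then insert e cur else cur) = ?c" by auto
    moreover have "filtered_run p D (hist @ [e]) ?c ?c es = online_run D (hist @ [e]) ?c es"
      using Cons.prems(1,2) F by (intro Cons.IH) auto
    ultimately show ?thesis by simp
  qed
  then show ?case by (auto intro: bind_pmf_cong)
qed simp

text \<open>The candidates depend only on the sample and on the set of remaining items. Given these,
  filtering the random order leaves a uniformly random order of the candidates.\<close>

lemma OA_eq:
  assumes "finite U" "C \<noteq> {}"
  shows "OA d U F g v s C \<A> =
    bind_pmf (pmf_of_set (Pow U)) (\<lambda>L.
      let Z = candidates d U F g v s C L (U - L)
      in bind_pmf (pmf_of_set (permutations_of_set Z)) (\<lambda>ys.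
        filtered_run (set_profit U g v s) (\<A> (set_profit U g v s) (card Z)) [] {} {} ys))"
proof -
  define Z where "Z = (\<lambda>L R. candidates d U F g v s C L R)"
  define p where "p = set_profit U g v s"
  define h where "h = (\<lambda>(L, zs). let ys = filter (\<lambda>e. e \<in> Z L (set zs)) zs
    in filtered_run p (\<A> p (length ys)) [] {} {} ys)"
  \<comment> \<open>For an empty curve the intersection in \<open>candidates\<close> would be the
    whole type; this is where \<open>C \<noteq> {}\<close> enters.\<close>
  have Z_sub: "Z L R \<subseteq> R" for L R
    using assms(2) by (auto simp: Z_def candidates_def items_strictly_above_def Let_def)
  have "OA d U F g v s C \<A> = bind_pmf (bind_pmf (pmf_of_set (permutations_of_set U)) (\<lambda>xs.
      bind_pmf (binomial_pmf (card U) (1 / 2)) (\<lambda>k. return_pmf (set (take k xs), drop k xs)))) h"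
    unfolding OA_def h_def Z_def p_def
    by (simp add: bind_assoc_pmf bind_return_pmf Let_def)
  also have "\<dots> = bind_pmf (pmf_of_set (Pow U)) (\<lambda>L. bind_pmf (pmf_of_set (permutations_of_set (U - L))) (\<lambda>zs. h (L, zs)))"
    unfolding binomial_split_permutation[OF assms(1)] by (simp add: bind_assoc_pmf bind_map_pmf)
  also have "\<dots> = bind_pmf (pmf_of_set (Pow U)) (\<lambda>L.
      bind_pmf (pmf_of_set (permutations_of_set (Z L (U - L)))) (\<lambda>ys.
        filtered_run p (\<A> p (card (Z L (U - L)))) [] {} {} ys))"
  proof (rule bind_pmf_cong[OF refl])
    fix L
    let ?Z = "Z L (U - L)" and ?R = "pmf_of_set (permutations_of_set (U - L))"
    have finite: "finite (U - L)" "finite ?Z" using assms(1) finite_subset[OF Z_sub] by auto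
    have "bind_pmf ?R (\<lambda>zs. h (L, zs)) =
        bind_pmf ?R (\<lambda>zs. filtered_run p (\<A> p (length (filter (\<lambda>e. e \<in> ?Z) zs))) [] {} {} (filter (\<lambda>e. e \<in> ?Z) zs))"
    proof (rule bind_pmf_cong[OF refl])
      fix zs assume "zs \<in> set_pmf ?R"
      then have "set zs = U - L" using finite(1) by (auto dest: permutations_of_setD)
      then show "h (L, zs) = filtered_run p (\<A> p (length (filter (\<lambda>e. e \<in> ?Z) zs))) [] {} {} (filter (\<lambda>e. e \<in> ?Z) zs)"
        by (simp add: h_def Let_def)
    qed
    also have "\<dots> = bind_pmf (map_pmf (filter (\<lambda>e. e \<in> ?Z)) ?R) (\<lambda>ys. filtered_run p (\<A> p (length ys)) [] {} {} ys)"
      by (simp add: bind_map_pmf)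
    also have "map_pmf (filter (\<lambda>e. e \<in> ?Z)) ?R = pmf_of_set (permutations_of_set ?Z)"
    proof -
      have "{x \<in> U - L. x \<in> ?Z} = ?Z" using Z_sub[of L "U - L"] by blast
      then show ?thesis using filter_random_permutation[OF finite(1)] by simp
    qed
    also have "bind_pmf (pmf_of_set (permutations_of_set ?Z)) (\<lambda>ys. filtered_run p (\<A> p (length ys)) [] {} {} ys) =
        bind_pmf (pmf_of_set (permutations_of_set ?Z)) (\<lambda>ys. filtered_run p (\<A> p (card ?Z)) [] {} {} ys)"
      using finite(2) by (intro bind_pmf_cong) (auto simp: length_finite_permutations_of_set)
    finally show "bind_pmf ?R (\<lambda>zs. h (L, zs)) =
        bind_pmf (pmf_of_set (permutations_of_set ?Z)) (\<lambda>ys. filtered_run p (\<A> p (card ?Z)) [] {} {} ys)" .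
  qed
  finally show ?thesis by (simp add: Z_def p_def Let_def)
qed

section \<open>The chosen price\<close>

locale OA_instance = profit_instance +
  fixes C :: "rvec set" and \<eta> :: real
  assumes d_pos: "1 \<le> d"
    and curve: "price_curve d g C"
    and general_position: "general_position d U v s"
    and \<eta>: "10 ^ 4 \<le> \<eta>"
    and small: "e \<in> U \<Longrightarrow> set_profit U g v s {e} \<le> opt U F g v s / (\<eta> * real d)"
begin

lemma lam_orthant: "0 \<le> \<tau> \<Longrightarrow> lam \<tau> \<in> orthant d"
  using lam_nonneg[of \<tau>] by (simp add: orthant_def) (simp add: lam_def)

text \<open>One parameter for both pieces of the curve: the initial piece occupies
  \<open>{0..1}\<close>, and \<open>lam\<close> follows with its argument shifted by one.\<close>

definition parametrization :: "(real \<Rightarrow> rvec) \<Rightarrow> bool" where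
  "parametrization c \<longleftrightarrow> C = c ` {0..} \<and> (\<forall>i. continuous_on {0..} (\<lambda>r. c r i)) \<and>
     mono_on {0..} c \<and> c 0 = (\<lambda>_. 0) \<and> (\<forall>r\<ge>0. c (r + 1) = lam r) \<and> c ` {0..} \<subseteq> orthant d"

text \<open>The pieces join because one-sided derivatives at \<open>0\<close> are unique, so the
  initial piece ends at \<open>lam 0\<close>. By \<open>price_unique\<close> the vectors with a
  common positive conjugate value are exactly the points \<open>lam \<tau>\<close> with
  \<open>\<tau> > 0\<close>.\<close>

lemma parametrization_exists: "\<exists>c. parametrization c"
proof -
  obtain \<gamma> :: "real \<Rightarrow> rvec" where \<gamma>: "continuous_on {0..1} \<gamma>" "mono_on {0..1} \<gamma>" "\<gamma> ` {0..1} \<subseteq> orthant d"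
    "\<gamma> 0 = (\<lambda>_. 0)" "\<And>i. i < d \<Longrightarrow> (\<phi> i has_real_derivative \<gamma> 1 i) (at 0 within {0..})"
    and C: "C = {\<mu> \<in> orthant d. \<exists>\<tau>>0. \<forall>i<d. conjugate g i (\<mu> i) = \<tau>} \<union> \<gamma> ` {0..1}"
    using curve unfolding price_curve_def by blast
  have \<gamma>1: "\<gamma> 1 = lam 0"
  proof
    fix i
    show "\<gamma> 1 i = lam 0 i"
    proof (cases "i < d")
      case True
      then have "\<gamma> 1 i = slope (\<phi> i) 0"
        using has_real_derivative_unique_atLeast[OF \<gamma>(5)[OF True] convex_cost.has_slope[OF coord_convex[OF True]]] by simp
      then show ?thesis using convex_cost.price_zero[OF coord_convex[OF True]] True by (simp add: lam_def)
    next
      case False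
      have "\<gamma> 1 \<in> orthant d" using \<gamma>(3) by auto
      then show ?thesis using False by (simp add: lam_def orthant_def)
    qed
  qed
  have dual: "{\<mu> \<in> orthant d. \<exists>\<tau>>0. \<forall>i<d. conjugate g i (\<mu> i) = \<tau>} = lam ` {0<..}"
  proof (intro equalityI subsetI)
    fix \<mu> assume "\<mu> \<in> {\<mu> \<in> orthant d. \<exists>\<tau>>0. \<forall>i<d. conjugate g i (\<mu> i) = \<tau>}"
    then obtain \<tau> where \<mu>: "\<mu> \<in> orthant d" "\<tau> > 0" "\<And>i. i < d \<Longrightarrow> conjugate g i (\<mu> i) = \<tau>" by auto
    have "\<mu> = lam \<tau>"
    proof
      fix i show "\<mu> i = lam \<tau> i"
        using convex_cost.price_unique[OF coord_convex \<mu>(2), of i "\<mu> i"] \<mu>(1) \<mu>(3)[of i]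
        by (cases "i < d") (auto simp: lam_def orthant_def conjugate_def)
    qed
    then show "\<mu> \<in> lam ` {0<..}" using \<mu>(2) by auto
  next
    fix \<mu> assume "\<mu> \<in> lam ` {0<..}"
    then obtain \<tau> where \<tau>: "\<mu> = lam \<tau>" "\<tau> > 0" by auto
    then have "conjugate g i (\<mu> i) = \<tau>" if "i < d" for i
      using convex_cost.conjugate_price[OF coord_convex[OF that], of \<tau>] that by (simp add: lam_def conjugate_def)
    then show "\<mu> \<in> {\<mu> \<in> orthant d. \<exists>\<tau>>0. \<forall>i<d. conjugate g i (\<mu> i) = \<tau>}"
      using lam_orthant[of \<tau>] \<tau> by auto
  qed
  define c where "c = (\<lambda>r. if r \<le> 1 then \<gamma> r else lam (r - 1))"
  have c_lam: "c (r + 1) = lam r" if "0 \<le> r" for r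
    using that \<gamma>1 by (cases "r = 0") (auto simp: c_def)
  have "parametrization c"
    unfolding parametrization_def
  proof (intro conjI allI impI)
    show "C = c ` {0..}"
    proof (intro equalityI subsetI)
      fix \<mu> assume "\<mu> \<in> C"
      then consider \<tau> where "\<tau> > 0" "\<mu> = lam \<tau>" | r where "r \<in> {0..1}" "\<mu> = \<gamma> r"
        unfolding C dual by auto
      then show "\<mu> \<in> c ` {0..}"
      proof cases
        case 1
        then show ?thesis using c_lam[of \<tau>] by (intro image_eqI[of _ _ "\<tau> + 1"]) auto
      next
        case 2
        then show ?thesis by (intro image_eqI[of _ _ r]) (auto simp: c_def)
      qed
    next
      fix \<mu> assume "\<mu> \<in> c ` {0..}"
      then obtain r where "0 \<le> r" "\<mu> = c r" by auto
      then show "\<mu> \<in> C" unfolding C dual by (cases "r \<le> 1") (auto simp: c_def)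
    qed
  next
    fix i
    have "continuous_on ({0..1} \<union> {1..}) (\<lambda>r. if r \<le> 1 then \<gamma> r i else lam (r - 1) i)"
    proof (rule continuous_on_If)
      show "continuous_on {0..1} (\<lambda>r. \<gamma> r i)" by (rule continuous_on_product_then_coordinatewise[OF \<gamma>(1)])
      show "continuous_on {1..} (\<lambda>r. lam (r - 1) i)"
      proof (cases "i < d")
        case True
        have "continuous_on {1..} (\<lambda>r. price (\<phi> i) (r - 1))"
          by (rule continuous_on_compose2[OF convex_cost.price_continuous[OF coord_convex[OF True]]])
            (auto intro: continuous_intros)
        then show ?thesis using True by (simp add: lam_def)
      qed (simp add: lam_def)
    qed (use \<gamma>1 in auto)
    moreover have "{0..1} \<union> {1..} = {0::real..}" by auto
    moreover have "c r i = (if r \<le> 1 then \<gamma> r i else lam (r - 1) i)" for r by (simp add: c_def)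
    ultimately show "continuous_on {0..} (\<lambda>r. c r i)" by simp
  next
    show "mono_on {0..} c"
    proof (rule mono_onI)
      fix r r' :: real assume "r \<in> {0..}" "r' \<in> {0..}" and r': "r \<le> r'"
      then have r: "0 \<le> r" "r \<le> r'" by auto
      consider "r' \<le> 1" | "r \<le> 1" "1 < r'" | "1 < r" by linarith
      then show "c r \<le> c r'"
      proof cases
        case 1
        then show ?thesis using mono_onD[OF \<gamma>(2), of r r'] r by (simp add: c_def)
      next
        case 2
        have "\<gamma> r \<le> lam 0" using mono_onD[OF \<gamma>(2), of r 1] r 2 \<gamma>1 by simp
        also have "\<dots> \<le> lam (r' - 1)" using 2 by (auto simp: le_fun_def intro: lam_mono)
        finally show ?thesis using 2 by (simp add: c_def)
      next
        case 3
        then show ?thesis using r by (auto simp: c_def le_fun_def intro: lam_mono)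
      qed
    qed
  next
    show "c 0 = (\<lambda>_. 0)" using \<gamma>(4) by (simp add: c_def)
  next
    have "c r \<in> orthant d" if "0 \<le> r" for r
      using \<gamma>(3) lam_orthant[of "r - 1"] that by (cases "r \<le> 1") (auto simp: c_def)
    then show "c ` {0..} \<subseteq> orthant d" by auto
  qed (rule c_lam)
  then show ?thesis by (rule exI[of _ c])
qed

definition par :: "real \<Rightarrow> rvec" where
  "par = (SOME c. parametrization c)"

lemma
  shows curve_iff: "\<mu> \<in> C \<longleftrightarrow> (\<exists>r\<ge>0. \<mu> = par r)"
    and par_continuous: "continuous_on {0..} (\<lambda>r. par r i)"
    and par_mono: "0 \<le> r \<Longrightarrow> r \<le> r' \<Longrightarrow> par r \<le> par r'"
    and par_zero: "par 0 = (\<lambda>_. 0)"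
    and par_lam: "0 \<le> r \<Longrightarrow> par (r + 1) = lam r"
    and par_orthant: "0 \<le> r \<Longrightarrow> par r \<in> orthant d"
proof -
  have c: "parametrization par"
    unfolding par_def using parametrization_exists by (rule someI_ex)
  then have "C = par ` {0..}" by (simp add: parametrization_def)
  then have "\<mu> \<in> C \<longleftrightarrow> \<mu> \<in> par ` {0..}" by (rule arg_cong)
  then show "\<mu> \<in> C \<longleftrightarrow> (\<exists>r\<ge>0. \<mu> = par r)" by auto
  show "continuous_on {0..} (\<lambda>r. par r i)" "0 \<le> r \<Longrightarrow> r \<le> r' \<Longrightarrow> par r \<le> par r'"
    "par 0 = (\<lambda>_. 0)" "0 \<le> r \<Longrightarrow> par (r + 1) = lam r" "0 \<le> r \<Longrightarrow> par r \<in> orthant d"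
    using c unfolding parametrization_def by (auto simp: mono_on_def)
qed

lemma lam_in_curve: "0 \<le> \<tau> \<Longrightarrow> lam \<tau> \<in> C"
  unfolding curve_iff by (rule exI[of _ "\<tau> + 1"]) (simp add: par_lam)

lemma zero_in_curve: "(\<lambda>_. 0) \<in> C"
  unfolding curve_iff by (rule exI[of _ 0]) (simp add: par_zero)

lemma curve_orthant: "\<mu> \<in> C \<Longrightarrow> \<mu> \<in> orthant d"
  unfolding curve_iff by (auto simp: par_orthant)

lemma curve_chain:
  assumes "\<mu> \<in> C" "\<nu> \<in> C" shows "\<mu> \<le> \<nu> \<or> \<nu> \<le> \<mu>"
proof -
  obtain r r' where "0 \<le> r" "0 \<le> r'" "\<mu> = par r" "\<nu> = par r'"
    using assms unfolding curve_iff by auto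
  then show ?thesis using par_mono[of r r'] par_mono[of r' r] by (cases "r \<le> r'") auto
qed

text \<open>The initial piece may be locally constant in a coordinate. The point
  \<open>lam (r + 1)\<close> avoids this: it exceeds \<open>lam r = par (r + 1)\<close>, hence
  \<open>par r\<close>, in every coordinate below \<open>d\<close>.\<close>

lemma curve_larger:
  assumes "\<mu> \<in> C" obtains \<nu> where "\<nu> \<in> C" "\<And>i. \<mu> i \<le> \<nu> i" "\<And>i. i < d \<Longrightarrow> \<mu> i < \<nu> i"
proof -
  obtain r where r: "0 \<le> r" "\<mu> = par r" using assms unfolding curve_iff by auto
  have le: "\<mu> i \<le> lam r i" for i
    using par_mono[of r "r + 1"] par_lam[of r] r by (auto simp: le_fun_def)
  have "lam r i < lam (r + 1) i" if "i < d" for i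
    using convex_cost.price_strict_mono[OF coord_convex[OF that] r(1), of "r + 1"] that by (simp add: lam_def)
  with le have "\<And>i. i < d \<Longrightarrow> \<mu> i < lam (r + 1) i" by (meson order_le_less_trans)
  moreover have "\<mu> i \<le> lam (r + 1) i" for i using le[of i] lam_mono[OF r(1), of "r + 1" i] by simp
  ultimately show ?thesis using that[of "lam (r + 1)"] lam_in_curve[of "r + 1"] r(1) by auto
qed

section \<open>Level sets along the curve and the price chosen from the sample\<close>

lemma items_above_antimono:
  assumes "\<mu> \<le> \<nu>" "X \<subseteq> U" shows "items_above d v s \<nu> X \<subseteq> items_above d v s \<mu> X"
  using dotp_mono[of _ \<mu> \<nu>] assms by (fastforce simp: items_above_def le_fun_def)

lemma items_above_zero: "X \<subseteq> U \<Longrightarrow> items_above d v s (\<lambda>_. 0) X = X"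
  using v_nonneg by (auto simp: items_above_def dotp_def)

text \<open>The inadmissible price \<open>\<mu>\<^sub>0\<close> bounds the admissible parameters,
  and these form a closed set. A largest parameter therefore exists, and monotonicity of
  \<open>par\<close> makes its price the largest.\<close>

lemma greatest_price:
  assumes "L \<subseteq> U" "\<theta> \<le> fo L" "\<mu>\<^sub>0 \<in> C" "\<not> \<theta> \<le> fo (items_above d v s \<mu>\<^sub>0 L)"
  shows "\<exists>\<mu>\<in>C. \<theta> \<le> fo (items_above d v s \<mu> L) \<and> (\<forall>\<nu>\<in>C. \<theta> \<le> fo (items_above d v s \<nu> L) \<longrightarrow> \<nu> \<le> \<mu>)"
proof -
  let ?S = "{r \<in> {0..}. \<theta> \<le> fo (items_above d v s (par r) L)}"
  obtain r0 where r0: "0 \<le> r0" "\<mu>\<^sub>0 = par r0" using assms(3) curve_iff by auto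
  have sub: "items_above d v s \<mu> L \<subseteq> U" for \<mu> using assms(1) by (auto simp: items_above_def)
  have bound: "r \<le> r0" if "r \<in> ?S" for r
  proof (rule ccontr)
    assume "\<not> r \<le> r0"
    then have "fo (items_above d v s (par r) L) \<le> fo (items_above d v s \<mu>\<^sub>0 L)"
      using par_mono[of r0 r] r0 assms(1) sub by (intro fopt_mono items_above_antimono) auto
    then show False using that assms(4) by simp
  qed
  \<comment> \<open>By monotonicity of \<open>fo\<close>, admissibility means that some set of value at least \<open>\<theta>\<close> stays above the price.\<close>
  have "?S = (\<Union>A\<in>{A. A \<subseteq> L \<and> \<theta> \<le> fo A}. {0..} \<inter> (\<Inter>e\<in>A. {r \<in> {0..}. dotp d (par r) (s e) \<le> v e}))"
  proof (intro equalityI subsetI)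
    fix r assume "r \<in> ?S"
    then show "r \<in> (\<Union>A\<in>{A. A \<subseteq> L \<and> \<theta> \<le> fo A}. {0..} \<inter> (\<Inter>e\<in>A. {r \<in> {0..}. dotp d (par r) (s e) \<le> v e}))"
      by (intro UN_I[of "items_above d v s (par r) L"]) (auto simp: items_above_def)
  next
    fix r assume "r \<in> (\<Union>A\<in>{A. A \<subseteq> L \<and> \<theta> \<le> fo A}. {0..} \<inter> (\<Inter>e\<in>A. {r \<in> {0..}. dotp d (par r) (s e) \<le> v e}))"
    then obtain A where A: "A \<subseteq> L" "\<theta> \<le> fo A" "0 \<le> r" "A \<subseteq> items_above d v s (par r) L"
      by (auto simp: items_above_def)
    then show "r \<in> ?S" using fopt_mono[OF A(4) sub] by auto
  qed
  moreover have "closed {r \<in> {0..}. dotp d (par r) (s e) \<le> v e}" for e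
  proof -
    have "continuous_on {0..} (\<lambda>r. dotp d (par r) (s e))"
      unfolding dotp_def by (intro continuous_intros par_continuous)
    then show ?thesis
      using continuous_on_closed_Collect_le[of "{0..}" "\<lambda>r. dotp d (par r) (s e)" "\<lambda>_. v e"] by auto
  qed
  moreover have "finite {A. A \<subseteq> L \<and> \<theta> \<le> fo A}"
    by (rule finite_subset[of _ "Pow U"]) (use assms(1) finite_U in auto)
  ultimately have "closed ?S"
    by (simp only:) (intro closed_UN closed_Int closed_INT ballI closed_atLeast)
  moreover have "bounded ?S"
  proof (rule bounded_subset)
    show "bounded {0..r0}" by (rule bounded_closed_interval)
    show "?S \<subseteq> {0..r0}" using bound by auto
  qed
  ultimately have "compact ?S" by (simp add: compact_eq_bounded_closed)
  moreover have "0 \<in> ?S" using par_zero items_above_zero[OF assms(1)] assms(2) by simp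
  ultimately obtain r where r: "r \<in> ?S" "\<And>t. t \<in> ?S \<Longrightarrow> t \<le> r"
    using compact_attains_sup[of ?S] by blast
  show ?thesis
  proof (intro bexI[of _ "par r"] conjI ballI impI)
    show "\<theta> \<le> fo (items_above d v s (par r) L)" "par r \<in> C" using r(1) curve_iff by auto
    fix \<nu> assume \<nu>: "\<nu> \<in> C" "\<theta> \<le> fo (items_above d v s \<nu> L)"
    then obtain t where "0 \<le> t" "\<nu> = par t" using curve_iff by auto
    then show "\<nu> \<le> par r" using r(2)[of t] \<nu>(2) par_mono[of t r] by auto
  qed
qed

text \<open>The level sets form a finite chain, so a smallest one of value at least
  \<open>\<kappa>\<close> exists. It is fixed before the sample is drawn, so concentration applies
  to it although the chosen price is random.\<close>

lemma minimal_level_set: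
  assumes "\<kappa> \<le> fo U"
  obtains M where "M \<subseteq> U" "\<kappa> \<le> fo M"
    "\<And>\<mu>. \<mu> \<in> C \<Longrightarrow> \<kappa> \<le> fo (items_above d v s \<mu> U) \<Longrightarrow> M \<subseteq> items_above d v s \<mu> U"
proof -
  let ?V = "{items_above d v s \<mu> U | \<mu>. \<mu> \<in> C \<and> \<kappa> \<le> fo (items_above d v s \<mu> U)}"
  have "finite ?V"
    by (rule finite_subset[of _ "Pow U"]) (use finite_U in \<open>auto simp: items_above_def\<close>)
  moreover have "U \<in> ?V"
    by (intro CollectI exI[of _ "\<lambda>_. 0"] conjI) (simp_all add: zero_in_curve items_above_zero assms)
  ultimately have "\<exists>M\<in>?V. \<forall>V\<in>?V. V \<subseteq> M \<longrightarrow> M = V"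
    by (intro finite_has_minimal) auto
  then obtain M where M: "M \<in> ?V" "\<forall>V\<in>?V. V \<subseteq> M \<longrightarrow> M = V"
    by (rule bexE)
  obtain \<mu> where \<mu>: "\<mu> \<in> C" "\<kappa> \<le> fo M" "M = items_above d v s \<mu> U" using M(1) by auto
  have "M \<subseteq> items_above d v s \<nu> U" if \<nu>: "\<nu> \<in> C" "\<kappa> \<le> fo (items_above d v s \<nu> U)" for \<nu>
  proof (cases "\<nu> \<le> \<mu>")
    case True
    then show ?thesis using items_above_antimono[of \<nu> \<mu> U] \<mu>(3) by simp
  next
    case False
    then have "items_above d v s \<nu> U \<subseteq> M"
      using curve_chain[OF \<mu>(1) \<nu>(1)] items_above_antimono[of \<mu> \<nu> U] \<mu>(3) by simp
    moreover have "items_above d v s \<nu> U \<in> ?V" using \<nu> by blast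
    ultimately have "M = items_above d v s \<nu> U" using M(2) by (meson bspec)
    then show ?thesis by simp
  qed
  then show ?thesis using that[of M] \<mu> by (auto simp: items_above_def)
qed

text \<open>A largest admissible price dominates the threshold price, which is admissible itself.
  The set \<open>M\<close> lies weakly above the chosen price, and by general position the passage
  to the strict inequality loses at most one item. If there is no largest admissible price, the same
  is argued with all prices of the curve.\<close>

lemma candidates_bounds:
  assumes "L \<subseteq> U" "M \<subseteq> U"
    and thr: "1 / (12 * real d) * fo L \<le> fo (upper (threshold U) L)"
    and M: "\<And>\<mu>. \<mu> \<in> C \<Longrightarrow> 1 / (12 * real d) * fo L \<le> fo (items_above d v s \<mu> L) \<Longrightarrow> M \<subseteq> items_above d v s \<mu> U"
  defines "Z \<equiv> candidates d U F g v s C L (U - L)"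
  shows "Z \<subseteq> strict_upper (threshold U) U" "\<exists>e. M - L - {e} \<subseteq> Z"
proof -
  define P where "P = admissible_price d U F g v s C L"
  have P: "P \<mu> \<longleftrightarrow> \<mu> \<in> C \<and> 1 / (12 * real d) * fo L \<le> fo (items_above d v s \<mu> L)" for \<mu>
    by (simp add: P_def admissible_price_def)
  have thrC: "lam (threshold U) \<in> C" by (intro lam_in_curve threshold_nonneg order_refl)
  then have Pthr: "P (lam (threshold U))" using thr by (simp add: P)
  have "Z \<subseteq> strict_upper (threshold U) U \<and> (\<exists>e. M - L - {e} \<subseteq> Z)"
  proof (cases "\<exists>\<mu>. P \<mu> \<and> (\<forall>\<nu>. P \<nu> \<longrightarrow> \<nu> \<le> \<mu>)")
    case True
    then obtain \<mu> where \<mu>: "P \<mu>" "\<And>\<nu>. P \<nu> \<Longrightarrow> \<nu> \<le> \<mu>" by blast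
    then have "(GREATEST \<mu>. P \<mu>) = \<mu>" by (intro Greatest_equality) auto
    then have Z: "Z = items_strictly_above d v s \<mu> (U - L)"
      using True by (simp add: Z_def candidates_def P_def Let_def)
    have "Z \<subseteq> strict_upper (threshold U) U"
      using \<mu>(2)[OF Pthr] dotp_mono[of _ "lam (threshold U)" \<mu>]
      by (fastforce simp: Z items_strictly_above_def le_fun_def)
    moreover have "\<exists>e. M - L - {e} \<subseteq> Z"
    proof (cases "M - L \<subseteq> Z")
      case False
      then obtain e where e: "e \<in> M - L" "e \<notin> Z" by blast
      have M\<mu>: "M \<subseteq> items_above d v s \<mu> U" using \<mu>(1) M by (simp add: P)
      have tight: "v e' = dotp d \<mu> (s e')" if "e' \<in> M - L" "e' \<notin> Z" for e'
        using M\<mu> that assms(2) by (fastforce simp: Z items_strictly_above_def items_above_def)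
      have "e' = e" if "e' \<in> M - L" "e' \<notin> Z" for e'
        using general_position tight[OF that] tight[OF e] e that assms(2) curve_orthant[of \<mu>] \<mu>(1)
        unfolding general_position_def P by blast
      then show ?thesis by (intro exI[of _ e]) blast
    qed blast
    ultimately show ?thesis by blast
  next
    case False
    then have Z: "Z = (\<Inter>\<mu>\<in>C. items_strictly_above d v s \<mu> (U - L))"
      by (simp only: Z_def candidates_def P_def Let_def if_False)
    have "1 / (12 * real d) * fo L \<le> 1 * fo L"
      using fopt_nonneg[OF assms(1)] d_pos by (intro mult_right_mono) (auto simp: field_simps)
    \<comment> \<open>An inadmissible price would make \<open>greatest_price\<close> produce a
      largest admissible one.\<close>
    then have all: "P \<mu>" if "\<mu> \<in> C" for \<mu>
      using greatest_price[OF assms(1), of "1 / (12 * real d) * fo L" \<mu>] that False unfolding P by fastforce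
    have "Z \<subseteq> strict_upper (threshold U) U"
      unfolding Z using thrC by (auto simp: items_strictly_above_def)
    moreover have "\<exists>e. M - L - {e} \<subseteq> Z"
    proof (cases "M - L \<subseteq> Z")
      case False
      then obtain e where e: "e \<in> M - L" "e \<notin> Z" by blast
      have above: "dotp d \<mu> (s e') \<le> v e'" if "e' \<in> M" "\<mu> \<in> C" for e' \<mu>
        using M[OF that(2)] all[OF that(2)] that(1) by (auto simp: P items_above_def)
      \<comment> \<open>An item of \<open>M\<close> that is not strictly above every price is tight at some price, but not
        below a strictly larger one; so its size, and hence its value, is zero.\<close>
      have zero: "v e' = dotp d (\<lambda>_. 0) (s e')" if e': "e' \<in> M - L" "e' \<notin> Z" for e'
      proof -
        have e'U: "e' \<in> U" using e' assms(2) by auto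
        obtain \<mu> where \<mu>: "\<mu> \<in> C" "v e' \<le> dotp d \<mu> (s e')"
          using e' e'U by (auto simp: Z items_strictly_above_def not_less)
        obtain \<nu> where \<nu>: "\<nu> \<in> C" "\<And>i. \<mu> i \<le> \<nu> i" "\<And>i. i < d \<Longrightarrow> \<mu> i < \<nu> i"
          using curve_larger[OF \<mu>(1)] by blast
        have "dotp d \<nu> (s e') \<le> dotp d \<mu> (s e')" using above[of e' \<nu>] e' \<nu>(1) \<mu>(2) by auto
        then have "(\<Sum>i<d. (\<nu> i - \<mu> i) * s e' i) \<le> 0"
          by (simp add: dotp_def left_diff_distrib sum_subtractf)
        moreover have nn: "0 \<le> (\<nu> i - \<mu> i) * s e' i" for i
          using \<nu>(2)[of i] s_nonneg[OF e'U] by simp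
        ultimately have "(\<Sum>i<d. (\<nu> i - \<mu> i) * s e' i) = 0" by (meson antisym sum_nonneg)
        then have "\<forall>i\<in>{..<d}. (\<nu> i - \<mu> i) * s e' i = 0" using nn by (subst (asm) sum_nonneg_eq_0_iff) auto
        then have "s e' i = 0" if "i < d" for i
          using \<nu>(3)[OF that] that by (metis diff_gt_0_iff_gt lessThan_iff less_irrefl mult_eq_0_iff)
        then have "dotp d \<mu> (s e') = 0" by (simp add: dotp_def)
        then show ?thesis using \<mu>(2) v_nonneg[OF e'U] by (simp add: dotp_def)
      qed
      \<comment> \<open>All these items are tight at the price \<open>0\<close>, where general
        position leaves only one.\<close>
      have "e' = e" if "e' \<in> M - L" "e' \<notin> Z" for e'
        using general_position zero[OF that] zero[OF e] e that assms(2) curve_orthant[OF zero_in_curve]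
        unfolding general_position_def by blast
      then show ?thesis by (intro exI[of _ e]) blast
    qed blast
    ultimately show ?thesis by blast
  qed
  then show "Z \<subseteq> strict_upper (threshold U) U" "\<exists>e. M - L - {e} \<subseteq> Z" by blast+
qed

end

section \<open>Concentration of the sampled value\<close>

context OA_instance
begin

lemma small_fopt:
  assumes "e \<in> U" shows "p {e} \<le> fo U / (10 ^ 4 * d)"
proof -
  have "p {e} \<le> opt U F g v s / (\<eta> * d)" by (rule small[OF assms])
  also have "\<dots> \<le> fo U / (\<eta> * d)"
    using \<eta> iopt_le_fopt[of U] by (intro divide_right_mono) (auto simp: opt_eq)
  also have "\<dots> \<le> fo U / (10 ^ 4 * d)"
    using \<eta> d_pos fopt_nonneg[of U] by (intro divide_left_mono mult_right_mono) auto
  finally show ?thesis .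
qed

text \<open>The fractional optimum is not additive, so concentration is applied to the additive
  weights of \<open>fopt_base\<close>, which bound it from below on every part of \<open>A\<close>.
  The total weight exceeds 9/10 of \<open>fo A\<close>; if one side has less than 1/4, the two sides
  differ by more than 9/10 - 2/4 = 4/10.\<close>

lemma prob_unbalanced:
  assumes A: "A \<subseteq> U" "fo U / (48 * d) \<le> fo A" and pos: "0 < fo U"
  shows "measure_pmf.prob (pmf_of_set (Pow U)) {L. L \<subseteq> U \<and> (fo (A \<inter> L) < fo A / 4 \<or> fo (A - L) < fo A / 4)} \<le> 1 / 30"
    (is "measure_pmf.prob ?M ?B \<le> _")
proof -
  define m where "m = fo U / (10 ^ 4 * d)"
  have m: "0 \<le> m" "\<And>e. e \<in> U \<Longrightarrow> p {e} \<le> m" using pos small_fopt by (auto simp: m_def)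
  have "0 < fo U / (48 * d)" using pos d_pos by simp
  then have posA: "0 < fo A" using A(2) by linarith
  then have "9 / 10 * fo A < fo A" by simp
  then obtain w where w: "\<And>e. e \<in> A \<Longrightarrow> 0 \<le> w e" "\<And>e. e \<in> A \<Longrightarrow> w e \<le> m"
    "9 / 10 * fo A < sum w A" "sum w A \<le> fo A" "\<And>L. L \<subseteq> A \<Longrightarrow> sum w L \<le> fo L"
    using fopt_base[OF A(1) _ m(2,1)] by blast
  \<comment> \<open>Extension by zero, so that the split is of a uniformly random subset of
    \<open>U\<close>.\<close>
  define w' where "w' = (\<lambda>e. if e \<in> A then w e else 0)"
  have w'_sum: "sum w' X = sum w (A \<inter> X)" if "X \<subseteq> U" for X
    unfolding w'_def using that finite_U finite_subset[of X U]
    by (subst Int_commute, subst sum.inter_restrict) auto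
  define t where "t = 4 / 10 * fo A"
  have t: "0 < t" using posA by (simp add: t_def)
  have "?B \<subseteq> {L. t \<le> \<bar>sum w' L - sum w' (U - L)\<bar>}"
  proof
    fix L assume "L \<in> ?B"
    then have L: "L \<subseteq> U" and cases: "fo (A \<inter> L) < fo A / 4 \<or> fo (A - L) < fo A / 4" by auto
    have finA: "finite A" using A(1) finite_U finite_subset by blast
    have "A \<inter> (U - L) = A - L" using A(1) by auto
    then have eq: "sum w' L = sum w (A \<inter> L)" "sum w' (U - L) = sum w (A - L)"
      using w'_sum[OF L] w'_sum[of "U - L"] by auto
    have "sum w A = sum w (A \<inter> L) + sum w (A - L)" using finA by (rule sum.Int_Diff)
    moreover have "sum w (A \<inter> L) \<le> fo (A \<inter> L)" "sum w (A - L) \<le> fo (A - L)" by (auto intro: w(5))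
    ultimately show "L \<in> {L. t \<le> \<bar>sum w' L - sum w' (U - L)\<bar>}"
      using cases w(3) unfolding mem_Collect_eq eq t_def by linarith
  qed
  then have "measure_pmf.prob ?M ?B \<le> measure_pmf.prob ?M {L. t \<le> \<bar>sum w' L - sum w' (U - L)\<bar>}"
    by (intro measure_pmf.finite_measure_mono) auto
  also have "\<dots> \<le> m * sum w' U / t\<^sup>2"
    using w(1,2) m(1) t by (intro prob_imbalance finite_U) (auto simp: w'_def)
  also have "\<dots> \<le> m * fo A / t\<^sup>2"
    using w'_sum[of U] w(4) m(1) A(1) by (intro divide_right_mono mult_left_mono) (auto simp: Int_absorb2)
  also have "\<dots> = 25 / 4 * m / fo A"
    using posA by (simp add: t_def power2_eq_square field_simps)
  also have "\<dots> \<le> 25 / 4 * m / (fo U / (48 * d))"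
    using A(2) m(1) posA pos d_pos by (intro divide_left_mono) auto
  \<comment> \<open>Here 25/4 * 48 / 10^4 = 3/100.\<close>
  also have "\<dots> \<le> 1 / 30"
    using pos d_pos by (simp add: m_def field_simps)
  finally show ?thesis .
qed

abbreviation "candidate_items L \<equiv> candidates d U F g v s C L (U - L)"

text \<open>Three sets fixed in advance, \<open>U\<close>, \<open>N\<close> and \<open>M\<close>,
  are each unbalanced with probability at most 1/30, so all three are balanced with probability at
  least 9/10.\<close>

lemma good_samples:
  assumes pos: "0 < fo U"
  obtains G where "G \<subseteq> Pow U" "1 / 2 \<le> measure_pmf.prob (pmf_of_set (Pow U)) G"
    "\<And>L. L \<in> G \<Longrightarrow> candidate_items L \<subseteq> strict_upper (threshold U) U"
    "\<And>L. L \<in> G \<Longrightarrow> fo U / (600 * (real d)\<^sup>2) \<le> iopt (candidate_items L)"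
proof -
  let ?M = "pmf_of_set (Pow U)"
  \<comment> \<open>This is the admissibility level \<open>1 / (12 * d)\<close> applied to a sample
    holding only a quarter of \<open>fo U\<close>.\<close>
  define \<kappa> where "\<kappa> = fo U / (48 * d)"
  define N where "N = upper (threshold U) U"
  have d: "1 \<le> real d" using d_pos by simp
  have div_d: "fo U / (real d * x) \<le> fo U / x" if "0 < x" for x
    using pos d that by (intro divide_left_mono) auto
  have \<kappa>U: "\<kappa> \<le> fo U" unfolding \<kappa>_def using pos d by (simp add: field_simps)
  then obtain M where M: "M \<subseteq> U" "\<kappa> \<le> fo M"
    "\<And>\<mu>. \<mu> \<in> C \<Longrightarrow> \<kappa> \<le> fo (items_above d v s \<mu> U) \<Longrightarrow> M \<subseteq> items_above d v s \<mu> U"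
    using minimal_level_set by blast
  have N: "N \<subseteq> U" by (auto simp: N_def items_above_def)
  \<comment> \<open>The factor \<open>2 * d + 1\<close> is simplified to \<open>3 * d\<close>, using
    \<open>d \<ge> 1\<close>.\<close>
  have iopt_lower: "fo X / (3 * d) \<le> y" if "fo X \<le> (2 * d + 1) * y" "X \<subseteq> U" "0 \<le> y" for X and y :: real
  proof -
    have "(2 * real d + 1) * y \<le> 3 * real d * y" using d that(3) by (intro mult_right_mono) auto
    then have "fo X \<le> y * (3 * real d)" using that(1) by (simp add: algebra_simps)
    then show ?thesis using d by (simp add: pos_divide_le_eq)
  qed
  have foN: "fo U / (3 * d) \<le> fo N"
  proof -
    have "fo U / (3 * d) \<le> iopt N"
      using fopt_le_iopt_threshold[of U] iopt_nonneg by (intro iopt_lower) (auto simp: N_def)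
    also have "\<dots> \<le> fo N" by (rule iopt_le_fopt[OF N])
    finally show ?thesis .
  qed
  have \<kappa>N: "\<kappa> \<le> fo N"
  proof -
    have "\<kappa> \<le> fo U / (3 * d)" unfolding \<kappa>_def using pos d by (intro divide_left_mono) auto
    with foN show ?thesis by simp
  qed
  define B where "B = (\<lambda>A. {L. L \<subseteq> U \<and> (fo (A \<inter> L) < fo A / 4 \<or> fo (A - L) < fo A / 4)})"
  \<comment> \<open>Balance of \<open>N\<close> makes the threshold price admissible; balance of \<open>M\<close>, the smallest level set that
    can contain enough value, keeps value in the second phase.\<close>
  define G where "G = Pow U - (B U \<union> B N \<union> B M)"
  have "measure_pmf.prob ?M (Pow U) = 1"
    using finite_U by (subst measure_pmf_of_set) (auto simp: card_Pow)
  moreover have "measure_pmf.prob ?M (Pow U) \<le> measure_pmf.prob ?M (G \<union> (B U \<union> B N \<union> B M))"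
    by (intro measure_pmf.finite_measure_mono) (auto simp: G_def)
  moreover have "\<dots> \<le> measure_pmf.prob ?M G + measure_pmf.prob ?M (B U \<union> B N \<union> B M)"
    by (intro measure_Un_le) auto
  moreover have "measure_pmf.prob ?M (B U \<union> B N \<union> B M) \<le> measure_pmf.prob ?M (B U \<union> B N) + measure_pmf.prob ?M (B M)"
    by (intro measure_Un_le) auto
  moreover have "measure_pmf.prob ?M (B U \<union> B N) \<le> measure_pmf.prob ?M (B U) + measure_pmf.prob ?M (B N)"
    by (intro measure_Un_le) auto
  moreover have "measure_pmf.prob ?M (B A) \<le> 1 / 30" if "A \<subseteq> U" "\<kappa> \<le> fo A" for A
    unfolding B_def using that pos by (intro prob_unbalanced) (auto simp: \<kappa>_def)
  note this[OF order_refl \<kappa>U] this[OF N \<kappa>N] this[OF M(1,2)]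
  ultimately have "1 / 2 \<le> measure_pmf.prob ?M G" by linarith
  moreover have "candidate_items L \<subseteq> strict_upper (threshold U) U \<and> fo U / (600 * (real d)\<^sup>2) \<le> iopt (candidate_items L)" if "L \<in> G" for L
  proof -
    have L: "L \<subseteq> U" and "L \<notin> B U" "L \<notin> B N" "L \<notin> B M" using that by (auto simp: G_def)
    then have fU: "fo U / 4 \<le> fo L" and fN: "fo N / 4 \<le> fo (N \<inter> L)" and fM: "fo M / 4 \<le> fo (M - L)"
      by (auto simp: B_def Int_absorb1)
    have adm: "1 / (12 * real d) * fo L \<le> fo (upper (threshold U) L)"
    proof -
      \<comment> \<open>The constant 12 is the 3 from the lower bound on \<open>fo N\<close> times
        the 4 from the balance of \<open>N\<close>.\<close>
      have "1 / (12 * real d) * fo L \<le> 1 / (12 * real d) * fo U"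
        using fopt_mono[OF L order_refl] by (intro mult_left_mono) auto
      also have "\<dots> = fo U / (3 * d) / 4" by simp
      also have "\<dots> \<le> fo N / 4" using foN by (rule divide_right_mono) simp
      also have "\<dots> \<le> fo (N \<inter> L)" by (rule fN)
      also have "N \<inter> L = upper (threshold U) L" using L by (auto simp: N_def items_above_def)
      finally show ?thesis .
    qed
    have M_sub: "M \<subseteq> items_above d v s \<mu> U"
      if \<mu>: "\<mu> \<in> C" "1 / (12 * real d) * fo L \<le> fo (items_above d v s \<mu> L)" for \<mu>
    proof -
      have "\<kappa> \<le> 1 / (12 * real d) * fo L" using fU d by (simp add: \<kappa>_def field_simps)
      also have "\<dots> \<le> fo (items_above d v s \<mu> L)" by (rule \<mu>(2))
      also have "\<dots> \<le> fo (items_above d v s \<mu> U)"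
        using L by (intro fopt_mono) (auto simp: items_above_def)
      finally show ?thesis by (rule M(3)[OF \<mu>(1)])
    qed
    note bounds = candidates_bounds[OF L M(1) adm M_sub]
    obtain e where e: "M - L - {e} \<subseteq> candidate_items L" using bounds(2) by blast
    have ZU: "candidate_items L \<subseteq> U" using bounds(1) by (auto simp: items_strictly_above_def)
    have "fo (M - L) \<le> fo (M - L - {e}) + fo U / (10 ^ 4 * d)"
    proof (cases "e \<in> U")
      case True
      have "max 0 (p {e}) \<le> fo U / (10 ^ 4 * d)" using small_fopt[OF True] pos by simp
      then show ?thesis using fopt_remove[OF _ True, of "M - L"] M(1) by force
    next
      case False
      then have "M - L - {e} = M - L" using M(1) by auto
      then show ?thesis using pos by simp
    qed
    moreover have "fo (M - L - {e}) \<le> fo (candidate_items L)" by (rule fopt_mono[OF e ZU])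
    moreover have "fo U / (192 * d) \<le> fo M / 4" using M(2) by (simp add: \<kappa>_def)
    \<comment> \<open>The lost item is small: 1/192 - 1/10^4 is still at least 1/200. The
      integrality gap \<open>3 * d\<close> then turns \<open>200 * d\<close> into
      \<open>600 * d^2\<close>.\<close>
    moreover have "fo U / (192 * d) - fo U / (10 ^ 4 * d) \<ge> fo U / (200 * d)"
      using pos d by (simp add: field_simps)
    ultimately have "fo U / (200 * d) \<le> fo (candidate_items L)" using fM by linarith
    then have "fo U / (200 * d) / (3 * d) \<le> fo (candidate_items L) / (3 * d)" by (intro divide_right_mono) auto
    also have "\<dots> \<le> iopt (candidate_items L)"
      using fopt_le_iopt[OF ZU] iopt_nonneg ZU by (intro iopt_lower) auto
    finally show ?thesis using bounds(1) by (simp add: power2_eq_square field_simps)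
  qed
  ultimately show ?thesis using that[of G] by (auto simp: G_def)
qed

end

section \<open>Competitiveness\<close>

locale OA_run = OA_instance +
  fixes \<alpha> :: real and \<A> :: "(nat set \<Rightarrow> real) \<Rightarrow> nat \<Rightarrow> decision_rule"
  assumes \<alpha>_pos: "0 < \<alpha>"
    and submodMS: "submodMS_assumption U F \<alpha> \<A>"
begin

definition second_phase :: "nat set \<Rightarrow> nat set pmf" where
  "second_phase Z = bind_pmf (pmf_of_set (permutations_of_set Z)) (filtered_run p (\<A> p (card Z)) [] {} {})"

lemma submodMS_local:
  assumes "\<And>B. B \<in> F \<Longrightarrow> B \<subseteq> set hist \<Longrightarrow> f B = f' B"
  shows "\<A> f N hist cur = \<A> f' N hist cur"
proof -
  have *: "\<forall>f f' N hist cur. (\<forall>B\<in>F. B \<subseteq> set hist \<longrightarrow> f B = f' B) \<longrightarrow> \<A> f N hist cur = \<A> f' N hist cur"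
    using submodMS unfolding submodMS_assumption_def by (rule conjunct1)
  show ?thesis by (rule *[rule_format]) (rule assms)
qed

lemma submodMS_feasible:
  assumes "ys \<in> permutations_of_set Z" "Z \<subseteq> U"
  shows "set_pmf (online_run (\<A> f (card Z)) [] {} ys) \<subseteq> F"
proof -
  have "distinct ys" "set ys = Z" "length ys = card Z"
    using assms(1) by (auto simp: permutations_of_set_def distinct_card)
  then show ?thesis using submodMS assms(2) unfolding submodMS_assumption_def by metis
qed

lemma submodMS_competitive:
  assumes "Z \<subseteq> U" "\<And>A. A \<subseteq> Z \<Longrightarrow> 0 \<le> f A" "f {} = 0" "mono_on (Pow Z) f" "submodular_on Z f"
  shows "1 / \<alpha> * Max (f ` restrict_family F Z) \<le> measure_pmf.expectation
    (bind_pmf (pmf_of_set (permutations_of_set Z)) (online_run (\<A> f (card Z)) [] {})) f"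
  using submodMS assms unfolding submodMS_assumption_def by blast

text \<open>This holds for every candidate set: the filter never lets the profit drop below that of
  the empty set, so bad samples contribute nonnegatively to the expectation.\<close>

lemma second_phase_support:
  assumes "Z \<subseteq> U" "x \<in> set_pmf (second_phase Z)"
  shows "x \<in> F" "0 \<le> p x"
proof -
  have "finite Z" using assms(1) finite_U finite_subset by blast
  then obtain ys where ys: "ys \<in> permutations_of_set Z" "x \<in> set_pmf (filtered_run p (\<A> p (card Z)) [] {} {} ys)"
    using assms(2) by (auto simp: second_phase_def)
  obtain y where "y \<in> set_pmf (online_run (\<A> p (card Z)) [] {} ys)" "x \<subseteq> y"
    using filtered_run_subset[OF ys(2)] by auto
  then show "x \<in> F" using submodMS_feasible[OF ys(1) assms(1), of p] F_down by blast
  show "0 \<le> p x" using filtered_run_profit[OF ys(2)] by simp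
qed

lemma finite_second_phase: "Z \<subseteq> U \<Longrightarrow> finite (set_pmf (second_phase Z))"
  using second_phase_support(1) finite_subset[OF _ finite_F] by blast

lemma second_phase_expectation_nonneg:
  "Z \<subseteq> U \<Longrightarrow> 0 \<le> measure_pmf.expectation (second_phase Z) p"
  using second_phase_support(2) by (intro integral_nonneg_AE) (auto simp: AE_measure_pmf_iff)

text \<open>The guarantee of \<open>\<A>\<close> concerns a monotone submodular function, while the
  algorithm passes it the profit. On feasible subsets of \<open>Z\<close> the profit equals the
  surrogate \<open>f\<close>, and \<open>\<A>\<close> sees no other values, so its decisions
  coincide. The profit is monotone there too, so the filter is inactive and the two runs have the
  same law.\<close>

lemma second_phase_expectation:
  assumes Z: "Z \<subseteq> strict_upper (threshold U) U"
  shows "1 / \<alpha> * iopt Z \<le> measure_pmf.expectation (second_phase Z) p"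
proof -
  define f where "f = tangent_profit (threshold U)"
  have ZU: "Z \<subseteq> U" using Z by (auto simp: items_strictly_above_def)
  have finZ: "finite Z" using ZU finite_U finite_subset by blast
  have thr: "0 \<le> threshold U" by (intro threshold_nonneg order_refl)
  have f_eq: "f B = p B" if "B \<in> F" "B \<subseteq> Z" for B
    unfolding f_def using that Z by (intro tangent_profit_eq) auto
  have f_mono: "mono_on (Pow Z) f" unfolding f_def using thr Z by (rule tangent_profit_mono)
  have f_empty: "f {} = 0" unfolding f_def using thr by (rule tangent_profit_empty)
  have f_nonneg: "0 \<le> f A" if "A \<subseteq> Z" for A
    using mono_onD[OF f_mono, of "{}" A] that f_empty by simp
  have p_mono: "p A \<le> p B" if "B \<in> F" "B \<subseteq> Z" "A \<subseteq> B" for A B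
    using mono_onD[OF f_mono, of A B] that f_eq[of A] f_eq[of B] F_down by auto
  have run: "filtered_run p (\<A> p (card Z)) [] {} {} ys = online_run (\<A> f (card Z)) [] {} ys"
    if ys: "ys \<in> permutations_of_set Z" for ys
  proof -
    have set: "set ys = Z" using ys by (simp add: permutations_of_set_def)
    have "filtered_run p (\<A> p (card Z)) [] {} {} ys = online_run (\<A> p (card Z)) [] {} ys"
      using submodMS_feasible[OF ys ZU, of p] F_down p_mono set
      by (intro filtered_run_eq_online_run[where F = F and Z = Z]) auto
    also have "\<dots> = online_run (\<A> f (card Z)) [] {} ys"
      using f_eq set by (intro online_run_cong[where Z = Z] submodMS_local) (auto intro: f_eq[symmetric])
    finally show ?thesis .
  qed
  then have eq: "second_phase Z = bind_pmf (pmf_of_set (permutations_of_set Z)) (online_run (\<A> f (card Z)) [] {})"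
    unfolding second_phase_def using finZ by (intro bind_pmf_cong) auto
  have support: "x \<in> F \<and> x \<subseteq> Z" if x: "x \<in> set_pmf (second_phase Z)" for x
  proof -
    obtain ys where ys: "ys \<in> permutations_of_set Z" "x \<in> set_pmf (online_run (\<A> f (card Z)) [] {} ys)"
      using x finZ by (auto simp: eq)
    then show ?thesis
      using online_run_bounds[OF ys(2)] second_phase_support(1)[OF ZU x] by (auto simp: permutations_of_set_def)
  qed
  have "f ` restrict_family F Z = p ` restrict_family F Z"
    using f_eq by (intro image_cong) (auto simp: restrict_family_def)
  then have "1 / \<alpha> * iopt Z = 1 / \<alpha> * Max (f ` restrict_family F Z)" by (simp add: iopt_def)
  also have "\<dots> \<le> measure_pmf.expectation (second_phase Z) f"
    unfolding eq using tangent_profit_submodular[OF thr ZU] f_nonneg f_empty f_mono ZU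
    by (intro submodMS_competitive) (auto simp: f_def)
  also have "\<dots> = measure_pmf.expectation (second_phase Z) p"
    using support f_eq by (intro integral_cong_AE) (auto simp: AE_measure_pmf_iff)
  finally show ?thesis .
qed

lemma cands_subset: "candidate_items L \<subseteq> U"
  using zero_in_curve by (auto simp: candidates_def items_strictly_above_def Let_def)

lemma OA_second_phase: "OA d U F g v s C \<A> = bind_pmf (pmf_of_set (Pow U)) (\<lambda>L. second_phase (candidate_items L))"
proof -
  have "C \<noteq> {}" using zero_in_curve by blast
  then show ?thesis by (simp add: OA_eq[OF finite_U] second_phase_def Let_def)
qed

lemma OA_feasible: "set_pmf (OA d U F g v s C \<A>) \<subseteq> F"
  unfolding OA_second_phase using second_phase_support(1)[OF cands_subset] by auto

text \<open>Only the good samples, of probability at least 1/2, are counted, which doubles the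
  constant 600 of \<open>good_samples\<close>. If \<open>fo U\<close> is not positive, nonnegativity
  of the expectation is enough.\<close>

theorem OA_competitive:
  "opt U F g v s / (1200 * \<alpha> * (real d)\<^sup>2) \<le> measure_pmf.expectation (OA d U F g v s C \<A>) p"
proof -
  define E where "E = (\<lambda>L. measure_pmf.expectation (second_phase (candidate_items L)) p)"
  let ?M = "pmf_of_set (Pow U)"
  have fin: "finite (Pow U)" "Pow U \<noteq> {}" using finite_U by auto
  have E_nonneg: "0 \<le> E L" for L
    unfolding E_def by (rule second_phase_expectation_nonneg[OF cands_subset])
  have exp: "measure_pmf.expectation (OA d U F g v s C \<A>) p = (\<Sum>L\<in>Pow U. pmf ?M L * E L)"
    unfolding OA_second_phase E_def using fin finite_second_phase[OF cands_subset]
    by (subst pmf_expectation_bind[OF fin(1)]) auto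
  have opt_le: "opt U F g v s \<le> fo U" using iopt_le_fopt[of U] by (simp add: opt_eq)
  show ?thesis
  proof (cases "0 < fo U")
    case True
    obtain G where G: "G \<subseteq> Pow U" "1 / 2 \<le> measure_pmf.prob ?M G"
      "\<And>L. L \<in> G \<Longrightarrow> candidate_items L \<subseteq> strict_upper (threshold U) U"
      "\<And>L. L \<in> G \<Longrightarrow> fo U / (600 * (real d)\<^sup>2) \<le> iopt (candidate_items L)"
      using good_samples[OF True] by blast
    define K where "K = 1 / \<alpha> * (fo U / (600 * (real d)\<^sup>2))"
    have K: "0 \<le> K" using True \<alpha>_pos by (simp add: K_def)
    have "opt U F g v s / (1200 * \<alpha> * (real d)\<^sup>2) \<le> fo U / (1200 * \<alpha> * (real d)\<^sup>2)"
      using opt_le \<alpha>_pos by (intro divide_right_mono) auto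
    also have "\<dots> = 1 / 2 * K" by (simp add: K_def)
    also have "\<dots> \<le> measure_pmf.prob ?M G * K" using G(2) K by (rule mult_right_mono)
    also have "\<dots> = (\<Sum>L\<in>G. pmf ?M L * K)"
      using finite_subset[OF G(1) fin(1)] by (simp add: measure_measure_pmf_finite sum_distrib_right)
    also have "\<dots> \<le> (\<Sum>L\<in>G. pmf ?M L * E L)"
    proof (intro sum_mono mult_left_mono)
      fix L assume L: "L \<in> G"
      have "K \<le> 1 / \<alpha> * iopt (candidate_items L)" unfolding K_def using G(4)[OF L] \<alpha>_pos by (intro mult_left_mono) auto
      also have "\<dots> \<le> E L" unfolding E_def by (rule second_phase_expectation[OF G(3)[OF L]])
      finally show "K \<le> E L" .
    qed simp
    also have "\<dots> \<le> (\<Sum>L\<in>Pow U. pmf ?M L * E L)"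
      using G(1) fin E_nonneg by (intro sum_mono2) auto
    finally show ?thesis unfolding exp .
  next
    case False
    then have "opt U F g v s \<le> 0" using opt_le by simp
    then have "opt U F g v s / (1200 * \<alpha> * (real d)\<^sup>2) \<le> 0"
      using \<alpha>_pos by (intro divide_nonpos_nonneg) auto
    also have "0 \<le> (\<Sum>L\<in>Pow U. pmf ?M L * E L)" using E_nonneg by (intro sum_nonneg) auto
    finally show ?thesis unfolding exp .
  qed
qed

end

section \<open>Coordinate costs of a cost function\<close>

lemma coord_cost_derivative:
  assumes "has_gradient d g D (\<lambda>j. if j = i then t else 0)" "i < d" "0 \<le> t"
  shows "(coord_cost g i has_real_derivative D i) (at t within {0..})"
  unfolding has_field_derivative_def has_derivative_within_alt
proof (intro conjI allI impI)
  show "bounded_linear ((*) (D i))" by (rule bounded_linear_mult_right)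
  fix \<epsilon> :: real assume "0 < \<epsilon>"
  then obtain \<delta> where \<delta>: "\<delta> > 0" "\<And>y. y \<in> orthant d \<Longrightarrow>
      L2_set (\<lambda>j. y j - (if j = i then t else 0)) {..<d} < \<delta> \<Longrightarrow>
      \<bar>g y - g (\<lambda>j. if j = i then t else 0) - dotp d D (\<lambda>j. y j - (if j = i then t else 0))\<bar>
        \<le> \<epsilon> * L2_set (\<lambda>j. y j - (if j = i then t else 0)) {..<d}"
    using assms(1) unfolding has_gradient_def by meson
  have "norm (coord_cost g i y - coord_cost g i t - D i * (y - t)) \<le> \<epsilon> * norm (y - t)"
    if y: "y \<in> {0..}" "norm (y - t) < \<delta>" for y
  proof -
    let ?y = "\<lambda>j. if j = i then y else 0"
    have diff: "(\<lambda>j. ?y j - (if j = i then t else 0)) = (\<lambda>j. if j = i then y - t else 0)" by auto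
    have "L2_set (\<lambda>j. if j = i then y - t else 0) {..<d} = sqrt (\<Sum>j<d. if j = i then (y - t)\<^sup>2 else 0)"
      unfolding L2_set_def by (intro arg_cong[of _ _ sqrt] sum.cong) auto
    then have L2: "L2_set (\<lambda>j. if j = i then y - t else 0) {..<d} = \<bar>y - t\<bar>" using assms(2) by simp
    have "dotp d D (\<lambda>j. if j = i then y - t else 0) = (\<Sum>j<d. if j = i then D j * (y - t) else 0)"
      unfolding dotp_def by (intro sum.cong) auto
    then have dot: "dotp d D (\<lambda>j. if j = i then y - t else 0) = D i * (y - t)" using assms(2) by simp
    have "?y \<in> orthant d" using y(1) assms(2) by (auto simp: orthant_def)
    from \<delta>(2)[OF this, unfolded diff L2 dot] y(2) show ?thesis by (simp add: coord_cost_def)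
  qed
  then show "\<exists>\<delta>>0. \<forall>y\<in>{0..}. norm (y - t) < \<delta> \<longrightarrow>
      norm (coord_cost g i y - coord_cost g i t - D i * (y - t)) \<le> \<epsilon> * norm (y - t)"
    using \<delta>(1) by blast
qed

text \<open>Restriction to the \<open>i\<close>-th axis preserves strict convexity, and the slope
  there is the \<open>i\<close>-th gradient component by uniqueness of one-sided derivatives. Its
  divergence is that of the gradient along the unit vector.\<close>

lemma convex_cost_coord_cost:
  assumes "cost_function d g" "i < d"
  shows "convex_cost (coord_cost g i)"
proof -
  let ?u = "\<lambda>t j. if j = i then t else (0::real)"
  have u: "?u t \<in> orthant d" if "0 \<le> t" for t using that assms(2) by (auto simp: orthant_def)
  have g_nonneg: "\<forall>z\<in>orthant d. 0 \<le> g z" and g_zero: "g (\<lambda>_. 0) = 0"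
    and g_convex: "\<forall>x\<in>orthant d. \<forall>y\<in>orthant d. \<forall>t. x \<noteq> y \<and> 0 < t \<and> t < 1 \<longrightarrow>
        g (\<lambda>i. (1 - t) * x i + t * y i) < (1 - t) * g x + t * g y"
    using assms(1) unfolding cost_function_def by - (elim conjE, assumption)+
  have "\<exists>D. (\<forall>z\<in>orthant d. has_gradient d g (D z) z) \<and>
      (\<forall>u\<in>orthant d. u \<noteq> (\<lambda>_. 0) \<longrightarrow> filterlim (\<lambda>t. dotp d (D (\<lambda>i. t * u i)) u) at_top at_top)"
    using assms(1) unfolding cost_function_def by (elim conjE)
  then obtain D where "(\<forall>z\<in>orthant d. has_gradient d g (D z) z) \<and>
      (\<forall>u\<in>orthant d. u \<noteq> (\<lambda>_. 0) \<longrightarrow> filterlim (\<lambda>t. dotp d (D (\<lambda>i. t * u i)) u) at_top at_top)"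
    by (rule exE)
  note D = this[THEN conjunct1, rule_format] this[THEN conjunct2, rule_format]
  have deriv: "(coord_cost g i has_real_derivative D (?u t) i) (at t within {0..})" if "0 \<le> t" for t
    using D(1)[OF u[OF that]] assms(2) that by (rule coord_cost_derivative)
  have slope: "slope (coord_cost g i) t = D (?u t) i" if "0 \<le> t" for t
  proof -
    have "(coord_cost g i has_real_derivative slope (coord_cost g i) t) (at t within {0..})"
      unfolding slope_def using deriv[OF that] by (rule someI)
    then show ?thesis using deriv[OF that] that by (rule has_real_derivative_unique_atLeast)
  qed
  show ?thesis
  proof
    have "(\<lambda>j. if j = i then 0 else (0::real)) = (\<lambda>_. 0)" by auto
    then show "coord_cost g i 0 = 0"
      using g_zero unfolding coord_cost_def by simp
    show "0 \<le> coord_cost g i t" if "0 \<le> t" for t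
      using g_nonneg u[OF that] unfolding coord_cost_def by (rule bspec)
    show "coord_cost g i ((1 - r) * x + r * y) < (1 - r) * coord_cost g i x + r * coord_cost g i y"
      if "0 \<le> x" "0 \<le> y" "x \<noteq> y" "0 < r" "r < 1" for x y r
    proof -
      have "?u x \<noteq> ?u y" using that(3) by metis
      then have "g (\<lambda>j. (1 - r) * ?u x j + r * ?u y j) < (1 - r) * g (?u x) + r * g (?u y)"
        using g_convex[rule_format, OF u[OF that(1)] u[OF that(2)], of r] that(4,5) by simp
      moreover have "(\<lambda>j. (1 - r) * ?u x j + r * ?u y j) = ?u ((1 - r) * x + r * y)" by auto
      ultimately show ?thesis by (simp add: coord_cost_def)
    qed
    show "\<exists>D. (coord_cost g i has_real_derivative D) (at t within {0..})" if "0 \<le> t" for t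
      using deriv[OF that] by blast
    have "?u 1 \<noteq> (\<lambda>_. 0)" by (metis zero_neq_one)
    then have "filterlim (\<lambda>t. dotp d (D (\<lambda>j. t * ?u 1 j)) (?u 1)) at_top at_top"
      using u[of 1] by (intro D(2)) auto
    moreover have "\<forall>\<^sub>F t in at_top. dotp d (D (\<lambda>j. t * ?u 1 j)) (?u 1) = slope (coord_cost g i) t"
      using eventually_ge_at_top[of 0]
    proof eventually_elim
      case (elim t)
      have "(\<lambda>j. t * ?u 1 j) = ?u t" by auto
      then have "dotp d (D (\<lambda>j. t * ?u 1 j)) (?u 1) = (\<Sum>j<d. if j = i then D (?u t) j else 0)"
        unfolding dotp_def by (intro sum.cong) auto
      then show ?case using slope[OF elim] assms(2) by simp
    qed
    ultimately show "filterlim (slope (coord_cost g i)) at_top at_top"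
      by (rule filterlim_cong[THEN iffD1, OF refl refl, rotated])
  qed
qed

theorem mainTheorem5:
  shows "\<exists>K>0. \<forall>(d::nat) (U::nat set) (F::nat set set) (g::rvec \<Rightarrow> real) (v::nat \<Rightarrow> real)
           (s::nat \<Rightarrow> rvec) (\<eta>::real) (\<alpha>::real) (C::rvec set)
           (\<A>::(nat set \<Rightarrow> real) \<Rightarrow> nat \<Rightarrow> decision_rule).
     d \<ge> 1 \<longrightarrow> finite U \<longrightarrow> (\<forall>e\<in>U. v e \<ge> 0 \<and> s e \<in> orthant d) \<longrightarrow>
     matroid U F \<longrightarrow> separable d g \<longrightarrow>
     \<eta> \<ge> 10 ^ 4 \<longrightarrow> standing_assumption d U F g v s \<eta> \<longrightarrow>
     price_curve d g C \<longrightarrow>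
     \<alpha> > 0 \<longrightarrow> submodMS_assumption U F \<alpha> \<A> \<longrightarrow>
       set_pmf (OA d U F g v s C \<A>) \<subseteq> F \<and>
       measure_pmf.expectation (OA d U F g v s C \<A>) (set_profit U g v s)
         \<ge> opt U F g v s / (K * \<alpha> * (real d)\<^sup>2)"
proof (intro exI[of _ "1200::real"] conjI[of "0 < (1200::real)"] allI impI)
  show "0 < (1200::real)" by simp
  fix d :: nat and U :: "nat set" and F :: "nat set set" and g :: "rvec \<Rightarrow> real" and v :: "nat \<Rightarrow> real"
    and s :: "nat \<Rightarrow> rvec" and \<eta> \<alpha> :: real and C :: "rvec set"
    and \<A> :: "(nat set \<Rightarrow> real) \<Rightarrow> nat \<Rightarrow> decision_rule"
  assume d: "d \<ge> 1" and U: "finite U" and items: "\<forall>e\<in>U. v e \<ge> 0 \<and> s e \<in> orthant d"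
    and matroid: "matroid U F" and g: "separable d g" and \<eta>: "\<eta> \<ge> 10 ^ 4"
    and standing: "standing_assumption d U F g v s \<eta>" and C: "price_curve d g C" and \<alpha>: "\<alpha> > 0"
    and \<A>: "submodMS_assumption U F \<alpha> \<A>"
  have F: "F \<subseteq> Pow U" "{} \<in> F" "\<forall>A\<in>F. \<forall>B. B \<subseteq> A \<longrightarrow> B \<in> F"
    using matroid by (simp_all add: matroid_def)
  have "cost_function d g" and gp: "general_position d U v s"
    and exc: "\<forall>e\<in>U. \<not> exceptional g v s e"
    and small: "\<forall>e\<in>U. set_profit U g v s {e} \<le> opt U F g v s / (\<eta> * real d)"
    using standing by (simp_all add: standing_assumption_def)
  then have convex: "convex_cost (coord_cost g i)" if "i < d" for i
    using that by (intro convex_cost_coord_cost)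
  interpret OA_run d U F g v s C \<eta> \<alpha> \<A>
    by (intro OA_run.intro OA_instance.intro profit_instance.intro OA_instance_axioms.intro OA_run_axioms.intro)
      (fact d U F g \<eta> C \<alpha> \<A> gp items[rule_format, THEN conjunct1] items[rule_format, THEN conjunct2]
        exc[rule_format] small[rule_format] convex)+
  show "set_pmf (OA d U F g v s C \<A>) \<subseteq> F \<and>
      opt U F g v s / (1200 * \<alpha> * (real d)\<^sup>2) \<le> measure_pmf.expectation (OA d U F g v s C \<A>) (set_profit U g v s)"
    using OA_feasible OA_competitive by blast
qed

end
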